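(* Let $\lambda$ and $\mu$ be partitions in $\Lambda^+(n,r)$ and choose a natural number $m$ such that $\lambda_1,\mu_1\le m$. Then $$(M^\lambda:Y^\mu)=(M^{\hat\lambda}:Y^{\hat\mu}).$$ Consequently, the column and row removal formulas for $p$-Kostka numbers hold true, that is: (Column removal) if $\lambda,\mu\in\Lambda^+(n,r)$ have $\lambda_n\ne 0$ and $\mu_n\neq 0$, then $(M^\lambda:Y^\mu)=(M^{\tilde\lambda}:Y^{\tilde\mu})$ with $\tilde\lambda=(\lambda_1-1,\dots,\lambda_n-1)$ and $\tilde\mu=(\mu_1-1,\dots,\mu_n-1)$; (Row removal) if $\lambda,\mu\in\Lambda^+(n,r)$ have $\lambda_1=\mu_1$, then $(M^\lambda:Y^\mu)=(M^{\bar\lambda}:Y^{\bar\mu})$ with $\bar\lambda=(\lambda_2,\dots,\lambda_n)$ and $\bar\mu=(\mu_2,\dots,\mu_n)$.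
   Context: $k$ is an infinite field (of characteristic $p$). $\Lambda^+(n,r)$ is the set of partitions $\lambda=(\lambda_1\ge\dots\ge\lambda_n\ge0)$ of $r$ with at most $n$ parts. For a partition $\lambda$ of $r$, the permutation module $M^\lambda$ is the $k\Sigma_r$-module obtained by inducing the trivial module from the Young subgroup $\Sigma_\lambda$ to the symmetric group $\Sigma_r$. The Young module $Y^\mu$ is the unique indecomposable direct summand of $M^\mu$ that contains the Specht module $S^\mu\subseteq M^\mu$ as a submodule. Each $M^\lambda$ is a direct sum of Young modules $Y^\mu$ with $\mu\ge\lambda$ in the dominance order; the $p$-Kostka number $(M^\lambda:Y^\mu)$ is the multiplicity of $Y^\mu$, up to isomorphism, in a decomposition of $M^\lambda$ into indecomposable summands. For $\lambda=(\lambda_1,\dots,\lambda_n)$ with $\lambda_1\le m$, $\hat\lambda=(m-\lambda_n,m-\lambda_{n-1},\dots,m-\lambda_1)$, a partition of $nm-r$. *)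

theory Defs
  imports
    "HOL-Algebra.Sym_Groups"
    "HOL-Library.Function_Algebras"
    "HOL-Library.Indicator_Function"
begin

section \<open>Modules over a group algebra\<close>

text \<open>
  A linear representation of a group \<open>G\<close> on a vector space. The modules considered below are
  the \<open>G\<close>-stable subspaces of one ambient representation; there is no finiteness or semisimplicity
  assumption.
\<close>

locale linear_rep = vector_space scale + group G
  for scale :: "'k::field \<Rightarrow> 'v::ab_group_add \<Rightarrow> 'v"
    and G :: "('g, 'b) monoid_scheme"
    and act :: "'g \<Rightarrow> 'v \<Rightarrow> 'v" +
  assumes act_add: "g \<in> carrier G \<Longrightarrow> act g (u + v) = act g u + act g v"
    and act_scale: "g \<in> carrier G \<Longrightarrow> act g (scale c v) = scale c (act g v)"
    and act_one: "act (one G) v = v"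
    and act_mult: "\<lbrakk>g \<in> carrier G; h \<in> carrier G\<rbrakk> \<Longrightarrow> act (mult G g h) v = act g (act h v)"
begin

definition submodule :: "'v set \<Rightarrow> bool" where
  "submodule U \<longleftrightarrow> subspace U \<and> (\<forall>g\<in>carrier G. \<forall>u\<in>U. act g u \<in> U)"

definition iso_modules :: "'v set \<Rightarrow> 'v set \<Rightarrow> bool" where
  "iso_modules U W \<longleftrightarrow>
     (\<exists>\<phi>. bij_betw \<phi> U W \<and>
          (\<forall>u\<in>U. \<forall>v\<in>U. \<phi> (u + v) = \<phi> u + \<phi> v) \<and>
          (\<forall>c. \<forall>u\<in>U. \<phi> (scale c u) = scale c (\<phi> u)) \<and>
          (\<forall>g\<in>carrier G. \<forall>u\<in>U. \<phi> (act g u) = act g (\<phi> u)))"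

definition direct_sum :: "'v set set \<Rightarrow> 'v set \<Rightarrow> bool" where
  "direct_sum \<D> M \<longleftrightarrow>
     (\<forall>U\<in>\<D>. submodule U) \<and> span (\<Union>\<D>) = M \<and> (\<forall>U\<in>\<D>. U \<inter> span (\<Union>(\<D> - {U})) = {0})"

definition direct_summand :: "'v set \<Rightarrow> 'v set \<Rightarrow> bool" where
  "direct_summand U M \<longleftrightarrow>
     submodule U \<and> (\<exists>W. submodule W \<and> U \<inter> W = {0} \<and> {u + w |u w. u \<in> U \<and> w \<in> W} = M)"

definition indecomposable :: "'v set \<Rightarrow> bool" where
  "indecomposable U \<longleftrightarrow>
     submodule U \<and> U \<noteq> {0} \<and> (\<forall>A. direct_summand A U \<longrightarrow> A = {0} \<or> A = U)"

text \<open>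
  Independence of the chosen decomposition is the Krull--Schmidt theorem, which is what makes the
  definite description below meaningful (for finite-dimensional \<open>M\<close>). The summands may be taken
  as a set since nonzero submodules with a direct sum are pairwise distinct.
\<close>

definition multiplicity :: "'v set \<Rightarrow> 'v set \<Rightarrow> nat" where
  "multiplicity M Y =
     (THE c. \<exists>\<D>. finite \<D> \<and> (\<forall>U\<in>\<D>. indecomposable U) \<and> direct_sum \<D> M \<and>
                 c = card {U \<in> \<D>. iso_modules U Y})"

end

section \<open>Induced modules\<close>

text \<open>
  The module induced from a representation \<open>\<rho>\<close> of a subgroup \<open>H\<close> on \<open>'w\<close>, in its function model:
  the \<open>H\<close>-equivariant functions on \<open>G\<close>, with \<open>G\<close> acting by left translation. (For the finite groups
  used here this is the tensor product of the group algebra with \<open>'w\<close> over the subalgebra of \<open>H\<close>;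
  \<open>g \<otimes> w\<close> corresponds to the function supported on \<open>g H\<close> with value \<open>w\<close> at \<open>g\<close>.) Functions are
  set to \<open>0\<close> outside the carrier.
\<close>

definition induced :: "('g, 'b) monoid_scheme \<Rightarrow> 'g set \<Rightarrow> ('g \<Rightarrow> 'w \<Rightarrow> 'w) \<Rightarrow> ('g \<Rightarrow> 'w::zero) set" where
  "induced G H \<rho> =
     {f. (\<forall>x\<in>carrier G. \<forall>h\<in>H. f (x \<otimes>\<^bsub>G\<^esub> h) = \<rho> (inv\<^bsub>G\<^esub> h) (f x)) \<and>
         (\<forall>x. x \<notin> carrier G \<longrightarrow> f x = 0)}"

definition translate :: "('g, 'b) monoid_scheme \<Rightarrow> 'g \<Rightarrow> ('g \<Rightarrow> 'w) \<Rightarrow> ('g \<Rightarrow> 'w)" where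
  "translate G g f = (\<lambda>x. f (inv\<^bsub>G\<^esub> g \<otimes>\<^bsub>G\<^esub> x))"

definition fscale :: "'k::field \<Rightarrow> ('g \<Rightarrow> 'k) \<Rightarrow> ('g \<Rightarrow> 'k)" where
  "fscale c f = (\<lambda>x. c * f x)"

interpretation sym: linear_rep fscale "sym_group r" "translate (sym_group r)" for r
proof -
  have vs: "vector_space (fscale :: 'k \<Rightarrow> ('g \<Rightarrow> 'k) \<Rightarrow> ('g \<Rightarrow> 'k::field))"
    by unfold_locales (auto simp: fscale_def fun_eq_iff algebra_simps)
  have *: "inv\<^bsub>sym_group r\<^esub> (g \<otimes>\<^bsub>sym_group r\<^esub> h) = inv\<^bsub>sym_group r\<^esub> h \<circ> inv\<^bsub>sym_group r\<^esub> g"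
    if "g \<in> carrier (sym_group r)" "h \<in> carrier (sym_group r)" for g h
    using group.inv_mult_group[OF sym_group_is_group that] by (simp add: sym_group_mult)
  have one: "inv\<^bsub>sym_group r\<^esub> (one (sym_group r)) = id"
    using monoid.inv_one[OF group.is_monoid[OF sym_group_is_group, of r]] by (simp add: sym_group_one)
  show "linear_rep (fscale :: 'k \<Rightarrow> ((nat \<Rightarrow> nat) \<Rightarrow> 'k) \<Rightarrow> ((nat \<Rightarrow> nat) \<Rightarrow> 'k::field))
          (sym_group r) (translate (sym_group r))"
    apply (intro linear_rep.intro linear_rep_axioms.intro vs sym_group_is_group)
       apply (auto simp: translate_def fscale_def one *)
     apply (simp_all add: sym_group_mult comp_assoc)
    done
qed

section \<open>Partitions\<close>

text \<open>
  Partitions with at most \<open>n\<close> parts are weakly decreasing lists of length exactly \<open>n\<close>, padded by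
  zeros. The part \<open>\<lambda>\<^sub>i\<close> is the list entry with index \<open>i - 1\<close>.
\<close>

definition partitions :: "nat \<Rightarrow> nat \<Rightarrow> nat list set" where
  "partitions n r = {lam. length lam = n \<and> sorted_wrt (\<ge>) lam \<and> sum_list lam = r}"

definition complement :: "nat \<Rightarrow> nat list \<Rightarrow> nat list" where
  "complement m lam = map (\<lambda>a. m - a) (rev lam)"

definition remove_column :: "nat list \<Rightarrow> nat list" where
  "remove_column lam = map (\<lambda>a. a - 1) lam"

definition remove_row :: "nat list \<Rightarrow> nat list" where
  "remove_row lam = tl lam"

lemma complement_in_partitions:
  assumes "lam \<in> partitions n r" "\<forall>a\<in>set lam. a \<le> m"
  shows "complement m lam \<in> partitions n (n * m - r)"
proof -
  have "sum_list (map (\<lambda>a. m - a) xs) + sum_list xs = length xs * m"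
    if "\<forall>a\<in>set xs. a \<le> m" for xs :: "nat list"
    using that by (induction xs) auto
  from this[of "rev lam"] assms have "sum_list (complement m lam) = n * m - r"
    by (auto simp: complement_def partitions_def sum_list_rev)
  moreover have "sorted_wrt (\<ge>) (complement m lam)"
    using assms by (auto simp: complement_def partitions_def sorted_wrt_map sorted_wrt_rev
        intro: sorted_wrt_mono_rel[rotated])
  ultimately show ?thesis
    using assms by (simp add: complement_def partitions_def)
qed

section \<open>Young, permutation and Specht modules\<close>

text \<open>
  Rows and columns (indexed from \<open>0\<close> and \<open>1\<close> respectively) of the \<open>\<lambda>\<close>-tableau in which
  \<open>1, \<dots>, r\<close> are entered row by row.
\<close>

definition tableau_row :: "nat list \<Rightarrow> nat \<Rightarrow> nat set" where
  "tableau_row lam i = {sum_list (take i lam) + j |j. 1 \<le> j \<and> j \<le> lam ! i}"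

definition tableau_column :: "nat list \<Rightarrow> nat \<Rightarrow> nat set" where
  "tableau_column lam j = {sum_list (take i lam) + j |i. i < length lam \<and> j \<le> lam ! i}"

definition young_subgroup :: "nat list \<Rightarrow> (nat \<Rightarrow> nat) set" where
  "young_subgroup lam =
     {p \<in> carrier (sym_group (sum_list lam)).
        \<forall>i<length lam. p ` tableau_row lam i = tableau_row lam i}"

definition column_stabilizer :: "nat list \<Rightarrow> (nat \<Rightarrow> nat) set" where
  "column_stabilizer lam =
     {p \<in> carrier (sym_group (sum_list lam)).
        \<forall>j\<ge>1. p ` tableau_column lam j = tableau_column lam j}"

definition perm_module :: "nat list \<Rightarrow> ((nat \<Rightarrow> nat) \<Rightarrow> 'k::field) set" where
  "perm_module lam = induced (sym_group (sum_list lam)) (young_subgroup lam) (\<lambda>_ c. c)"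

lemma submodule_perm_module:
  "sym.submodule (sum_list lam) (perm_module lam :: ((nat \<Rightarrow> nat) \<Rightarrow> 'k::field) set)"
proof -
  define r where "r = sum_list lam"
  have out: "x \<in> carrier (sym_group r)"
    if "inv\<^bsub>sym_group r\<^esub> g \<otimes>\<^bsub>sym_group r\<^esub> x \<in> carrier (sym_group r)" "g \<in> carrier (sym_group r)" for g x
  proof -
    have "g \<otimes>\<^bsub>sym_group r\<^esub> (inv\<^bsub>sym_group r\<^esub> g \<otimes>\<^bsub>sym_group r\<^esub> x) = x"
      using sym.r_inv[OF that(2)] by (metis sym_group_mult comp_assoc sym_group_one id_comp)
    then show ?thesis using that sym.m_closed by metis
  qed
  show ?thesis
    unfolding sym.submodule_def sym.subspace_def perm_module_def induced_def r_def[symmetric]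
  proof (intro conjI ballI)
    fix g and u :: "(nat \<Rightarrow> nat) \<Rightarrow> 'k"
    assume g: "g \<in> carrier (sym_group r)"
      and u: "u \<in> {f. (\<forall>x\<in>carrier (sym_group r). \<forall>h\<in>young_subgroup lam.
                         f (x \<otimes>\<^bsub>sym_group r\<^esub> h) = f x) \<and>
                      (\<forall>x. x \<notin> carrier (sym_group r) \<longrightarrow> f x = 0)}"
    show "translate (sym_group r) g u \<in> {f. (\<forall>x\<in>carrier (sym_group r). \<forall>h\<in>young_subgroup lam.
                         f (x \<otimes>\<^bsub>sym_group r\<^esub> h) = f x) \<and>
                      (\<forall>x. x \<notin> carrier (sym_group r) \<longrightarrow> f x = 0)}"
    proof (intro CollectI conjI ballI allI impI)
      fix x h assume x: "x \<in> carrier (sym_group r)" and h: "h \<in> young_subgroup lam"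
      have c: "inv\<^bsub>sym_group r\<^esub> g \<otimes>\<^bsub>sym_group r\<^esub> x \<in> carrier (sym_group r)"
        using x g by (intro sym.m_closed sym.inv_closed)
      have "inv\<^bsub>sym_group r\<^esub> g \<otimes>\<^bsub>sym_group r\<^esub> (x \<otimes>\<^bsub>sym_group r\<^esub> h) =
            (inv\<^bsub>sym_group r\<^esub> g \<otimes>\<^bsub>sym_group r\<^esub> x) \<otimes>\<^bsub>sym_group r\<^esub> h"
        by (simp add: sym_group_mult comp_assoc)
      then show "translate (sym_group r) g u (x \<otimes>\<^bsub>sym_group r\<^esub> h) = translate (sym_group r) g u x"
        unfolding translate_def using u c h by force
    next
      fix x assume "x \<notin> carrier (sym_group r)"
      then show "translate (sym_group r) g u x = 0"
        unfolding translate_def using u out g by blast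
    qed
  qed (auto simp: fscale_def)
qed

text \<open>
  The tabloid of the \<open>\<lambda>\<close>-tableau \<open>g t\<close>, where \<open>t\<close> is the tableau above, is the
  coset \<open>g \<Sigma>\<^sub>\<lambda>\<close>, i.e. the basis element \<open>g \<otimes> 1\<close> of the induced module.
\<close>

definition tabloid :: "nat list \<Rightarrow> (nat \<Rightarrow> nat) \<Rightarrow> (nat \<Rightarrow> nat) \<Rightarrow> 'k::field" where
  "tabloid lam g = indicator (g <#\<^bsub>sym_group (sum_list lam)\<^esub> young_subgroup lam)"

definition polytabloid :: "nat list \<Rightarrow> (nat \<Rightarrow> nat) \<Rightarrow> 'k::field" where
  "polytabloid lam = (\<Sum>p\<in>column_stabilizer lam. fscale (of_int (sign p)) (tabloid lam p))"

text \<open>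
  The polytabloid of the tableau \<open>g t\<close> is the \<open>g\<close>-translate of the polytabloid of \<open>t\<close>, so
  this is the span of all \<open>\<lambda>\<close>-polytabloids.
\<close>

definition specht_module :: "nat list \<Rightarrow> ((nat \<Rightarrow> nat) \<Rightarrow> 'k::field) set" where
  "specht_module lam =
     sym.span ((\<lambda>g. translate (sym_group (sum_list lam)) g (polytabloid lam))
                 ` carrier (sym_group (sum_list lam)))"

lemma specht_module_subset:
  "(specht_module lam :: ((nat \<Rightarrow> nat) \<Rightarrow> 'k::field) set) \<subseteq> perm_module lam"
proof -
  define r where "r = sum_list lam"
  have sub: "subgroup (young_subgroup lam) (sym_group r)"
  proof (intro sym.subgroupI)
    show "young_subgroup lam \<subseteq> carrier (sym_group r)"
      by (auto simp: young_subgroup_def r_def)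
    have "id \<in> young_subgroup lam"
      by (auto simp: young_subgroup_def sym_group_carrier permutes_id)
    then show "young_subgroup lam \<noteq> {}" by blast
  next
    fix a assume a: "a \<in> young_subgroup lam"
    then have c: "a \<in> carrier (sym_group r)" by (auto simp: young_subgroup_def r_def)
    then have "bij a" by (auto simp: sym_group_carrier permutes_bij)
    then have "inv' a ` S = S" if "a ` S = S" for S
      using that by (metis bij_is_inj image_inv_f_f)
    then have "inv' a \<in> young_subgroup lam"
      using a c sym_group_inv_closed by (auto simp: young_subgroup_def r_def)
    then show "inv\<^bsub>sym_group r\<^esub> a \<in> young_subgroup lam" using c by simp
  next
    fix a b assume ab: "a \<in> young_subgroup lam" "b \<in> young_subgroup lam"
    have 1: "(a \<circ> b) ` S = S" if "a ` S = S" "b ` S = S" for S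
      by (simp only: image_comp[symmetric] that)
    have 2: "a \<circ> b permutes {1..sum_list lam}"
      using ab by (intro permutes_compose) (simp_all add: young_subgroup_def sym_group_carrier)
    have "(a \<circ> b) ` tableau_row lam i = tableau_row lam i" if "i < length lam" for i
      using ab that by (intro 1) (simp_all add: young_subgroup_def)
    with 2 show "a \<otimes>\<^bsub>sym_group r\<^esub> b \<in> young_subgroup lam"
      unfolding young_subgroup_def sym_group_mult sym_group_carrier by blast
  qed
  have tab: "(tabloid lam p :: (nat \<Rightarrow> nat) \<Rightarrow> 'k) \<in> perm_module lam"
    if p: "p \<in> carrier (sym_group r)" for p
  proof -
    let ?C = "p <#\<^bsub>sym_group r\<^esub> young_subgroup lam"
    have C: "?C \<subseteq> carrier (sym_group r)"
      using p sub by (simp add: sym.l_coset_subset_G subgroup.subset)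
    have "x \<otimes>\<^bsub>sym_group r\<^esub> h \<in> ?C \<longleftrightarrow> x \<in> ?C"
      if "x \<in> carrier (sym_group r)" "h \<in> young_subgroup lam" for x h
    proof -
      have h: "h \<in> carrier (sym_group r)" using that sub subgroup.subset by blast
      have 1: "y \<otimes>\<^bsub>sym_group r\<^esub> k \<in> ?C" if y: "y \<in> ?C" and k: "k \<in> young_subgroup lam" for y k
      proof -
        obtain z where z: "z \<in> young_subgroup lam" "y = p \<otimes>\<^bsub>sym_group r\<^esub> z"
          using y by (auto simp: l_coset_def)
        then have "y \<otimes>\<^bsub>sym_group r\<^esub> k = p \<otimes>\<^bsub>sym_group r\<^esub> (z \<otimes>\<^bsub>sym_group r\<^esub> k)"
          by (simp add: sym_group_mult comp_assoc)
        then show ?thesis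
          using subgroup.m_closed[OF sub z(1) k] by (auto simp: l_coset_def)
      qed
      have inv: "inv\<^bsub>sym_group r\<^esub> h \<in> young_subgroup lam"
        by (rule subgroup.m_inv_closed[OF sub that(2)])
      have "h \<otimes>\<^bsub>sym_group r\<^esub> inv\<^bsub>sym_group r\<^esub> h = id"
        using sym.r_inv[OF h] by (simp only: sym_group_one)
      then have "(x \<otimes>\<^bsub>sym_group r\<^esub> h) \<otimes>\<^bsub>sym_group r\<^esub> inv\<^bsub>sym_group r\<^esub> h = x"
        by (simp only: sym_group_mult comp_assoc comp_id)
      then show ?thesis
        using 1[OF _ inv, of "x \<otimes>\<^bsub>sym_group r\<^esub> h"] 1[OF _ that(2), of x] by argo
    qed
    moreover have "x \<notin> ?C" if "x \<notin> carrier (sym_group r)" for x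
      using that C by blast
    ultimately show ?thesis
      unfolding perm_module_def induced_def tabloid_def r_def[symmetric] indicator_def by simp
  qed
  note M = submodule_perm_module[of lam, where 'k = 'k, unfolded sym.submodule_def]
  have "(polytabloid lam :: (nat \<Rightarrow> nat) \<Rightarrow> 'k) \<in> perm_module lam"
    unfolding polytabloid_def
    by (rule sym.subspace_sum[OF conjunct1[OF M]], rule sym.subspace_scale[OF conjunct1[OF M]],
        rule tab) (simp add: column_stabilizer_def r_def)
  then show ?thesis
    unfolding specht_module_def
    by (intro sym.span_minimal[OF _ conjunct1[OF M]] image_subsetI) (use M in blast)
qed

text \<open>
  As a subset of the permutation module the Young module is determined only up to isomorphism
  (complements may be changed), hence a choice rather than a definite description. Only its
  isomorphism class enters the multiplicity below.
\<close>

definition young_module :: "nat list \<Rightarrow> ((nat \<Rightarrow> nat) \<Rightarrow> 'k::field) set" where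
  "young_module mu =
     (SOME Y. sym.indecomposable (sum_list mu) Y \<and>
              sym.direct_summand (sum_list mu) Y (perm_module mu) \<and>
              specht_module mu \<subseteq> Y)"

text \<open>
  The \<open>p\<close>-Kostka number \<open>(M\<^sup>\<lambda> : Y\<^sup>\<mu>)\<close> over the field \<open>'k\<close>, for partitions of the same number; its
  dependence on \<open>p\<close> is through the characteristic of \<open>'k\<close>.
\<close>

definition kostka :: "'k::field itself \<Rightarrow> nat list \<Rightarrow> nat list \<Rightarrow> nat" where
  "kostka _ lam mu =
     sym.multiplicity (sum_list lam) (perm_module lam :: ((nat \<Rightarrow> nat) \<Rightarrow> 'k) set) (young_module mu)"

end

theory Submission
  imports Defs "Jordan_Normal_Form.Determinant"
begin

text \<open>
  Let \<open>e\<close> be the standard polytabloid in \<open>M\<^sup>\<mu>\<close>. Every endomorphism of \<open>M\<^sup>\<mu>\<close> multiplies \<open>e\<close> by a scalar,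
  and \<open>Y\<^sup>\<mu>\<close> is the summand of \<open>M\<^sup>\<mu>\<close> containing \<open>e\<close>; hence \<open>(M\<^sup>\<lambda> : Y\<^sup>\<mu>)\<close> is the rank of the pairing
  \<open>(f, g) \<mapsto> \<chi> (g \<circ> f)\<close> of \<open>Hom (M\<^sup>\<mu>, M\<^sup>\<lambda>)\<close> with \<open>Hom (M\<^sup>\<lambda>, M\<^sup>\<mu>)\<close>, where \<open>\<chi>\<close> is that scalar.
  Homomorphisms between permutation modules are bi-invariant functions on the symmetric group, and
  since \<open>k\<close> is infinite these are spanned by monomials in the entries of invertible \<open>n \<times> n\<close> matrices.
  On monomials the pairing becomes the kernel \<open>K (g, h)\<close> given by the coefficient of \<open>\<zeta>\<^sup>\<lambda>\<close> in
  \<open>\<Delta>\<^sub>\<mu> (h diag(\<zeta>) g)\<close>, where \<open>\<Delta>\<^sub>\<mu>\<close> is the product, over the columns of \<open>\<mu>\<close>, of the leading minors whose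
  sizes are the column heights. Jacobi's identity for complementary minors of the inverse turns \<open>\<Delta>\<^sub>\<mu>\<close>
  into a power of the determinant times the function for the complementary partition, evaluated at
  the reversed inverse transpose. So the kernels for \<open>(\<lambda>, \<mu>)\<close> and for the complementary pair agree up to
  nonzero scalars and a reparametrization of \<open>GL\<^sub>n\<close>, and have equal rank.
  Column removal is complementation with \<open>m\<close> followed by complementation with \<open>m - 1\<close>; row removal is
  complementation, deletion of a zero part, and complementation again.
\<close>

section \<open>Kernels and their rank\<close>

text \<open>The two sides of the identity live over symmetric groups of different degrees,
  \<open>r\<close> and \<open>n * m - r\<close>, so the modules cannot be compared directly. A rank
  survives the passage, because it can be computed on any spanning sets of the two Hom spaces, and
  invertible matrices index such sets for both pairs. Duality inverts matrices, which is why the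
  spanning argument stays inside the invertible ones. The scalar \<chi> exists by James's argument:
  in the signed column sum of any vector, a tabloid with two entries of one column in one row has
  coefficient zero, and every other tabloid is a column translate of the standard one. Summands not
  isomorphic to the Young module contribute nothing to the pairing, since by Fitting's lemma a
  nonzero value of \<chi> would split the Young module off from them. The complement of \<lambda>
  arises from the power of the determinant: the diagonal matrix contributes the product of all
  variables to the power m, the inverse matrix contributes inverse variables, and so an exponent
  \<lambda>_i on one side meets m - \<lambda>_i on the other. Reversing the matrix puts these parts
  into decreasing order.\<close>

interpretation fn: vector_space "fscale :: 'k::field \<Rightarrow> ('a \<Rightarrow> 'k) \<Rightarrow> 'a \<Rightarrow> 'k"
  by unfold_locales (auto simp: fscale_def fun_eq_iff algebra_simps)

text \<open>Rows are cut off outside \<open>Y\<close>, so that as vectors they see \<open>K\<close>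
  on \<open>Y\<close> only. The rank below is the dimension of a row space because \<open>X\<close>
  and \<open>Y\<close> may be infinite.\<close>

definition kernel_row :: "('a \<Rightarrow> 'b \<Rightarrow> 'k::field) \<Rightarrow> 'b set \<Rightarrow> 'a \<Rightarrow> 'b \<Rightarrow> 'k" where
  "kernel_row K Y x = (\<lambda>y. if y \<in> Y then K x y else 0)"

definition kernel_rank :: "('a \<Rightarrow> 'b \<Rightarrow> 'k::field) \<Rightarrow> 'a set \<Rightarrow> 'b set \<Rightarrow> nat" where
  "kernel_rank K X Y = fn.dim (kernel_row K Y ` X)"

lemma sum_fun_apply: "(\<Sum>i\<in>I. f i) x = (\<Sum>i\<in>I. f i x)"
  by (induction I rule: infinite_finite_induct) auto

text \<open>A rank factorization: evaluation at the points \<open>g j\<close> separates the rows of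
  the \<open>f i\<close>, which are therefore independent, and \<open>factor\<close> writes every
  row as a combination of them.\<close>

lemma kernel_rank_eq_card:
  fixes K :: "'a \<Rightarrow> 'b \<Rightarrow> 'k::field"
  assumes I: "finite I"
    and f: "\<And>i. i \<in> I \<Longrightarrow> f i \<in> X" and g: "\<And>i. i \<in> I \<Longrightarrow> g i \<in> Y"
    and dual: "\<And>i j. \<lbrakk>i \<in> I; j \<in> I\<rbrakk> \<Longrightarrow> K (f i) (g j) = (if i = j then 1 else 0)"
    and factor: "\<And>x y. \<lbrakk>x \<in> X; y \<in> Y\<rbrakk> \<Longrightarrow> K x y = (\<Sum>i\<in>I. K x (g i) * K (f i) y)"
  shows "kernel_rank K X Y = card I"
proof -
  let ?r = "kernel_row K Y"
  let ?B = "(\<lambda>i. ?r (f i)) ` I"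
  have val: "?r (f i) (g j) = (if i = j then 1 else 0)" if "i \<in> I" "j \<in> I" for i j
    using that g dual by (simp add: kernel_row_def)
  have inj: "inj_on (\<lambda>i. ?r (f i)) I"
    by (rule inj_onI) (metis val zero_neq_one)
  have "fn.independent ?B"
  proof (rule fn.independent_if_scalars_zero)
    show "finite ?B" using I by simp
    fix c b assume s: "(\<Sum>b\<in>?B. fscale (c b) b) = 0" and b: "b \<in> ?B"
    from b obtain j where j: "j \<in> I" "b = ?r (f j)" by auto
    have "0 = (\<Sum>b\<in>?B. fscale (c b) b) (g j)" using s by simp
    also have "\<dots> = (\<Sum>i\<in>I. c (?r (f i)) * ?r (f i) (g j))"
      by (simp add: sum.reindex[OF inj] sum_fun_apply fscale_def)
    also have "\<dots> = (\<Sum>i\<in>I. if i = j then c (?r (f i)) else 0)"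
      by (rule sum.cong) (use val j in auto)
    also have "\<dots> = c b" using I j by simp
    finally show "c b = 0" by simp
  qed
  moreover have "?B \<subseteq> ?r ` X" using f by auto
  moreover have "?r ` X \<subseteq> fn.span ?B"
  proof
    fix v assume "v \<in> ?r ` X"
    then obtain x where x: "x \<in> X" "v = ?r x" by auto
    have "?r x = (\<Sum>i\<in>I. fscale (K x (g i)) (?r (f i)))"
      using factor[OF x(1)] by (auto simp: fun_eq_iff sum_fun_apply kernel_row_def fscale_def)
    then show "v \<in> fn.span ?B"
      unfolding x by (auto intro!: fn.span_sum fn.span_scale intro: fn.span_base)
  qed
  ultimately have "fn.dim (?r ` X) = card ?B" by (metis fn.dim_unique)
  then show ?thesis using card_image[OF inj] by (simp add: kernel_rank_def)
qed

lemma fn_dim_image_eq: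
  fixes S :: "('a \<Rightarrow> 'k::field) set" and R :: "('a \<Rightarrow> 'k) \<Rightarrow> ('b \<Rightarrow> 'k)"
  assumes lin: "Vector_Spaces.linear fscale fscale R"
    and inj: "inj_on R (fn.span S)"
  shows "fn.dim (R ` S) = fn.dim S"
proof -
  interpret vector_space_pair "fscale :: 'k \<Rightarrow> ('a \<Rightarrow> 'k) \<Rightarrow> 'a \<Rightarrow> 'k"
      "fscale :: 'k \<Rightarrow> ('b \<Rightarrow> 'k) \<Rightarrow> 'b \<Rightarrow> 'k" ..
  obtain B where B: "B \<subseteq> S" "fn.independent B" "S \<subseteq> fn.span B" "card B = fn.dim S"
    using fn.basis_exists by blast
  have sp: "fn.span B \<subseteq> fn.span S" using B(1) fn.span_mono by blast
  have "fn.independent (R ` B)"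
    using linear_independent_injective_image[OF lin B(2)] inj_on_subset[OF inj sp] by blast
  moreover have "R ` S \<subseteq> fn.span (R ` B)"
    using linear_span_image[OF lin, of B] B(3) by blast
  moreover have "card (R ` B) = card B"
    by (rule card_image, rule inj_on_subset[OF inj]) (use B(1) fn.span_superset in blast)
  ultimately show ?thesis using B by (metis fn.dim_unique image_mono)
qed

text \<open>By the first spanning hypothesis the rows at values of \<open>P\<close> have the full
  row space. By the second, an element of the row space that vanishes at all points
  \<open>Q b\<close> vanishes on \<open>Y\<close>, so restricting the columns is injective there.
  This allows a form to be tested on functions that merely span.\<close>

lemma kernel_rank_transport:
  fixes K :: "'a \<Rightarrow> 'b \<Rightarrow> 'k::field" and P :: "'c \<Rightarrow> 'a" and Q :: "'d \<Rightarrow> 'b"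
  assumes P: "P ` A \<subseteq> X" and Q: "Q ` B \<subseteq> Y"
    and rows: "\<And>x. x \<in> X \<Longrightarrow> kernel_row K Y x \<in> fn.span ((\<lambda>a. kernel_row K Y (P a)) ` A)"
    and cols: "\<And>y. y \<in> Y \<Longrightarrow> kernel_row (\<lambda>y x. K x y) X y \<in>
                 fn.span ((\<lambda>b. kernel_row (\<lambda>y x. K x y) X (Q b)) ` B)"
  shows "kernel_rank (\<lambda>a b. K (P a) (Q b)) A B = kernel_rank K X Y"
proof -
  define R :: "('b \<Rightarrow> 'k) \<Rightarrow> 'd \<Rightarrow> 'k" where "R \<phi> = (\<lambda>b. if b \<in> B then \<phi> (Q b) else 0)" for \<phi>
  have lin: "Vector_Spaces.linear fscale fscale R"
    unfolding Vector_Spaces.linear_iff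
    by (auto simp: R_def fscale_def fun_eq_iff fn.vector_space_axioms)
  let ?S = "(\<lambda>a. kernel_row K Y (P a)) ` A"
  have row: "kernel_row (\<lambda>a b. K (P a) (Q b)) B a = R (kernel_row K Y (P a))" for a
    using Q by (auto simp: kernel_row_def R_def fun_eq_iff)
  have span_eq: "fn.span (kernel_row K Y ` X) = fn.span ?S"
  proof (rule antisym)
    show "fn.span (kernel_row K Y ` X) \<subseteq> fn.span ?S"
      by (rule fn.span_minimal) (use rows in auto)
    show "fn.span ?S \<subseteq> fn.span (kernel_row K Y ` X)"
      by (rule fn.span_mono) (use P in auto)
  qed
  \<comment> \<open>A linear relation between columns, valid at all points of \<open>X\<close>, is
    inherited by every combination of rows.\<close>
  have eval: "(\<Sum>b\<in>T. c b * \<phi> (q b)) = \<phi> y"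
    if \<phi>: "\<phi> \<in> fn.span ?S" and y: "y \<in> Y" and q: "\<And>b. b \<in> T \<Longrightarrow> q b \<in> Y"
      and e: "\<And>x. x \<in> X \<Longrightarrow> (\<Sum>b\<in>T. c b * K x (q b)) = K x y" for \<phi> y c q and T :: "('a \<Rightarrow> 'k) set"
    using \<phi>
  proof (induction \<phi> rule: fn.span_induct_alt)
    case base then show ?case by simp
  next
    case (step k s \<psi>)
    then obtain a where a: "a \<in> A" "s = kernel_row K Y (P a)" by auto
    have "(\<Sum>b\<in>T. c b * s (q b)) = (\<Sum>b\<in>T. c b * K (P a) (q b))"
      by (rule sum.cong) (use a q in \<open>auto simp: kernel_row_def\<close>)
    also have "\<dots> = K (P a) y" using e P a by auto
    finally have "(\<Sum>b\<in>T. c b * s (q b)) = s y" using a y by (simp add: kernel_row_def)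
    then show ?case using step.IH
      by (simp add: fscale_def algebra_simps sum.distrib flip: sum_distrib_left)
  qed
  have inj: "inj_on R (fn.span ?S)"
  proof -
    have *: "\<phi> = 0" if \<phi>: "\<phi> \<in> fn.span ?S" and z: "R \<phi> = 0" for \<phi>
    proof
      fix y
      show "\<phi> y = 0 y"
      proof (cases "y \<in> Y")
        case False
        have "\<phi> y = 0" using \<phi>
          by (induction \<phi> rule: fn.span_induct_alt) (use False in \<open>auto simp: kernel_row_def fscale_def\<close>)
        then show ?thesis by simp
      next
        case True
        let ?c = "\<lambda>b. kernel_row (\<lambda>y x. K x y) X (Q b)"
        from cols[OF True] obtain T c where T: "finite T" "T \<subseteq> ?c ` B"
          "kernel_row (\<lambda>y x. K x y) X y = (\<Sum>v\<in>T. fscale (c v) v)"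
          unfolding fn.span_explicit by blast
        have "\<forall>v\<in>T. \<exists>b\<in>B. v = ?c b" using T(2) by auto
        then obtain q where q: "\<And>v. v \<in> T \<Longrightarrow> q v \<in> B" "\<And>v. v \<in> T \<Longrightarrow> v = ?c (q v)" by metis
        have "(\<Sum>v\<in>T. c v * K x (Q (q v))) = K x y" if x: "x \<in> X" for x
        proof -
          have "K x y = (\<Sum>v\<in>T. c v * v x)"
            using arg_cong[OF T(3), of "\<lambda>h. h x"] x by (simp add: kernel_row_def sum_fun_apply fscale_def)
          also have "\<dots> = (\<Sum>v\<in>T. c v * K x (Q (q v)))"
          proof (rule sum.cong)
            fix v assume "v \<in> T"
            from q(2)[OF this] have "v x = ?c (q v) x" by simp
            then show "c v * v x = c v * K x (Q (q v))" using x by (simp add: kernel_row_def)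
          qed simp
          finally show ?thesis by simp
        qed
        then have "\<phi> y = (\<Sum>v\<in>T. c v * \<phi> (Q (q v)))"
          using eval[OF \<phi> True, of T "\<lambda>v. Q (q v)" c] q Q by fastforce
        also have "\<dots> = 0"
        proof (rule sum.neutral, rule ballI)
          fix v assume "v \<in> T"
          then show "c v * \<phi> (Q (q v)) = 0"
            using fun_cong[OF z, of "q v"] q(1)[of v] by (simp add: R_def)
        qed
        finally show ?thesis by simp
      qed
    qed
    show ?thesis
    proof (intro inj_onI)
      fix a b assume ab: "a \<in> fn.span ?S" "b \<in> fn.span ?S" "R a = R b"
      have "R (a - b) = R a - R b" by (auto simp: R_def fun_eq_iff)
      then have "a - b = 0" by (intro *) (simp_all add: ab fn.span_diff)
      then show "a = b" by simp
    qed
  qed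
  have "kernel_rank (\<lambda>a b. K (P a) (Q b)) A B = fn.dim (R ` ?S)"
    by (simp add: kernel_rank_def row image_image)
  also have "\<dots> = fn.dim ?S" by (rule fn_dim_image_eq[OF lin inj])
  also have "\<dots> = kernel_rank K X Y"
    unfolding kernel_rank_def using span_eq fn.span_eq_dim by metis
  finally show ?thesis .
qed

lemma kernel_rank_cong:
  assumes "\<And>x y. \<lbrakk>x \<in> X; y \<in> Y\<rbrakk> \<Longrightarrow> K x y = K' x y"
  shows "kernel_rank K X Y = kernel_rank K' X Y"
proof -
  have "kernel_row K Y ` X = kernel_row K' Y ` X"
    by (rule image_cong) (use assms in \<open>auto simp: kernel_row_def fun_eq_iff\<close>)
  then show ?thesis by (simp add: kernel_rank_def)
qed

lemma kernel_rank_surj: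
  fixes K :: "'a \<Rightarrow> 'b \<Rightarrow> 'k::field"
  assumes "P ` A = X" "Q ` B = Y"
  shows "kernel_rank (\<lambda>a b. K (P a) (Q b)) A B = kernel_rank K X Y"
  by (rule kernel_rank_transport) (use assms in \<open>auto intro!: fn.span_base\<close>)

lemma kernel_rank_scale:
  fixes K :: "'a \<Rightarrow> 'b \<Rightarrow> 'k::field"
  assumes c: "\<And>x. x \<in> X \<Longrightarrow> c x \<noteq> 0" and d: "\<And>y. y \<in> Y \<Longrightarrow> d y \<noteq> 0"
  shows "kernel_rank (\<lambda>x y. c x * d y * K x y) X Y = kernel_rank K X Y"
proof -
  text \<open>Scaling by \<open>c\<close> and \<open>d\<close> is a reparametrization of the kernel extended to pairs.\<close>
  define K' where "K' = (\<lambda>(a, x) (b, y). a * b * K x y)"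
  let ?X = "(UNIV :: 'k set) \<times> X" and ?Y = "(UNIV :: 'k set) \<times> Y"
  have r': "kernel_row K' ?Y (a, x) = fscale (a / e) (kernel_row K' ?Y (e, x))"
    and l': "kernel_row (\<lambda>y x. K' x y) ?X (b, y) = fscale (b / e) (kernel_row (\<lambda>y x. K' x y) ?X (e, y))"
    if "e \<noteq> 0" for a b x y e
    using that by (auto simp: K'_def kernel_row_def fscale_def fun_eq_iff)
  \<comment> \<open>Generalized over \<open>c\<close> and \<open>d\<close>: the instance with
    constant value 1 gives the unscaled kernel, and both have the rank of \<open>K'\<close>.\<close>
  have *: "kernel_rank (\<lambda>x y. K' (c x, x) (d y, y)) X Y = kernel_rank K' ?X ?Y"
    if c: "\<And>x. x \<in> X \<Longrightarrow> c x \<noteq> 0" and d: "\<And>y. y \<in> Y \<Longrightarrow> d y \<noteq> 0" for c d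
  proof (rule kernel_rank_transport)
    fix x assume "x \<in> ?X"
    then show "kernel_row K' ?Y x \<in> fn.span ((\<lambda>a. kernel_row K' ?Y (c a, a)) ` X)"
    proof (cases x)
      case (Pair a z)
      then have "z \<in> X" using \<open>x \<in> ?X\<close> by simp
      then show ?thesis unfolding Pair r'[OF c[OF \<open>z \<in> X\<close>], of a z]
        by (intro fn.span_scale fn.span_base imageI)
    qed
  next
    fix y assume "y \<in> ?Y"
    then show "kernel_row (\<lambda>y x. K' x y) ?X y \<in> fn.span ((\<lambda>b. kernel_row (\<lambda>y x. K' x y) ?X (d b, b)) ` Y)"
    proof (cases y)
      case (Pair a z)
      then have "z \<in> Y" using \<open>y \<in> ?Y\<close> by simp
      then show ?thesis unfolding Pair l'[OF d[OF \<open>z \<in> Y\<close>], of a z]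
        by (intro fn.span_scale fn.span_base imageI)
    qed
  qed auto
  show ?thesis using *[of c d] *[of "\<lambda>_. 1" "\<lambda>_. 1"] c d by (simp add: K'_def)
qed

section \<open>Finite-dimensional subspaces\<close>

context linear_rep
begin

text \<open>The ambient space may be infinite-dimensional, and \<open>dim\<close> returns 0 on
  subspaces without a finite basis; statements about \<open>dim\<close> therefore carry this
  predicate.\<close>

definition findim :: "'v set \<Rightarrow> bool" where
  "findim U \<longleftrightarrow> (\<exists>B. finite B \<and> U \<subseteq> span B)"

lemma findim_subset: "\<lbrakk>findim U; A \<subseteq> U\<rbrakk> \<Longrightarrow> findim A"
  unfolding findim_def by blast

lemma findim_independent:
  assumes "findim U" "\<not> dependent S" "S \<subseteq> U"
  shows "finite S \<and> card S \<le> dim U"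
proof -
  obtain C where C: "finite C" "U \<subseteq> span C" using assms(1) by (auto simp: findim_def)
  obtain B where B: "B \<subseteq> U" "\<not> dependent B" "U \<subseteq> span B" "card B = dim U"
    using basis_exists by blast
  have "finite B" using independent_span_bound[OF C(1) B(2)] B C by blast
  then show ?thesis using independent_span_bound[of B S] assms B by (metis subset_trans)
qed

lemma findim_dim_mono:
  assumes "findim U" "A \<subseteq> U"
  shows "dim A \<le> dim U"
proof -
  obtain B where "B \<subseteq> A" "\<not> dependent B" "card B = dim A"
    using basis_exists[of A] by metis
  then show ?thesis using findim_independent[OF assms(1), of B] assms(2) by simp
qed

lemma findim_dim_less:
  assumes "findim U" "subspace A" "A \<subset> U"
  shows "dim A < dim U"
proof -
  obtain B where B: "B \<subseteq> A" "\<not> dependent B" "A \<subseteq> span B" "card B = dim A"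
    using basis_exists by blast
  obtain x where x: "x \<in> U" "x \<notin> A" using assms by blast
  have "span B \<subseteq> A" by (rule span_minimal) (use B assms in auto)
  then have x': "x \<notin> span B" using x by blast
  then have "\<not> dependent (insert x B)" using B(2) independent_insertI by blast
  moreover have "finite B" using findim_independent[of U B] B assms by blast
  moreover have "x \<notin> B" using x B by blast
  moreover have "insert x B \<subseteq> U" using B x assms by blast
  ultimately show ?thesis using findim_independent[OF assms(1), of "insert x B"] B(4) by simp
qed

lemma findim_stabilize_decreasing:
  fixes S :: "nat \<Rightarrow> 'v set"
  assumes fd: "findim (S 0)" and sub: "\<And>n. subspace (S n)" and dec: "\<And>m n. m \<le> n \<Longrightarrow> S n \<subseteq> S m"
  shows "\<exists>N. \<forall>n\<ge>N. S n = S N"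
proof -
  obtain N where N: "\<And>n. dim (S N) \<le> dim (S n)"
    using ex_has_least_nat[of "\<lambda>_. True" 0 "\<lambda>n. dim (S n)"] by auto
  have "S n = S N" if "n \<ge> N" for n
    using findim_dim_less[of "S N" "S n"] N[of n] sub dec[OF that] dec[of 0 N] findim_subset[OF fd]
    by (metis le0 linorder_not_less psubsetI)
  then show ?thesis by blast
qed

lemma findim_stabilize_increasing:
  fixes S :: "nat \<Rightarrow> 'v set"
  assumes fd: "findim U" and SU: "\<And>n. S n \<subseteq> U"
    and sub: "\<And>n. subspace (S n)" and inc: "\<And>m n. m \<le> n \<Longrightarrow> S m \<subseteq> S n"
  shows "\<exists>N. \<forall>n\<ge>N. S n = S N"
proof -
  have "\<forall>n. True \<longrightarrow> dim (S n) < Suc (dim U)" using findim_dim_mono[OF fd SU] by (simp add: less_Suc_eq_le)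
  from ex_has_greatest_nat[OF TrueI this] obtain N where N: "\<And>n. dim (S n) \<le> dim (S N)" by blast
  have "S n = S N" if "n \<ge> N" for n
    using findim_dim_less[of "S n" "S N"] N[of n] sub inc[OF that] findim_subset[OF fd SU]
    by (metis linorder_not_less psubsetI)
  then show ?thesis by blast
qed

section \<open>Decompositions of modules\<close>

text \<open>Values off \<open>U\<close> are unconstrained, so different elements can restrict to the
  same homomorphism. The ranks taken below are unaffected, since repeated rows and columns do not
  change a rank.\<close>

definition homs :: "'v set \<Rightarrow> 'v set \<Rightarrow> ('v \<Rightarrow> 'v) set" where
  "homs U W = {\<phi>. (\<forall>u\<in>U. \<phi> u \<in> W) \<and>
     (\<forall>u\<in>U. \<forall>v\<in>U. \<phi> (u + v) = \<phi> u + \<phi> v) \<and>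
     (\<forall>c. \<forall>u\<in>U. \<phi> (scale c u) = scale c (\<phi> u)) \<and>
     (\<forall>g\<in>carrier G. \<forall>u\<in>U. \<phi> (act g u) = act g (\<phi> u))}"

lemma homs_mem: "\<lbrakk>\<phi> \<in> homs U W; u \<in> U\<rbrakk> \<Longrightarrow> \<phi> u \<in> W"
  and homs_add: "\<lbrakk>\<phi> \<in> homs U W; u \<in> U; v \<in> U\<rbrakk> \<Longrightarrow> \<phi> (u + v) = \<phi> u + \<phi> v"
  and homs_scale: "\<lbrakk>\<phi> \<in> homs U W; u \<in> U\<rbrakk> \<Longrightarrow> \<phi> (scale c u) = scale c (\<phi> u)"
  and homs_act: "\<lbrakk>\<phi> \<in> homs U W; u \<in> U; g \<in> carrier G\<rbrakk> \<Longrightarrow> \<phi> (act g u) = act g (\<phi> u)"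
  unfolding homs_def by blast+

lemma submoduleD:
  assumes "submodule U"
  shows "subspace U" "0 \<in> U" "\<And>u v. \<lbrakk>u \<in> U; v \<in> U\<rbrakk> \<Longrightarrow> u + v \<in> U" "\<And>u v. \<lbrakk>u \<in> U; v \<in> U\<rbrakk> \<Longrightarrow> u - v \<in> U"
    "\<And>c u. u \<in> U \<Longrightarrow> scale c u \<in> U" "\<And>g u. \<lbrakk>g \<in> carrier G; u \<in> U\<rbrakk> \<Longrightarrow> act g u \<in> U"
  using assms unfolding submodule_def by (auto simp: subspace_0 subspace_add subspace_diff subspace_scale)

lemma homs_zero: "\<lbrakk>\<phi> \<in> homs U W; submodule U\<rbrakk> \<Longrightarrow> \<phi> 0 = 0"
  using homs_scale[of \<phi> U W 0 0] submoduleD(2)[of U] by simp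

lemma homs_diff:
  assumes "\<phi> \<in> homs U W" "submodule U" "u \<in> U" "v \<in> U"
  shows "\<phi> (u - v) = \<phi> u - \<phi> v"
  using homs_add[OF assms(1) submoduleD(4)[OF assms(2-4)] assms(4)] by simp

lemma homs_sum:
  assumes "\<phi> \<in> homs U W" "submodule U" "\<And>i. i \<in> I \<Longrightarrow> u i \<in> U"
  shows "\<phi> (\<Sum>i\<in>I. u i) = (\<Sum>i\<in>I. \<phi> (u i))"
  using assms(3)
proof (induction I rule: infinite_finite_induct)
  case (insert i I)
  then have "(\<Sum>i\<in>I. u i) \<in> U" using subspace_sum[OF submoduleD(1)[OF assms(2)], of I u] by auto
  then show ?case using insert homs_add[OF assms(1)] by simp
qed (auto simp: homs_zero[OF assms(1,2)])

lemma homs_comp: "\<lbrakk>\<phi> \<in> homs U V; \<psi> \<in> homs V W\<rbrakk> \<Longrightarrow> \<psi> \<circ> \<phi> \<in> homs U W"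
  unfolding homs_def by simp

lemma homs_subset: "\<lbrakk>\<phi> \<in> homs U W; U' \<subseteq> U; W \<subseteq> W'\<rbrakk> \<Longrightarrow> \<phi> \<in> homs U' W'"
  unfolding homs_def by blast

lemma homs_funpow: "\<phi> \<in> homs U U \<Longrightarrow> \<phi> ^^ n \<in> homs U U"
  by (induction n) (auto simp: homs_comp homs_def)

lemma submodule_image:
  assumes \<phi>: "\<phi> \<in> homs U W" and U: "submodule U"
  shows "submodule (\<phi> ` U)"
  unfolding submodule_def subspace_def
proof (intro conjI ballI allI)
  show "0 \<in> \<phi> ` U" using homs_zero[OF \<phi> U] submoduleD(2)[OF U] by (auto intro: image_eqI[of _ _ 0])
next
  fix x y assume "x \<in> \<phi> ` U" "y \<in> \<phi> ` U"
  then obtain a b where "a \<in> U" "b \<in> U" "x = \<phi> a" "y = \<phi> b" by blast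
  then show "x + y \<in> \<phi> ` U"
    using submoduleD(3)[OF U] homs_add[OF \<phi>] by (intro image_eqI[of _ _ "a + b"]) auto
next
  fix c x assume "x \<in> \<phi> ` U"
  then obtain a where "a \<in> U" "x = \<phi> a" by blast
  then show "scale c x \<in> \<phi> ` U"
    using submoduleD(5)[OF U] homs_scale[OF \<phi>] by (intro image_eqI[of _ _ "scale c a"]) auto
next
  fix g x assume g: "g \<in> carrier G" and "x \<in> \<phi> ` U"
  then obtain a where "a \<in> U" "x = \<phi> a" by blast
  then show "act g x \<in> \<phi> ` U"
    using submoduleD(6)[OF U g] homs_act[OF \<phi> _ g] by (intro image_eqI[of _ _ "act g a"]) auto
qed

lemma act_zero: "g \<in> carrier G \<Longrightarrow> act g 0 = 0"
  using act_scale[of g 0 0] by simp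

lemma submodule_kernel:
  assumes "\<phi> \<in> homs U W" and U: "submodule U"
  shows "submodule {u \<in> U. \<phi> u = 0}"
  unfolding submodule_def subspace_def
  using submoduleD[OF U] assms by (simp add: homs_zero homs_add homs_scale homs_act act_zero)

lemma submodule_span_Union:
  assumes D: "\<forall>U\<in>D. submodule U"
  shows "submodule (span (\<Union>D))"
  unfolding submodule_def
proof (intro conjI ballI)
  fix g u assume g: "g \<in> carrier G" and "u \<in> span (\<Union>D)"
  from this(2) show "act g u \<in> span (\<Union>D)"
  proof (induction u rule: span_induct_alt)
    case base then show ?case using g by (simp add: act_zero span_zero)
  next
    case (step c x y)
    then obtain X where "X \<in> D" "x \<in> X" by blast
    then have "act g x \<in> \<Union>D" using D g submoduleD(6)[of X g x] by blast
    then show ?case using step.IH g by (simp add: act_add act_scale span_add span_scale span_base)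
  qed
qed simp

section \<open>Projections onto direct summands\<close>

lemma split_projection:
  assumes U: "submodule U" and W: "submodule W" and z: "U \<inter> W = {0}"
  shows "\<exists>p \<in> homs {u + w |u w. u \<in> U \<and> w \<in> W} U. (\<forall>u\<in>U. p u = u) \<and> (\<forall>w\<in>W. p w = 0)"
proof -
  define p where "p x = (SOME u. u \<in> U \<and> (\<exists>w\<in>W. x = u + w))" for x
  have p: "p (u + w) = u" if u: "u \<in> U" and w: "w \<in> W" for u w
  proof -
    have "\<exists>v. v \<in> U \<and> (\<exists>w'\<in>W. u + w = v + w')" using that by blast
    from someI_ex[OF this] obtain w' where v: "p (u + w) \<in> U" "w' \<in> W" "u + w = p (u + w) + w'"
      unfolding p_def by blast
    then have "u - p (u + w) = w' - w" by (simp add: algebra_simps)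
    moreover have "u - p (u + w) \<in> U" "w' - w \<in> W" using submoduleD(4) U W u w v by auto
    ultimately have "u - p (u + w) \<in> U \<inter> W" by auto
    then show ?thesis using z by simp
  qed
  have "p \<in> homs {u + w |u w. u \<in> U \<and> w \<in> W} U"
    unfolding homs_def
  proof (intro CollectI conjI ballI allI; clarify?)
    fix u w assume "u \<in> U" "w \<in> W"
    then show "p (u + w) \<in> U" by (simp add: p)
  next
    fix u w u' w' assume a: "u \<in> U" "w \<in> W" "u' \<in> U" "w' \<in> W"
    have e: "u + w + (u' + w') = (u + u') + (w + w')" by (simp add: algebra_simps)
    show "p (u + w + (u' + w')) = p (u + w) + p (u' + w')"
      unfolding e using a submoduleD(3)[OF U] submoduleD(3)[OF W] by (simp add: p)
  next
    fix c u w assume "u \<in> U" "w \<in> W"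
    then show "p (scale c (u + w)) = scale c (p (u + w))"
      using submoduleD(5)[OF U] submoduleD(5)[OF W] by (simp add: p scale_right_distrib)
  next
    fix g u w assume "g \<in> carrier G" "u \<in> U" "w \<in> W"
    then show "p (act g (u + w)) = act g (p (u + w))"
      using submoduleD(6)[OF U] submoduleD(6)[OF W] by (simp add: p act_add)
  qed
  moreover have "p u = u" if "u \<in> U" for u using p[OF that submoduleD(2)[OF W]] by simp
  moreover have "p w = 0" if "w \<in> W" for w using p[OF submoduleD(2)[OF U] that] by simp
  ultimately show ?thesis by blast
qed

lemma direct_sum_split:
  assumes D: "direct_sum D M" and U: "U \<in> D"
  defines "W \<equiv> span (\<Union>(D - {U}))"
  shows "submodule U" "submodule W" "U \<inter> W = {0}" "{u + w |u w. u \<in> U \<and> w \<in> W} = M"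
proof -
  show sU: "submodule U" and "submodule W" "U \<inter> W = {0}"
    using D U by (auto simp: direct_sum_def W_def intro!: submodule_span_Union)
  have "\<Union>D = U \<union> \<Union>(D - {U})" using U by blast
  then have "M = {x + y |x y. x \<in> span U \<and> y \<in> W}"
    using D span_Un[of U "\<Union>(D - {U})"] by (simp add: direct_sum_def W_def)
  then show "{u + w |u w. u \<in> U \<and> w \<in> W} = M"
    using submoduleD(1)[OF sU] by (simp add: span_eq_iff[THEN iffD2])
qed

lemma direct_sum_projections:
  assumes "direct_sum D M"
  obtains p where "\<And>U. U \<in> D \<Longrightarrow> p U \<in> homs M U" "\<And>U u. \<lbrakk>U \<in> D; u \<in> U\<rbrakk> \<Longrightarrow> p U u = u"
    "\<And>U V v. \<lbrakk>U \<in> D; V \<in> D; V \<noteq> U; v \<in> V\<rbrakk> \<Longrightarrow> p U v = 0"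
proof -
  have ex: "\<forall>U\<in>D. \<exists>p. p \<in> homs M U \<and> (\<forall>u\<in>U. p u = u) \<and> (\<forall>V\<in>D. V \<noteq> U \<longrightarrow> (\<forall>v\<in>V. p v = 0))"
  proof
    fix U assume U: "U \<in> D"
    let ?W = "span (\<Union>(D - {U}))"
    note W = direct_sum_split[OF assms U]
    obtain p where "p \<in> homs M U" "\<forall>u\<in>U. p u = u" "\<forall>w\<in>?W. p w = 0"
      using split_projection[OF W(1-3)] unfolding W(4) by blast
    moreover have "v \<in> ?W" if "V \<in> D" "V \<noteq> U" "v \<in> V" for V v
      using that by (auto intro!: span_base)
    ultimately show "\<exists>p. p \<in> homs M U \<and> (\<forall>u\<in>U. p u = u) \<and> (\<forall>V\<in>D. V \<noteq> U \<longrightarrow> (\<forall>v\<in>V. p v = 0))"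
      by blast
  qed
  from bchoice[OF ex] show ?thesis using that by metis
qed

lemma direct_sum_subset: "\<lbrakk>direct_sum D M; U \<in> D\<rbrakk> \<Longrightarrow> U \<subseteq> M"
  unfolding direct_sum_def using span_superset[of "\<Union>D"] by blast

lemma direct_sum_submodule: "direct_sum D M \<Longrightarrow> submodule M"
  unfolding direct_sum_def using submodule_span_Union by blast

lemma direct_sum_projections_sum:
  assumes D: "direct_sum D M" "finite D"
    and p: "\<And>U. U \<in> D \<Longrightarrow> p U \<in> homs M U" "\<And>U u. \<lbrakk>U \<in> D; u \<in> U\<rbrakk> \<Longrightarrow> p U u = u"
      "\<And>U V v. \<lbrakk>U \<in> D; V \<in> D; V \<noteq> U; v \<in> V\<rbrakk> \<Longrightarrow> p U v = 0"
    and x: "x \<in> M"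
  shows "(\<Sum>U\<in>D. p U x) = x"
proof -
  have M: "M = span (\<Union>D)" using D by (simp add: direct_sum_def)
  have sM: "submodule M" using direct_sum_submodule[OF D(1)] .
  have "x \<in> M \<and> (\<Sum>U\<in>D. p U x) = x"
    using x[unfolded M]
  proof (induction x rule: span_induct_alt)
    case base
    then show ?case using homs_zero[OF p(1) sM] submoduleD(2)[OF sM] by simp
  next
    case (step c v y)
    then obtain V where V: "V \<in> D" "v \<in> V" by blast
    have vM: "v \<in> M" using direct_sum_subset[OF D(1)] V by blast
    have "(\<Sum>U\<in>D. p U v) = (\<Sum>U\<in>D. if U = V then v else 0)"
      by (rule sum.cong) (use V p in auto)
    then have v: "(\<Sum>U\<in>D. p U v) = v" using V D(2) by simp
    have "(\<Sum>U\<in>D. p U (scale c v + y)) = (\<Sum>U\<in>D. scale c (p U v) + p U y)"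
    proof (rule sum.cong)
      fix U assume U: "U \<in> D"
      show "p U (scale c v + y) = scale c (p U v) + p U y"
        using homs_add[OF p(1)[OF U] submoduleD(5)[OF sM vM]] homs_scale[OF p(1)[OF U] vM] step.IH
        by simp
    qed simp
    also have "\<dots> = scale c (\<Sum>U\<in>D. p U v) + (\<Sum>U\<in>D. p U y)"
      by (simp add: sum.distrib scale_sum_right)
    also have "\<dots> = scale c v + y" using v step.IH by simp
    finally show ?case using vM step.IH submoduleD(3,5)[OF sM] by simp
  qed
  then show ?thesis by simp
qed

lemma direct_sum_Un:
  assumes A: "direct_sum A M" and B: "direct_sum B N" and z: "M \<inter> N = {0}"
  shows "direct_sum (A \<union> B) {u + w |u w. u \<in> M \<and> w \<in> N}"
proof -
  have sA: "span (\<Union>A) = M" and sB: "span (\<Union>B) = N" using A B by (auto simp: direct_sum_def)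
  \<comment> \<open>Stated for arbitrary \<open>A\<close> and \<open>B\<close>, because it is used a
    second time with the two families exchanged.\<close>
  have *: "U \<inter> span (\<Union>(A \<union> B - {U})) = {0}"
    if U: "U \<in> A" and A: "direct_sum A M" and B: "direct_sum B N" and z: "M \<inter> N = {0}" for U A B M N
  proof -
    have sA: "span (\<Union>A) = M" and sB: "span (\<Union>B) = N" and U0: "U \<inter> span (\<Union>(A - {U})) = {0}"
      and sU: "submodule U" using A B U by (auto simp: direct_sum_def)
    have "x = 0" if x: "x \<in> U" and xs: "x \<in> span (\<Union>(A \<union> B - {U}))" for x
    proof -
      have "\<Union>(A \<union> B - {U}) \<subseteq> \<Union>(A - {U}) \<union> \<Union>B" by blast
      then have "x \<in> span (\<Union>(A - {U}) \<union> \<Union>B)" using xs span_mono by blast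
      then obtain a b where ab: "x = a + b" "a \<in> span (\<Union>(A - {U}))" "b \<in> N"
        using sB unfolding span_Un by blast
      have "a \<in> M" using ab(2) sA span_mono[of "\<Union>(A - {U})" "\<Union>A"] by blast
      moreover have "x \<in> M" using x U direct_sum_subset[OF A] by blast
      moreover have "b = x - a" using ab by simp
      ultimately have "b \<in> M" using submoduleD(4)[OF direct_sum_submodule[OF A]] by blast
      then have "b = 0" using ab z by blast
      then show ?thesis using ab U0 x by auto
    qed
    moreover have "0 \<in> U" "0 \<in> span (\<Union>(A \<union> B - {U}))" using submoduleD(2)[OF sU] span_zero by auto
    ultimately show ?thesis by blast
  qed
  have "\<forall>U\<in>A \<union> B. U \<inter> span (\<Union>(A \<union> B - {U})) = {0}"
    using *[OF _ A B z] *[OF _ B A] z by (metis Un_iff inf_commute sup_commute)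
  moreover have "span (\<Union>(A \<union> B)) = {u + w |u w. u \<in> M \<and> w \<in> N}"
    unfolding Union_Un_distrib span_Un sA sB ..
  ultimately show ?thesis using A B unfolding direct_sum_def by blast
qed

section \<open>Existence of decompositions and Fitting's lemma\<close>

lemma indecomposable_decomposition:
  assumes "submodule M" "findim M"
  shows "\<exists>D. finite D \<and> (\<forall>U\<in>D. indecomposable U) \<and> direct_sum D M"
  using assms
proof (induction "dim M" arbitrary: M rule: less_induct)
  case less
  consider "M = {0}" | "indecomposable M" | "M \<noteq> {0}" "\<not> indecomposable M" by blast
  then show ?case
  proof cases
    case 1
    then have "direct_sum {} M" by (simp add: direct_sum_def)
    then show ?thesis by blast
  next
    case 2
    have "span M = M" using less.prems submoduleD(1) by (simp add: span_eq_iff)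
    then have "direct_sum {M} M"
      using less.prems submoduleD(2)[of M] by (auto simp: direct_sum_def)
    then show ?thesis using 2 by blast
  next
    case 3
    then obtain A where A: "direct_summand A M" "A \<noteq> {0}" "A \<noteq> M"
      using less.prems unfolding indecomposable_def by blast
    then obtain W where W: "submodule A" "submodule W" "A \<inter> W = {0}"
      and M: "{u + w |u w. u \<in> A \<and> w \<in> W} = M"
      unfolding direct_summand_def by blast
    have AM: "A \<subset> M" using A M submoduleD(2)[OF W(2)] by (force intro!: psubsetI)
    have WM: "W \<subseteq> M" using M submoduleD(2)[OF W(1)] by force
    have "W \<noteq> M"
    proof
      assume "W = M"
      then have "A = {0}" using AM W by blast
      then show False using A by simp
    qed
    then have WM: "W \<subset> M" using WM by blast
    obtain DA where DA: "finite DA" "\<forall>U\<in>DA. indecomposable U" "direct_sum DA A"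
      using less.hyps[OF findim_dim_less[OF less.prems(2) submoduleD(1)[OF W(1)] AM] W(1)]
        findim_subset[OF less.prems(2)] AM by blast
    obtain DW where DW: "finite DW" "\<forall>U\<in>DW. indecomposable U" "direct_sum DW W"
      using less.hyps[OF findim_dim_less[OF less.prems(2) submoduleD(1)[OF W(2)] WM] W(2)]
        findim_subset[OF less.prems(2)] WM by blast
    show ?thesis
      using direct_sum_Un[OF DA(3) DW(3) W(3)] DA DW M by (intro exI[of _ "DA \<union> DW"]) auto
  qed
qed

text \<open>Once the chains of images and kernels of the powers \<open>\<psi> ^^ n\<close> are
  stationary, image and kernel of \<open>\<psi> ^^ n\<close> are complementary in \<open>Y\<close>.
  Indecomposability leaves two cases: the image is zero, or it is all of \<open>Y\<close> and the
  kernel is zero.\<close>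

lemma fitting_indecomposable:
  assumes Y: "indecomposable Y" "findim Y" and \<psi>: "\<psi> \<in> homs Y Y"
  shows "(\<exists>n. \<forall>y\<in>Y. (\<psi> ^^ n) y = 0) \<or> bij_betw \<psi> Y Y"
proof -
  have sY: "submodule Y" using Y by (simp add: indecomposable_def)
  note hp = homs_funpow[OF \<psi>]
  let ?I = "\<lambda>n. (\<psi> ^^ n) ` Y" and ?K = "\<lambda>n. {y \<in> Y. (\<psi> ^^ n) y = 0}"
  have sI: "submodule (?I n)" and sK: "submodule (?K n)" for n
    using submodule_image[OF hp sY] submodule_kernel[OF hp sY] by auto
  have IY: "?I n \<subseteq> Y" for n using homs_mem[OF hp] by blast
  have decI: "?I n \<subseteq> ?I m" if "m \<le> n" for m n
  proof -
    from that obtain k where "n = m + k" using le_Suc_ex by blast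
    then show ?thesis using homs_mem[OF hp] by (auto simp: funpow_add)
  qed
  have incK: "?K m \<subseteq> ?K n" if "m \<le> n" for m n
  proof -
    from that obtain k where "n = k + m" using le_Suc_ex add.commute by metis
    then show ?thesis using homs_zero[OF hp sY] by (auto simp: funpow_add)
  qed
  obtain N1 where N1: "\<forall>n\<ge>N1. ?I n = ?I N1"
    using findim_stabilize_decreasing[of ?I] Y(2) decI submoduleD(1)[OF sI] by auto
  obtain N2 where N2: "\<forall>n\<ge>N2. ?K n = ?K N2"
    using findim_stabilize_increasing[OF Y(2), of ?K] incK submoduleD(1)[OF sK] by auto
  \<comment> \<open>The successor makes \<open>n\<close> positive, so that the image of
    \<open>\<psi> ^^ n\<close> lies in that of \<open>\<psi>\<close> and the kernel of
    \<open>\<psi>\<close> in that of \<open>\<psi> ^^ n\<close>; both serve to pass from the power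
    back to \<open>\<psi>\<close>.\<close>
  define n where "n = Suc (max N1 N2)"
  have I2: "?I (n + n) = ?I n" and K2: "?K (n + n) = ?K n"
  proof -
    have "N1 \<le> n" "N1 \<le> n + n" "N2 \<le> n" "N2 \<le> n + n" by (auto simp: n_def)
    then show "?I (n + n) = ?I n" "?K (n + n) = ?K n"
      by - ((rule trans[OF N1[rule_format] N1[rule_format, symmetric]], assumption+),
          (rule trans[OF N2[rule_format] N2[rule_format, symmetric]], assumption+))
  qed
  have int: "?I n \<inter> ?K n = {0}"
  proof -
    have "x = 0" if "x \<in> ?I n" "x \<in> ?K n" for x
    proof -
      from that(1) obtain z where z: "x = (\<psi> ^^ n) z" "z \<in> Y" by (rule imageE)
      then have "z \<in> ?K (n + n)" using that by (simp add: funpow_add)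
      then show ?thesis using K2 z by simp
    qed
    then show ?thesis using submoduleD(2)[OF sI] submoduleD(2)[OF sK] by blast
  qed
  have "{u + w |u w. u \<in> ?I n \<and> w \<in> ?K n} = Y"
  proof
    show "{u + w |u w. u \<in> ?I n \<and> w \<in> ?K n} \<subseteq> Y" using IY submoduleD(3)[OF sY] by blast
    show "Y \<subseteq> {u + w |u w. u \<in> ?I n \<and> w \<in> ?K n}"
    proof
      fix y assume y: "y \<in> Y"
      then obtain z where z: "z \<in> Y" "(\<psi> ^^ n) y = (\<psi> ^^ (n + n)) z" using I2 by blast
      have "(\<psi> ^^ n) z \<in> Y" using homs_mem[OF hp] z by blast
      then have "y - (\<psi> ^^ n) z \<in> ?K n"
        using y z homs_diff[OF hp sY] submoduleD(4)[OF sY] by (simp add: funpow_add)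
      moreover have "(\<psi> ^^ n) z \<in> ?I n" using z by blast
      moreover have "y = (\<psi> ^^ n) z + (y - (\<psi> ^^ n) z)" by simp
      ultimately show "y \<in> {u + w |u w. u \<in> ?I n \<and> w \<in> ?K n}" by blast
    qed
  qed
  then have "direct_summand (?I n) Y" unfolding direct_summand_def using sI sK int by blast
  then consider "?I n = {0}" | "?I n = Y" using Y by (auto simp: indecomposable_def)
  then show ?thesis
  proof cases
    case 1 then show ?thesis by blast
  next
    case 2
    have K0: "?K n = {0}" using int 2 by auto
    have "Y \<subseteq> \<psi> ` Y"
    proof -
      have "(\<psi> ^^ n) ` Y \<subseteq> (\<psi> ^^ Suc 0) ` Y" by (rule decI) (simp add: n_def)
      then show ?thesis using 2 by simp
    qed
    moreover have "inj_on \<psi> Y"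
    proof (rule inj_onI)
      fix a b assume ab: "a \<in> Y" "b \<in> Y" "\<psi> a = \<psi> b"
      then have "\<psi> (a - b) = 0" using homs_diff[OF \<psi> sY] by simp
      then have "(\<psi> ^^ n) (a - b) = 0"
        using homs_zero[OF homs_funpow[OF \<psi>] sY] by (simp add: n_def funpow_swap1)
      then have "a - b \<in> ?K n" using submoduleD(4)[OF sY] ab by simp
      then show "a = b" using K0 by simp
    qed
    moreover have "\<psi> ` Y \<subseteq> Y" using homs_mem[OF \<psi>] by blast
    ultimately show ?thesis by (auto simp: bij_betw_def)
  qed
qed

section \<open>Multiplicities as ranks\<close>

lemma homs_inv_into:
  assumes \<phi>: "\<phi> \<in> homs U W" and bij: "bij_betw \<phi> U W" and U: "submodule U"
  shows "inv_into U \<phi> \<in> homs W U"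
proof -
  let ?i = "inv_into U \<phi>"
  have i: "?i (\<phi> u) = u" if "u \<in> U" for u using that bij by (simp add: bij_betw_def)
  have W: "W = \<phi> ` U" using bij by (simp add: bij_betw_def)
  show ?thesis unfolding homs_def W
  proof (intro CollectI conjI ballI allI; clarify?)
    fix u v assume uv: "u \<in> U" "v \<in> U"
    show "?i (\<phi> u + \<phi> v) = ?i (\<phi> u) + ?i (\<phi> v)"
      using i[OF submoduleD(3)[OF U uv]] homs_add[OF \<phi> uv] i uv by simp
  next
    fix c u assume u: "u \<in> U"
    show "?i (scale c (\<phi> u)) = scale c (?i (\<phi> u))"
      using i[OF submoduleD(5)[OF U u, of c]] homs_scale[OF \<phi> u, of c] i u by simp
  next
    fix g u assume g: "g \<in> carrier G" and u: "u \<in> U"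
    show "?i (act g (\<phi> u)) = act g (?i (\<phi> u))"
      using i[OF submoduleD(6)[OF U g u]] homs_act[OF \<phi> u g] i u by simp
  qed (simp add: i)
qed

lemma iso_modulesI: "\<lbrakk>\<phi> \<in> homs U W; bij_betw \<phi> U W\<rbrakk> \<Longrightarrow> iso_modules U W"
  unfolding iso_modules_def homs_def by blast

lemma iso_modulesE:
  assumes "iso_modules U W"
  obtains \<phi> where "\<phi> \<in> homs U W" "bij_betw \<phi> U W"
proof -
  from assms obtain \<phi> where \<phi>: "bij_betw \<phi> U W" "\<forall>u\<in>U. \<forall>v\<in>U. \<phi> (u + v) = \<phi> u + \<phi> v"
    "\<forall>c. \<forall>u\<in>U. \<phi> (scale c u) = scale c (\<phi> u)" "\<forall>g\<in>carrier G. \<forall>u\<in>U. \<phi> (act g u) = act g (\<phi> u)"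
    unfolding iso_modules_def by blast
  then have "\<phi> \<in> homs U W" unfolding homs_def by (simp add: bij_betwE)
  then show ?thesis using that \<phi>(1) by blast
qed

text \<open>The image of \<open>a\<close> and the kernel of \<open>b\<close> are complementary in
  \<open>U\<close>. As the image is nonzero, indecomposability makes it all of \<open>U\<close>, and
  \<open>b\<close> becomes bijective.\<close>

lemma iso_modules_if_bij_comp:
  assumes U: "indecomposable U" and Y: "submodule Y" "Y \<noteq> {0}"
    and a: "a \<in> homs Y U" and b: "b \<in> homs U Y" and bij: "bij_betw (b \<circ> a) Y Y"
  shows "iso_modules U Y"
proof -
  have sU: "submodule U" using U by (simp add: indecomposable_def)
  let ?K = "{u \<in> U. b u = 0}"
  have sA: "submodule (a ` Y)" using submodule_image[OF a Y(1)] .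
  have sK: "submodule ?K" using submodule_kernel[OF b sU] .
  have a0: "a 0 = 0" and b0: "b 0 = 0" using homs_zero a b Y sU by auto
  have inj: "y = y'" if "y \<in> Y" "y' \<in> Y" "b (a y) = b (a y')" for y y'
    using bij that by (auto simp: bij_betw_def inj_on_def)
  have AU: "a ` Y \<subseteq> U" using homs_mem[OF a] by blast
  have int: "a ` Y \<inter> ?K = {0}"
  proof -
    have "x = 0" if "x \<in> a ` Y" "b x = 0" for x
    proof -
      from that(1) obtain y where y: "x = a y" "y \<in> Y" by blast
      then have "y = 0" using inj[of y 0] that(2) a0 b0 submoduleD(2)[OF Y(1)] by simp
      then show ?thesis using y a0 by simp
    qed
    then show ?thesis using submoduleD(2)[OF sA] submoduleD(2)[OF sK] by blast
  qed
  have "{u + w |u w. u \<in> a ` Y \<and> w \<in> ?K} = U"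
  proof
    show "{u + w |u w. u \<in> a ` Y \<and> w \<in> ?K} \<subseteq> U"
      using AU submoduleD(3)[OF sU] by blast
    show "U \<subseteq> {u + w |u w. u \<in> a ` Y \<and> w \<in> ?K}"
    proof
      fix u assume u: "u \<in> U"
      have "(b \<circ> a) ` Y = Y" using bij by (simp add: bij_betw_def)
      then have "b u \<in> (b \<circ> a) ` Y" using homs_mem[OF b u] by simp
      then obtain y where y: "y \<in> Y" "b u = b (a y)" by auto
      have ay: "a y \<in> U" using homs_mem[OF a y(1)] .
      have "u - a y \<in> ?K" using homs_diff[OF b sU u ay] submoduleD(4)[OF sU u ay] y by simp
      moreover have "u = a y + (u - a y)" by simp
      ultimately show "u \<in> {u + w |u w. u \<in> a ` Y \<and> w \<in> ?K}" using y(1) by blast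
    qed
  qed
  then have "direct_summand (a ` Y) U"
    unfolding direct_summand_def using sA sK int by blast
  then consider "a ` Y = {0}" | "a ` Y = U" using U by (auto simp: indecomposable_def)
  then have AU: "a ` Y = U"
  proof cases
    case 1
    have "y = 0" if "y \<in> Y" for y
    proof -
      have "a y = 0" using 1 that by blast
      then show ?thesis using inj[of y 0] that a0 submoduleD(2)[OF Y(1)] by simp
    qed
    then show ?thesis using Y(2) submoduleD(2)[OF Y(1)] by blast
  qed
  have "bij_betw b U Y"
    unfolding bij_betw_def
  proof
    show "inj_on b U" using inj unfolding AU[symmetric] inj_on_def by blast
    show "b ` U = Y" using bij unfolding AU[symmetric] by (simp add: bij_betw_def image_comp)
  qed
  then show ?thesis using iso_modulesI[OF b] by blast
qed

lemma direct_sum_direct_summand: "\<lbrakk>direct_sum D M; U \<in> D\<rbrakk> \<Longrightarrow> direct_summand U M"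
  unfolding direct_summand_def using direct_sum_split[of D M U] by blast

text \<open>A projection onto a summand is an endomorphism of \<open>N\<close>, so it multiplies
  \<open>\<epsilon>\<close> by a scalar. The projections of \<open>\<epsilon>\<close> add up to
  \<open>\<epsilon>\<close>, so one of these scalars is nonzero, and that summand contains
  \<open>\<epsilon>\<close>.\<close>

lemma exists_indecomposable_summand:
  assumes N: "submodule N" "findim N" and \<epsilon>: "\<epsilon> \<in> N" "\<epsilon> \<noteq> 0"
    and \<chi>: "\<And>\<theta>. \<theta> \<in> homs N N \<Longrightarrow> \<theta> \<epsilon> = scale (\<chi> \<theta>) \<epsilon>"
  shows "\<exists>Y. indecomposable Y \<and> direct_summand Y N \<and> \<epsilon> \<in> Y"
proof -
  obtain D where D: "finite D" "\<forall>U\<in>D. indecomposable U" "direct_sum D N"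
    using indecomposable_decomposition[OF N] by blast
  obtain p where p: "\<And>U. U \<in> D \<Longrightarrow> p U \<in> homs N U" "\<And>U u. \<lbrakk>U \<in> D; u \<in> U\<rbrakk> \<Longrightarrow> p U u = u"
    "\<And>U V v. \<lbrakk>U \<in> D; V \<in> D; V \<noteq> U; v \<in> V\<rbrakk> \<Longrightarrow> p U v = 0"
    using direct_sum_projections[OF D(3)] by blast
  have "(\<Sum>U\<in>D. p U \<epsilon>) = \<epsilon>" using direct_sum_projections_sum[OF D(3,1) p \<epsilon>(1)] by simp
  then obtain U where U: "U \<in> D" "p U \<epsilon> \<noteq> 0" using \<epsilon>(2) sum.neutral by metis
  let ?c = "\<chi> (p U)"
  have "p U \<in> homs N N" using homs_subset[OF p(1)[OF U(1)]] direct_sum_subset[OF D(3) U(1)] by blast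
  then have e: "p U \<epsilon> = scale ?c \<epsilon>" using \<chi> by blast
  then have "?c \<noteq> 0" using U(2) by auto
  then have "\<epsilon> = scale (inverse ?c) (p U \<epsilon>)" using e by simp
  moreover have "p U \<epsilon> \<in> U" using homs_mem[OF p(1)[OF U(1)] \<epsilon>(1)] .
  moreover have "submodule U" using D(2) U(1) by (simp add: indecomposable_def)
  ultimately have "\<epsilon> \<in> U" using submoduleD(5)[of U "p U \<epsilon>"] by metis
  then show ?thesis using D U direct_sum_direct_summand by blast
qed

text \<open>
  The endomorphism ring of \<open>Y\<close> is local with residue map \<open>\<chi>\<close>, so pairing homomorphisms into and out
  of an indecomposable summand of \<open>M\<close> by \<open>\<chi>\<close> gives a form of rank one if the summand is isomorphic
  to \<open>Y\<close> and the zero form otherwise.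
\<close>

lemma kernel_rank_eq_card_summands:
  assumes M: "findim M" and N: "submodule N" "findim N" and \<epsilon>: "\<epsilon> \<in> N" "\<epsilon> \<noteq> 0"
    and \<chi>: "\<And>\<theta>. \<theta> \<in> homs N N \<Longrightarrow> \<theta> \<epsilon> = scale (\<chi> \<theta>) \<epsilon>"
    and Y: "indecomposable Y" "direct_summand Y N" "\<epsilon> \<in> Y"
    and D: "finite D" "\<forall>U\<in>D. indecomposable U" "direct_sum D M"
  shows "kernel_rank (\<lambda>f g. \<chi> (g \<circ> f)) (homs N M) (homs M N) = card {U \<in> D. iso_modules U Y}"
proof -
  have sM: "submodule M" using direct_sum_submodule[OF D(3)] .
  obtain W where W: "submodule Y" "submodule W" "Y \<inter> W = {0}"
    and NYW: "{u + w |u w. u \<in> Y \<and> w \<in> W} = N"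
    using Y(2) unfolding direct_summand_def by blast
  have YN: "Y \<subseteq> N" using NYW submoduleD(2)[OF W(2)] by force
  obtain e where e: "e \<in> homs N Y" "\<And>y. y \<in> Y \<Longrightarrow> e y = y"
    using split_projection[OF W] unfolding NYW by blast
  have Y0: "Y \<noteq> {0}" using Y(1) by (simp add: indecomposable_def)
  have fY: "findim Y" using findim_subset[OF N(2) YN] .
  have chi_eq: "\<chi> \<theta> = c" if "\<theta> \<in> homs N N" "\<theta> \<epsilon> = scale c \<epsilon>" for \<theta> c
    using \<chi>[OF that(1)] that(2) \<epsilon>(2) by simp
  have chi_comp: "\<chi> (\<theta> \<circ> \<theta>') = \<chi> \<theta> * \<chi> \<theta>'" if t: "\<theta> \<in> homs N N" "\<theta>' \<in> homs N N" for \<theta> \<theta>'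
  proof (rule chi_eq[OF homs_comp[OF t(2,1)]])
    show "(\<theta> \<circ> \<theta>') \<epsilon> = scale (\<chi> \<theta> * \<chi> \<theta>') \<epsilon>"
      using \<chi>[OF t(1)] \<chi>[OF t(2)] homs_scale[OF t(1) \<epsilon>(1)] by (simp add: mult.commute)
  qed
  obtain p where p: "\<And>U. U \<in> D \<Longrightarrow> p U \<in> homs M U" "\<And>U u. \<lbrakk>U \<in> D; u \<in> U\<rbrakk> \<Longrightarrow> p U u = u"
    "\<And>U V v. \<lbrakk>U \<in> D; V \<in> D; V \<noteq> U; v \<in> V\<rbrakk> \<Longrightarrow> p U v = 0"
    using direct_sum_projections[OF D(3)] by blast
  let ?I = "{U \<in> D. iso_modules U Y}"
  have "\<forall>U\<in>?I. \<exists>\<phi>. \<phi> \<in> homs U Y \<and> bij_betw \<phi> U Y" using iso_modulesE by blast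
  from bchoice[OF this] obtain \<phi> where \<phi>: "\<And>U. U \<in> ?I \<Longrightarrow> \<phi> U \<in> homs U Y" "\<And>U. U \<in> ?I \<Longrightarrow> bij_betw (\<phi> U) U Y"
    by blast
  define \<psi> where "\<psi> U = inv_into U (\<phi> U)" for U
  have sU: "submodule U" if "U \<in> D" for U using D(2) that by (simp add: indecomposable_def)
  have \<psi>: "\<psi> U \<in> homs Y U" if "U \<in> ?I" for U
    unfolding \<psi>_def using homs_inv_into[OF \<phi>[OF that]] sU that by blast
  have \<psi>\<phi>: "\<psi> U (\<phi> U u) = u" if "U \<in> ?I" "u \<in> U" for U u
    unfolding \<psi>_def using \<phi>(2)[OF that(1)] that(2) by (simp add: bij_betw_def)
  have \<phi>\<psi>: "\<phi> U (\<psi> U y) = y" if "U \<in> ?I" "y \<in> Y" for U y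
    unfolding \<psi>_def using \<phi>(2)[OF that(1)] that(2) by (simp add: bij_betw_inv_into_right)
  have UM: "U \<subseteq> M" if "U \<in> D" for U using direct_sum_subset[OF D(3) that] .
  \<comment> \<open>Up to the isomorphism with \<open>Y\<close>, these are inclusion and projection
    of the summand \<open>U\<close>; they form the dual systems that exhibit the rank.\<close>
  define f where "f U = \<psi> U \<circ> e" for U
  define g where "g U = \<phi> U \<circ> p U" for U
  have f: "f U \<in> homs N M" if "U \<in> ?I" for U
    unfolding f_def using homs_subset[OF homs_comp[OF e(1) \<psi>[OF that]] subset_refl UM] that by blast
  have gY: "g U \<in> homs M Y" if "U \<in> ?I" for U
    unfolding g_def using homs_comp[OF p(1) \<phi>(1)] that by blast
  have g: "g U \<in> homs M N" if "U \<in> ?I" for U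
    using homs_subset[OF gY[OF that] subset_refl YN] .
  have dual: "\<chi> (g V \<circ> f U) = (if U = V then 1 else 0)" if UV: "U \<in> ?I" "V \<in> ?I" for U V
  proof (rule chi_eq[OF homs_comp[OF f[OF UV(1)] g[OF UV(2)]]])
    have m: "\<psi> U \<epsilon> \<in> U" using homs_mem[OF \<psi>[OF UV(1)] Y(3)] .
    show "(g V \<circ> f U) \<epsilon> = scale (if U = V then 1 else 0) \<epsilon>"
    proof (cases "U = V")
      case True
      then show ?thesis using p(2)[of U] m UV \<phi>\<psi>[OF UV(1) Y(3)] e(2)[OF Y(3)] by (simp add: f_def g_def)
    next
      case False
      then have "p V (\<psi> U \<epsilon>) = 0" using p(3)[of V U] m UV by blast
      then show ?thesis using e(2)[OF Y(3)] False homs_zero[OF \<phi>(1)[OF UV(2)]] sU UV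
        by (simp add: f_def g_def)
    qed
  qed
  have factor: "\<chi> (y \<circ> x) = (\<Sum>U\<in>?I. \<chi> (g U \<circ> x) * \<chi> (y \<circ> f U))"
    if x: "x \<in> homs N M" and y: "y \<in> homs M N" for x y
  proof -
    have xM: "x \<epsilon> \<in> M" using homs_mem[OF x \<epsilon>(1)] .
    \<comment> \<open>\<open>t U\<close> is the part of \<open>y \<circ> x\<close> that passes
      through \<open>U\<close>; \<chi> is additive over these parts.\<close>
    define t where "t U = y \<circ> (p U \<circ> x)" for U
    have t: "t U \<in> homs N N" if "U \<in> D" for U
      unfolding t_def by (rule homs_comp[OF homs_comp[OF x p(1)[OF that]]])
        (rule homs_subset[OF y UM[OF that] subset_refl])
    have pM: "p U (x \<epsilon>) \<in> M" if "U \<in> D" for U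
      using homs_mem[OF p(1)[OF that] xM] UM[OF that] by blast
    have "y (x \<epsilon>) = y (\<Sum>U\<in>D. p U (x \<epsilon>))"
      using direct_sum_projections_sum[OF D(3,1) p xM] by simp
    also have "\<dots> = (\<Sum>U\<in>D. t U \<epsilon>)" using homs_sum[OF y sM pM] by (simp add: t_def)
    also have "\<dots> = (\<Sum>U\<in>D. scale (\<chi> (t U)) \<epsilon>)" using \<chi>[OF t] by simp
    also have "\<dots> = scale (\<Sum>U\<in>D. \<chi> (t U)) \<epsilon>" by (simp add: scale_sum_left)
    finally have "\<chi> (y \<circ> x) = (\<Sum>U\<in>D. \<chi> (t U))" using chi_eq[OF homs_comp[OF x y]] by simp
    also have "\<dots> = (\<Sum>U\<in>?I. \<chi> (t U))"
    proof (rule sum.mono_neutral_right[OF D(1)])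
      show "\<forall>U\<in>D - ?I. \<chi> (t U) = 0"
      \<comment> \<open>If \<chi> is nonzero on the part through \<open>U\<close>, the induced
        endomorphism of \<open>Y\<close> multiplies \<open>\<epsilon>\<close> by a nonzero scalar
        and is not nilpotent, so it is bijective by Fitting's lemma and \<open>U\<close> is
        isomorphic to \<open>Y\<close>.\<close>
      proof (rule ballI, rule ccontr)
        fix U assume U: "U \<in> D - ?I" and nz: "\<chi> (t U) \<noteq> 0"
        let ?a = "p U \<circ> x" and ?b = "e \<circ> y"
        have UD: "U \<in> D" using U by blast
        have a: "?a \<in> homs Y U" using homs_subset[OF homs_comp[OF x p(1)[OF UD]] YN] by blast
        have b: "?b \<in> homs U Y" using homs_subset[OF homs_comp[OF y e(1)] UM[OF UD]] by blast
        have ba: "?b \<circ> ?a \<in> homs Y Y" using homs_comp[OF a b] .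
        have "(?b \<circ> ?a) \<epsilon> = e (t U \<epsilon>)" by (simp add: t_def)
        also have "\<dots> = scale (\<chi> (t U)) \<epsilon>"
          using \<chi>[OF t[OF UD]] homs_scale[OF e(1) \<epsilon>(1)] e(2)[OF Y(3)] by simp
        finally have s: "(?b \<circ> ?a) \<epsilon> = scale (\<chi> (t U)) \<epsilon>" .
        have pow: "((?b \<circ> ?a) ^^ n) \<epsilon> = scale (\<chi> (t U) ^ n) \<epsilon>" for n
        proof (induction n)
          case (Suc n)
          have "((?b \<circ> ?a) ^^ Suc n) \<epsilon> = (?b \<circ> ?a) (((?b \<circ> ?a) ^^ n) \<epsilon>)" by simp
          also have "\<dots> = scale (\<chi> (t U) ^ n) ((?b \<circ> ?a) \<epsilon>)"
            unfolding Suc using homs_scale[OF ba Y(3)] .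
          finally show ?case unfolding s by (simp only: scale_scale power_Suc2)
        qed simp
        have "\<not> (\<forall>y\<in>Y. ((?b \<circ> ?a) ^^ n) y = 0)" for n
          using pow[of n] nz \<epsilon>(2) Y(3) by (metis power_not_zero scale_eq_0_iff)
        then have "bij_betw (?b \<circ> ?a) Y Y" using fitting_indecomposable[OF Y(1) fY ba] by blast
        then have "iso_modules U Y"
          using iso_modules_if_bij_comp[OF _ W(1) Y0 a b] D(2) UD by blast
        then show False using U by blast
      qed
    qed auto
    also have "\<dots> = (\<Sum>U\<in>?I. \<chi> (g U \<circ> x) * \<chi> (y \<circ> f U))"
    proof (rule sum.cong)
      fix U assume U: "U \<in> ?I"
      then have UD: "U \<in> D" by blast
      have gx: "g U \<circ> x \<in> homs N N" and yf: "y \<circ> f U \<in> homs N N"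
        using homs_comp[OF x g[OF U]] homs_comp[OF f[OF U] y] by auto
      \<comment> \<open>\<open>g U\<close> takes values in \<open>Y\<close>, where \<open>e\<close>
        is the identity, so \<open>\<phi> U\<close> and \<open>\<psi> U\<close> cancel.
        Multiplicativity of \<chi> then splits the part through \<open>U\<close> into two
        factors.\<close>
      have "(y \<circ> f U) ((g U \<circ> x) \<epsilon>) = y (\<psi> U (e (g U (x \<epsilon>))))" by (simp add: f_def)
      also have "e (g U (x \<epsilon>)) = g U (x \<epsilon>)" using e(2)[OF homs_mem[OF gY[OF U] xM]] .
      also have "\<psi> U (g U (x \<epsilon>)) = p U (x \<epsilon>)"
        using \<psi>\<phi>[OF U homs_mem[OF p(1)[OF UD] xM]] by (simp add: g_def)
      finally have "((y \<circ> f U) \<circ> (g U \<circ> x)) \<epsilon> = scale (\<chi> (t U)) \<epsilon>"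
        using \<chi>[OF t[OF UD]] by (simp add: t_def)
      then have "\<chi> ((y \<circ> f U) \<circ> (g U \<circ> x)) = \<chi> (t U)" using chi_eq[OF homs_comp[OF gx yf]] by blast
      then show "\<chi> (t U) = \<chi> (g U \<circ> x) * \<chi> (y \<circ> f U)" using chi_comp[OF yf gx] by (simp add: mult.commute)
    qed simp
    finally show ?thesis .
  qed
  show ?thesis
  proof (rule kernel_rank_eq_card[where f = f and g = g])
    show "finite ?I" using D(1) by simp
  qed (fact f g dual factor)+
qed

text \<open>The rank makes no reference to a decomposition, so all decompositions give the same
  count. This is the uniqueness that the definite description in \<open>multiplicity\<close>
  requires.\<close>

lemma multiplicity_eq_kernel_rank:
  assumes M: "submodule M" "findim M" and N: "submodule N" "findim N" and \<epsilon>: "\<epsilon> \<in> N" "\<epsilon> \<noteq> 0"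
    and \<chi>: "\<And>\<theta>. \<theta> \<in> homs N N \<Longrightarrow> \<theta> \<epsilon> = scale (\<chi> \<theta>) \<epsilon>"
    and Y: "indecomposable Y" "direct_summand Y N" "\<epsilon> \<in> Y"
  shows "multiplicity M Y = kernel_rank (\<lambda>f g. \<chi> (g \<circ> f)) (homs N M) (homs M N)"
  unfolding multiplicity_def
proof (rule the_equality)
  note * = kernel_rank_eq_card_summands[where \<chi> = \<chi>, OF M(2) N \<epsilon> \<chi> Y]
  show "\<exists>\<D>. finite \<D> \<and> (\<forall>U\<in>\<D>. indecomposable U) \<and> direct_sum \<D> M \<and>
      kernel_rank (\<lambda>f g. \<chi> (g \<circ> f)) (homs N M) (homs M N) = card {U \<in> \<D>. iso_modules U Y}"
  proof -
    obtain D where "finite D" "\<forall>U\<in>D. indecomposable U" "direct_sum D M"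
      using indecomposable_decomposition[OF M] by blast
    then show ?thesis using * by (intro exI[of _ D]) simp
  qed
  show "c = kernel_rank (\<lambda>f g. \<chi> (g \<circ> f)) (homs N M) (homs M N)"
    if "\<exists>\<D>. finite \<D> \<and> (\<forall>U\<in>\<D>. indecomposable U) \<and> direct_sum \<D> M \<and>
      c = card {U \<in> \<D>. iso_modules U Y}" for c
    using that * by auto
qed

end

section \<open>Rows and columns of the initial tableau\<close>

abbreviation entries :: "nat list \<Rightarrow> nat set" where
  "entries lam \<equiv> {1..sum_list lam}"

definition row_of :: "nat list \<Rightarrow> nat \<Rightarrow> nat" where
  "row_of lam b = (LEAST i. b \<le> sum_list (take (Suc i) lam))"

definition col_of :: "nat list \<Rightarrow> nat \<Rightarrow> nat" where
  "col_of lam b = b - sum_list (take (row_of lam b) lam)"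

lemma sum_list_take_mono: "i \<le> j \<Longrightarrow> sum_list (take i lam) \<le> sum_list (take j (lam :: nat list))"
proof -
  assume "i \<le> j"
  then have "take j lam = take i lam @ take (j - i) (drop i lam)" by (metis le_add_diff_inverse take_add)
  then show ?thesis by simp
qed

lemma sum_list_take_Suc: "i < length lam \<Longrightarrow> sum_list (take (Suc i) lam) = sum_list (take i lam) + (lam ! i :: nat)"
  by (simp add: take_Suc_conv_app_nth)

lemma tableau_row_eq:
  "i < length lam \<Longrightarrow> tableau_row lam i = {sum_list (take i lam)<..sum_list (take (Suc i) lam)}"
proof -
  assume i: "i < length lam"
  have "b \<in> tableau_row lam i"
    if "sum_list (take i lam) < b" "b \<le> sum_list (take i lam) + lam ! i" for b
    unfolding tableau_row_def using that
    by (intro CollectI exI[of _ "b - sum_list (take i lam)"]) auto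
  then show ?thesis using i by (auto simp: tableau_row_def sum_list_take_Suc)
qed

lemma row_of_eqI:
  assumes "i < length lam" "sum_list (take i lam) < b" "b \<le> sum_list (take (Suc i) lam)"
  shows "row_of lam b = i"
  unfolding row_of_def
proof (rule Least_equality)
  fix j assume "b \<le> sum_list (take (Suc j) lam)"
  then show "i \<le> j" using sum_list_take_mono[of "Suc j" i lam] assms by (meson le_trans not_less not_less_eq_eq)
qed (use assms in auto)

lemma row_of:
  assumes "b \<in> entries lam"
  shows "row_of lam b < length lam" "sum_list (take (row_of lam b) lam) < b"
    "b \<le> sum_list (take (Suc (row_of lam b)) lam)"
proof -
  have "length lam \<noteq> 0" using assms by (cases lam) auto
  then have ex: "b \<le> sum_list (take (Suc (length lam - 1)) lam)" using assms by simp
  show "b \<le> sum_list (take (Suc (row_of lam b)) lam)" unfolding row_of_def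
    using LeastI[of "\<lambda>i. b \<le> sum_list (take (Suc i) lam)", OF ex] .
  show "row_of lam b < length lam"
    using Least_le[of "\<lambda>i. b \<le> sum_list (take (Suc i) lam)", OF ex] \<open>length lam \<noteq> 0\<close>
    unfolding row_of_def by linarith
  show "sum_list (take (row_of lam b) lam) < b"
  proof (cases "row_of lam b")
    case 0 then show ?thesis using assms by simp
  next
    case (Suc j)
    then have "\<not> b \<le> sum_list (take (Suc j) lam)"
      using not_less_Least[of j "\<lambda>i. b \<le> sum_list (take (Suc i) lam)"] unfolding row_of_def by simp
    then show ?thesis using Suc by simp
  qed
qed

lemma tableau_row_subset: "i < length lam \<Longrightarrow> tableau_row lam i \<subseteq> entries lam"
  using sum_list_take_mono[of "Suc i" "length lam" lam] by (fastforce simp: tableau_row_eq)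

lemma tableau_row_iff:
  "i < length lam \<Longrightarrow> b \<in> tableau_row lam i \<longleftrightarrow> b \<in> entries lam \<and> row_of lam b = i"
  using row_of_eqI[of i lam b] row_of[of b lam] tableau_row_subset[of i lam] by (auto simp: tableau_row_eq)

lemma col_of:
  assumes "b \<in> entries lam"
  shows "1 \<le> col_of lam b" "col_of lam b \<le> lam ! row_of lam b"
    "b = sum_list (take (row_of lam b) lam) + col_of lam b"
  using row_of[OF assms] sum_list_take_Suc[OF row_of(1)[OF assms]] by (auto simp: col_of_def)

text \<open>Together with \<open>col_of\<close>, this identifies entries with boxes, rows being
  counted from 0 and columns from 1.\<close>

lemma box_exists:
  assumes "i < length lam" "1 \<le> j" "j \<le> lam ! i"
  defines "b \<equiv> sum_list (take i lam) + j"
  shows "b \<in> entries lam" "row_of lam b = i" "col_of lam b = j"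
proof -
  show r: "row_of lam b = i" by (rule row_of_eqI) (use assms sum_list_take_Suc[of i lam] in auto)
  show "b \<in> entries lam"
    using sum_list_take_mono[of "Suc i" "length lam" lam] sum_list_take_Suc[of i lam] assms by auto
  show "col_of lam b = j" unfolding col_of_def r by (simp add: b_def)
qed

lemma tableau_column_iff:
  assumes "1 \<le> j"
  shows "b \<in> tableau_column lam j \<longleftrightarrow> b \<in> entries lam \<and> col_of lam b = j"
proof
  assume "b \<in> tableau_column lam j"
  then show "b \<in> entries lam \<and> col_of lam b = j"
    using box_exists assms unfolding tableau_column_def by blast
next
  assume "b \<in> entries lam \<and> col_of lam b = j"
  then show "b \<in> tableau_column lam j"
    unfolding tableau_column_def using col_of[of b lam] row_of[of b lam] by blast
qed

abbreviation perms :: "nat \<Rightarrow> (nat \<Rightarrow> nat) set" where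
  "perms r \<equiv> {p. p permutes {1..r}}"

lemma carrier_sym_group: "carrier (sym_group r) = perms r"
  by (simp add: sym_group_def)

lemma finite_perms: "finite (perms r)"
  by (rule finite_permutations) simp

lemma permutes_fibre_iff:
  assumes p: "p permutes S" and S: "finite S"
  shows "p ` {b \<in> S. f b = i} = {b \<in> S. f b = i} \<longleftrightarrow> (\<forall>b\<in>S. f b = i \<longrightarrow> f (p b) = i)"
proof
  assume "p ` {b \<in> S. f b = i} = {b \<in> S. f b = i}"
  then show "\<forall>b\<in>S. f b = i \<longrightarrow> f (p b) = i" by blast
next
  assume "\<forall>b\<in>S. f b = i \<longrightarrow> f (p b) = i"
  then have "p ` {b \<in> S. f b = i} \<subseteq> {b \<in> S. f b = i}" using permutes_in_image[OF p] by auto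
  moreover have "finite {b \<in> S. f b = i}" using S by simp
  moreover have "inj_on p {b \<in> S. f b = i}" using permutes_inj_on[OF p] by blast
  ultimately show "p ` {b \<in> S. f b = i} = {b \<in> S. f b = i}" using endo_inj_surj by blast
qed

lemma young_subgroup_iff:
  "q \<in> young_subgroup lam \<longleftrightarrow>
     q permutes entries lam \<and> (\<forall>b\<in>entries lam. row_of lam (q b) = row_of lam b)"
proof -
  let ?S = "entries lam"
  have r: "tableau_row lam i = {b \<in> ?S. row_of lam b = i}" if "i < length lam" for i
    using tableau_row_iff[OF that] by blast
  have "q \<in> young_subgroup lam \<longleftrightarrow> q permutes ?S \<and>
      (\<forall>i<length lam. q ` {b \<in> ?S. row_of lam b = i} = {b \<in> ?S. row_of lam b = i})"
    unfolding young_subgroup_def carrier_sym_group using r by simp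
  also have "\<dots> \<longleftrightarrow> q permutes ?S \<and> (\<forall>i<length lam. \<forall>b\<in>?S. row_of lam b = i \<longrightarrow> row_of lam (q b) = i)"
    by (intro conj_cong refl) (simp only: permutes_fibre_iff[OF _ finite_atLeastAtMost])
  also have "\<dots> \<longleftrightarrow> q permutes ?S \<and> (\<forall>b\<in>?S. row_of lam (q b) = row_of lam b)"
    using row_of(1)[of _ lam] by metis
  finally show ?thesis .
qed

lemma column_iff:
  "q \<in> column_stabilizer lam \<longleftrightarrow>
     q permutes entries lam \<and> (\<forall>b\<in>entries lam. col_of lam (q b) = col_of lam b)"
proof -
  let ?S = "entries lam"
  have r: "tableau_column lam j = {b \<in> ?S. col_of lam b = j}" if "1 \<le> j" for j
    using tableau_column_iff[OF that] by blast
  have "q \<in> column_stabilizer lam \<longleftrightarrow> q permutes ?S \<and>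
      (\<forall>j\<ge>1. q ` {b \<in> ?S. col_of lam b = j} = {b \<in> ?S. col_of lam b = j})"
    unfolding column_stabilizer_def carrier_sym_group using r by simp
  also have "\<dots> \<longleftrightarrow> q permutes ?S \<and> (\<forall>j\<ge>1. \<forall>b\<in>?S. col_of lam b = j \<longrightarrow> col_of lam (q b) = j)"
    by (intro conj_cong refl) (simp only: permutes_fibre_iff[OF _ finite_atLeastAtMost])
  also have "\<dots> \<longleftrightarrow> q permutes ?S \<and> (\<forall>b\<in>?S. col_of lam (q b) = col_of lam b)"
    using col_of(1)[of _ lam] by metis
  finally show ?thesis .
qed

lemma perm_module_iff:
  assumes "sum_list lam = r"
  shows "f \<in> perm_module lam \<longleftrightarrow>
    (\<forall>x h. x permutes {1..r} \<longrightarrow> h \<in> young_subgroup lam \<longrightarrow> f (x \<circ> h) = f x) \<and>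
    (\<forall>x. \<not> x permutes {1..r} \<longrightarrow> f x = 0)"
  using assms by (auto simp: perm_module_def induced_def carrier_sym_group sym_group_mult)

lemma translate_eq:
  assumes "g permutes {1..r}"
  shows "translate (sym_group r) g f = (\<lambda>x. f (inv' g \<circ> x))"
  using assms by (simp add: translate_def sym_group_mult sym_group_carrier)

section \<open>Sums over cosets of Young subgroups\<close>

text \<open>The coset \<open>x \<Sigma>\<^sub>\<lambda>\<close> is encoded by the word assigning to each entry of the tableau \<open>x t\<close> its row.\<close>

definition word_of :: "nat list \<Rightarrow> (nat \<Rightarrow> nat) \<Rightarrow> nat \<Rightarrow> nat" where
  "word_of lam x = (\<lambda>b\<in>entries lam. row_of lam (inv' x b))"

definition words :: "nat list \<Rightarrow> (nat \<Rightarrow> nat) set" where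
  "words lam = word_of lam ` perms (sum_list lam)"

definition coset_rep :: "nat list \<Rightarrow> (nat \<Rightarrow> nat) \<Rightarrow> nat \<Rightarrow> nat" where
  "coset_rep lam = inv_into (perms (sum_list lam)) (word_of lam)"

text \<open>One term per coset, instead of a sum over the whole group divided by the order of the
  Young subgroup, which may vanish in \<open>'k\<close>. The value is independent of the chosen
  representatives when \<open>\<phi>\<close> is right invariant.\<close>

definition coset_sum :: "nat list \<Rightarrow> ((nat \<Rightarrow> nat) \<Rightarrow> 'k) \<Rightarrow> 'k::comm_monoid_add" where
  "coset_sum lam \<phi> = (\<Sum>w\<in>words lam. \<phi> (coset_rep lam w))"

lemma coset_rep:
  assumes "w \<in> words lam"
  shows "coset_rep lam w permutes entries lam" "word_of lam (coset_rep lam w) = w"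
  using assms inv_into_into[of w "word_of lam" "perms (sum_list lam)"]
    f_inv_into_f[of w "word_of lam" "perms (sum_list lam)"]
  unfolding words_def coset_rep_def by auto

lemma finite_words: "finite (words lam)"
  unfolding words_def using finite_perms by blast

lemma word_of_eq_iff:
  assumes x: "x permutes entries lam" and y: "y permutes entries lam"
  shows "word_of lam x = word_of lam y \<longleftrightarrow> inv' x \<circ> y \<in> young_subgroup lam"
proof -
  let ?S = "entries lam"
  have "word_of lam x = word_of lam y \<longleftrightarrow> (\<forall>b\<in>?S. row_of lam (inv' x b) = row_of lam (inv' y b))"
    by (auto simp: word_of_def fun_eq_iff)
  also have "\<dots> \<longleftrightarrow> (\<forall>b\<in>?S. row_of lam (inv' x (y b)) = row_of lam b)"
  proof -
    have *: "(\<forall>b\<in>?S. P b) \<longleftrightarrow> (\<forall>b\<in>?S. P (y b))" for P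
      using permutes_image[OF y] by (metis imageE imageI)
    show ?thesis
      using *[of "\<lambda>b. row_of lam (inv' x b) = row_of lam (inv' y b)"]
      by (simp only: permutes_inverses(2)[OF y])
  qed
  finally show ?thesis
    using permutes_compose[OF y permutes_inv[OF x]] by (simp add: young_subgroup_iff)
qed

definition right_invariant :: "nat list \<Rightarrow> ((nat \<Rightarrow> nat) \<Rightarrow> 'a) \<Rightarrow> bool" where
  "right_invariant lam \<phi> \<longleftrightarrow> (\<forall>x h. x permutes entries lam \<longrightarrow> h \<in> young_subgroup lam \<longrightarrow> \<phi> (x \<circ> h) = \<phi> x)"

lemma right_invariant_word:
  assumes \<phi>: "right_invariant lam \<phi>" and x: "x permutes entries lam" and y: "y permutes entries lam"
    and w: "word_of lam x = word_of lam y"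
  shows "\<phi> x = \<phi> y"
proof -
  have "x \<circ> (inv' x \<circ> y) = y" using permutes_inverses(1)[OF x] by (auto simp: fun_eq_iff)
  moreover have "inv' x \<circ> y \<in> young_subgroup lam" using word_of_eq_iff[OF x y] w by simp
  ultimately show ?thesis using \<phi> x unfolding right_invariant_def by metis
qed

lemma right_invariant_coset_rep:
  assumes "right_invariant lam \<phi>" "x permutes entries lam"
  shows "\<phi> (coset_rep lam (word_of lam x)) = \<phi> x"
proof -
  have "word_of lam x \<in> words lam" using assms by (auto simp: words_def)
  from coset_rep[OF this] show ?thesis using right_invariant_word[OF assms(1)] assms(2) by blast
qed

lemma coset_sum_cong:
  assumes "\<And>x. x permutes entries lam \<Longrightarrow> \<phi> x = \<psi> x"
  shows "coset_sum lam \<phi> = coset_sum lam \<psi>"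
  unfolding coset_sum_def by (rule sum.cong) (use assms coset_rep in auto)

lemma word_of_comp:
  assumes s: "s permutes entries lam" and z: "z permutes entries lam"
  shows "word_of lam (s \<circ> z) = (\<lambda>b\<in>entries lam. word_of lam z (inv' s b))"
proof -
  have "inv' (s \<circ> z) = inv' z \<circ> inv' s" using permutes_inv_o s z by (metis o_inv_distrib permutes_bij)
  then show ?thesis
    unfolding word_of_def
    by (intro restrict_ext) (use permutes_in_image[OF permutes_inv[OF s]] in auto)
qed

text \<open>Left multiplication by \<open>s\<close> permutes the cosets but not their chosen
  representatives; invariance of \<open>\<phi>\<close> absorbs the difference.\<close>

lemma coset_sum_shift:
  assumes \<phi>: "right_invariant lam \<phi>" and s: "s permutes entries lam"
  shows "coset_sum lam \<phi> = coset_sum lam (\<lambda>z. \<phi> (s \<circ> z))"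
proof -
  have inv: "s1 permutes entries lam \<Longrightarrow> w \<in> words lam \<Longrightarrow>
      word_of lam (s1 \<circ> coset_rep lam w) \<in> words lam" for w s1
    using permutes_compose[OF coset_rep(1)] by (auto simp: words_def)
  have cancel: "word_of lam (s1 \<circ> coset_rep lam (word_of lam (s2 \<circ> coset_rep lam w))) = w"
    if s1: "s1 permutes entries lam" and s2: "s2 permutes entries lam"
      and c: "s1 \<circ> s2 = id" and w: "w \<in> words lam" for w s1 s2
  proof -
    note cr = coset_rep[OF inv[OF s2 w]]
    have "word_of lam (s1 \<circ> coset_rep lam (word_of lam (s2 \<circ> coset_rep lam w)))
        = word_of lam (s1 \<circ> (s2 \<circ> coset_rep lam w))"
      unfolding word_of_comp[OF s1 cr(1)] cr(2)
      unfolding word_of_comp[OF s1 permutes_compose[OF coset_rep(1)[OF w] s2]] ..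
    also have "s1 \<circ> (s2 \<circ> coset_rep lam w) = coset_rep lam w" using c by (simp flip: comp_assoc)
    finally show ?thesis unfolding coset_rep(2)[OF w] .
  qed
  note s' = permutes_inv[OF s]
  show ?thesis
    unfolding coset_sum_def
  proof (rule sum.reindex_bij_witness[of _ "\<lambda>w. word_of lam (s \<circ> coset_rep lam w)"
        "\<lambda>w. word_of lam (inv' s \<circ> coset_rep lam w)"])
    fix w assume w: "w \<in> words lam"
    show w': "word_of lam (s \<circ> coset_rep lam (word_of lam (inv' s \<circ> coset_rep lam w))) = w"
      by (rule cancel[OF s s' permutes_inv_o(1)[OF s] w])
    show "word_of lam (inv' s \<circ> coset_rep lam (word_of lam (s \<circ> coset_rep lam w))) = w"
      by (rule cancel[OF s' s permutes_inv_o(2)[OF s] w])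
    from w' show "\<phi> (s \<circ> coset_rep lam (word_of lam (inv' s \<circ> coset_rep lam w))) = \<phi> (coset_rep lam w)"
      using right_invariant_word[OF \<phi> permutes_compose[OF coset_rep(1)[OF inv[OF s' w]] s] coset_rep(1)[OF w]]
        coset_rep(2)[OF w] by simp
  qed (use inv s s' in auto)
qed

section \<open>Homomorphisms between permutation modules\<close>

lemma perm_module_right_invariant:
  "f \<in> perm_module lam \<Longrightarrow> right_invariant lam f"
  using perm_module_iff[of lam "sum_list lam" f] by (simp add: right_invariant_def)

lemma id_in_young_subgroup: "id \<in> young_subgroup lam"
  by (simp add: young_subgroup_iff permutes_id)

lemma young_subgroup_inv: "q \<in> young_subgroup lam \<Longrightarrow> inv' q \<in> young_subgroup lam"
proof -
  assume q: "q \<in> young_subgroup lam"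
  then have p: "q permutes entries lam" by (simp add: young_subgroup_iff)
  have "row_of lam (inv' q b) = row_of lam b" if "b \<in> entries lam" for b
  proof -
    have "inv' q b \<in> entries lam" using that permutes_in_image[OF permutes_inv[OF p]] by blast
    then have "row_of lam (q (inv' q b)) = row_of lam (inv' q b)" using q by (simp only: young_subgroup_iff)
    then show ?thesis by (simp only: permutes_inverses(1)[OF p])
  qed
  then show ?thesis unfolding young_subgroup_iff using permutes_inv[OF p] by blast
qed

lemma tabloid_apply:
  assumes z: "z permutes entries lam" and x: "x permutes entries lam"
  shows "tabloid lam z x = (if word_of lam z = word_of lam x then 1 else (0::'k::field))"
proof -
  have "x \<in> z <#\<^bsub>sym_group (sum_list lam)\<^esub> young_subgroup lam \<longleftrightarrow> inv' z \<circ> x \<in> young_subgroup lam"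
  proof
    assume "x \<in> z <#\<^bsub>sym_group (sum_list lam)\<^esub> young_subgroup lam"
    then obtain h where "h \<in> young_subgroup lam" "x = z \<circ> h"
      by (auto simp: l_coset_def sym_group_mult)
    then show "inv' z \<circ> x \<in> young_subgroup lam" using permutes_inv_o(2)[OF z] by (simp flip: comp_assoc)
  next
    assume h: "inv' z \<circ> x \<in> young_subgroup lam"
    have "x = z \<circ> (inv' z \<circ> x)" using permutes_inv_o(1)[OF z] by (simp flip: comp_assoc)
    then show "x \<in> z <#\<^bsub>sym_group (sum_list lam)\<^esub> young_subgroup lam"
      using h by (auto simp: l_coset_def sym_group_mult)
  qed
  then show ?thesis by (simp add: tabloid_def word_of_eq_iff[OF z x] indicator_def)
qed

lemma tabloid_outside:
  assumes z: "z permutes entries lam" and x: "\<not> x permutes entries lam"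
  shows "tabloid lam z x = (0::'k::field)"
proof -
  have "x \<notin> z <#\<^bsub>sym_group (sum_list lam)\<^esub> young_subgroup lam"
    using x permutes_compose[OF _ z] by (auto simp: l_coset_def sym_group_mult young_subgroup_iff)
  then show ?thesis by (simp add: tabloid_def)
qed

lemma tabloid_in_perm_module:
  assumes z: "z permutes entries lam"
  shows "(tabloid lam z :: _ \<Rightarrow> 'k::field) \<in> perm_module lam"
  unfolding perm_module_iff[OF refl]
proof (intro conjI allI impI)
  fix x h assume x: "x permutes entries lam" and h: "h \<in> young_subgroup lam"
  have xh: "x \<circ> h permutes entries lam" using h x permutes_compose by (auto simp: young_subgroup_iff)
  have "inv' x \<circ> (x \<circ> h) = h" using permutes_inv_o(2)[OF x] by (simp flip: comp_assoc)
  then have "word_of lam x = word_of lam (x \<circ> h)" using word_of_eq_iff[OF x xh] h by simp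
  then show "tabloid lam z (x \<circ> h) = (tabloid lam z x :: 'k)"
    unfolding tabloid_apply[OF z x] tabloid_apply[OF z xh] by simp
qed (rule tabloid_outside[OF z])

lemma tabloid_translate:
  assumes z: "z permutes entries lam"
  shows "tabloid lam z = (translate (sym_group (sum_list lam)) z (tabloid lam id) :: _ \<Rightarrow> 'k::field)"
proof
  fix x
  show "tabloid lam z x = (translate (sym_group (sum_list lam)) z (tabloid lam id) x :: 'k)"
  proof (cases "x permutes entries lam")
    case True
    have c: "inv' z \<circ> x permutes entries lam" using permutes_compose[OF True permutes_inv[OF z]] .
    show ?thesis unfolding translate_eq[OF z] tabloid_apply[OF z True] tabloid_apply[OF permutes_id c]
      word_of_eq_iff[OF z True] word_of_eq_iff[OF permutes_id c] by simp
  next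
    case False
    have "\<not> inv' z \<circ> x permutes entries lam"
    proof
      assume "inv' z \<circ> x permutes entries lam"
      from permutes_compose[OF this z] have "z \<circ> (inv' z \<circ> x) permutes entries lam" .
      then show False using False permutes_inv_o(1)[OF z] by (simp flip: comp_assoc)
    qed
    then show ?thesis
      unfolding translate_eq[OF z] using tabloid_outside[OF z False] tabloid_outside[OF permutes_id] by metis
  qed
qed

lemma translate_tabloid_young:
  assumes q: "q \<in> young_subgroup lam"
  shows "translate (sym_group (sum_list lam)) q (tabloid lam id) = (tabloid lam id :: _ \<Rightarrow> 'k::field)"
proof -
  have p: "q permutes entries lam" using q by (simp add: young_subgroup_iff)
  have "tabloid lam q x = (tabloid lam id x :: 'k)" for x
  proof (cases "x permutes entries lam")
    case True
    have "word_of lam id = word_of lam q" using word_of_eq_iff[OF permutes_id p] q by simp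
    then show ?thesis unfolding tabloid_apply[OF p True] tabloid_apply[OF permutes_id True] by simp
  next
    case False
    then show ?thesis using tabloid_outside[OF p] tabloid_outside[OF permutes_id] by metis
  qed
  then show ?thesis unfolding tabloid_translate[OF p, symmetric] by blast
qed

lemma perm_module_expand:
  assumes y: "y \<in> perm_module lam"
  shows "y = (\<Sum>w\<in>words lam. fscale (y (coset_rep lam w)) (tabloid lam (coset_rep lam w)))"
proof
  fix x
  have e: "(\<Sum>w\<in>words lam. fscale (y (coset_rep lam w)) (tabloid lam (coset_rep lam w))) x
      = (\<Sum>w\<in>words lam. y (coset_rep lam w) * tabloid lam (coset_rep lam w) x)"
    by (simp add: sum_fun_apply fscale_def)
  show "y x = (\<Sum>w\<in>words lam. fscale (y (coset_rep lam w)) (tabloid lam (coset_rep lam w))) x"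
  proof (cases "x permutes entries lam")
    case True
    have "(\<Sum>w\<in>words lam. y (coset_rep lam w) * tabloid lam (coset_rep lam w) x)
        = (\<Sum>w\<in>words lam. if w = word_of lam x then y (coset_rep lam w) else 0)"
      by (rule sum.cong) (auto simp: tabloid_apply[OF coset_rep(1) True] coset_rep(2))
    also have "\<dots> = y (coset_rep lam (word_of lam x))"
      using True finite_words by (auto simp: words_def)
    also have "\<dots> = y x"
      by (rule right_invariant_coset_rep[OF perm_module_right_invariant[OF y] True])
    finally show ?thesis unfolding e ..
  next
    case False
    then show ?thesis unfolding e
      using y by (simp add: perm_module_iff[OF refl] tabloid_outside[OF coset_rep(1) False])
  qed
qed

lemma perm_module_submodule: "sum_list lam = r \<Longrightarrow> sym.submodule r (perm_module lam)"
  using submodule_perm_module by blast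

lemma findim_perm_module: "sym.findim (perm_module lam :: ((nat \<Rightarrow> nat) \<Rightarrow> 'k::field) set)"
  unfolding sym.findim_def
proof (intro exI conjI subsetI)
  show "finite (tabloid lam ` perms (sum_list lam) :: ((nat \<Rightarrow> nat) \<Rightarrow> 'k) set)"
    using finite_perms by blast
  fix y :: "_ \<Rightarrow> 'k" assume y: "y \<in> perm_module lam"
  have "(\<Sum>w\<in>words lam. fscale (y (coset_rep lam w)) (tabloid lam (coset_rep lam w)))
      \<in> sym.span (tabloid lam ` perms (sum_list lam))"
    by (intro sym.span_sum sym.span_scale sym.span_base imageI CollectI coset_rep(1))
  then show "y \<in> sym.span (tabloid lam ` perms (sum_list lam))"
    by (rule ssubst[OF perm_module_expand[OF y], of "\<lambda>v. v \<in> sym.span (tabloid lam ` perms (sum_list lam))"])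
qed

text \<open>The permutation module of \<open>a\<close> is generated by \<open>tabloid a id\<close>,
  whose stabilizer is the Young subgroup of \<open>a\<close>. These functions are the possible
  images of that generator in the permutation module of \<open>b\<close>, and so parametrize the
  homomorphisms.\<close>

definition biinvariant :: "nat list \<Rightarrow> nat list \<Rightarrow> ((nat \<Rightarrow> nat) \<Rightarrow> 'k::field) set" where
  "biinvariant a b = {u \<in> perm_module b. \<forall>q\<in>young_subgroup a. \<forall>x. u (q \<circ> x) = u x}"

text \<open>Convolution with \<open>u\<close> over cosets. For bi-invariant \<open>u\<close> it is
  the homomorphism sending the generating tabloid to \<open>u\<close>.\<close>

definition hom_of :: "nat list \<Rightarrow> ((nat \<Rightarrow> nat) \<Rightarrow> 'k::field) \<Rightarrow> ((nat \<Rightarrow> nat) \<Rightarrow> 'k) \<Rightarrow> (nat \<Rightarrow> nat) \<Rightarrow> 'k" where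
  "hom_of a u y = (\<lambda>x. coset_sum a (\<lambda>z. y z * u (inv' z \<circ> x)))"

lemma inv_comp_perms:
  assumes "z permutes S"
  shows "inv' z \<circ> x permutes S \<longleftrightarrow> x permutes S"
proof
  assume "inv' z \<circ> x permutes S"
  from permutes_compose[OF this assms] have "z \<circ> (inv' z \<circ> x) permutes S" .
  then show "x permutes S" using permutes_inv_o(1)[OF assms] by (simp flip: comp_assoc)
qed (use permutes_compose permutes_inv assms in blast)

lemma inv_comp_eq: "\<lbrakk>p permutes S; q permutes S\<rbrakk> \<Longrightarrow> inv' (p \<circ> q) = inv' q \<circ> inv' p"
  by (simp add: o_inv_distrib permutes_bij)

context
  fixes a b :: "nat list" and r :: nat
  assumes a: "sum_list a = r" and b: "sum_list b = r"
begin

lemma hom_of_in_homs: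
  fixes u :: "(nat \<Rightarrow> nat) \<Rightarrow> 'k::field"
  assumes u: "u \<in> biinvariant a b"
  shows "hom_of a u \<in> sym.homs r (perm_module a) (perm_module b)"
  unfolding sym.homs_def
proof (intro CollectI conjI ballI allI)
  have ub: "u \<in> perm_module b" and ul: "\<And>q x. q \<in> young_subgroup a \<Longrightarrow> u (q \<circ> x) = u x"
    using u by (auto simp: biinvariant_def)
  note um = ub[unfolded perm_module_iff[OF b]]
  fix y :: "(nat \<Rightarrow> nat) \<Rightarrow> 'k" assume y: "y \<in> perm_module a"
  show "hom_of a u y \<in> perm_module b"
    unfolding perm_module_iff[OF b]
  proof (intro conjI allI impI)
    fix x h assume "x permutes {1..r}" "h \<in> young_subgroup b"
    then show "hom_of a u y (x \<circ> h) = hom_of a u y x"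
      unfolding hom_of_def
      by (intro coset_sum_cong) (use um in \<open>simp add: a comp_assoc[symmetric] inv_comp_perms\<close>)
  next
    fix x assume "\<not> x permutes {1..r}"
    then have "u (inv' z \<circ> x) = 0" if "z permutes entries a" for z
      using um that by (simp add: a inv_comp_perms)
    then have "hom_of a u y x = coset_sum a (\<lambda>z. 0)"
      unfolding hom_of_def by (intro coset_sum_cong) simp
    then show "hom_of a u y x = 0" by (simp add: coset_sum_def)
  qed
  show "hom_of a u (y + v) = hom_of a u y + hom_of a u v" for v
    by (auto simp: hom_of_def coset_sum_def fun_eq_iff sum.distrib algebra_simps)
  show "hom_of a u (fscale c y) = fscale c (hom_of a u y)" for c
    by (auto simp: hom_of_def coset_sum_def fun_eq_iff fscale_def sum_distrib_left algebra_simps)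
  fix s assume "s \<in> carrier (sym_group r)"
  then have s: "s permutes {1..r}" by (simp add: sym_group_carrier)
  show "hom_of a u (translate (sym_group r) s y) = translate (sym_group r) s (hom_of a u y)"
  proof
    fix x
    \<comment> \<open>Right invariance of \<open>y\<close> and left invariance of \<open>u\<close>
      make this constant on cosets, so the sum can be shifted by \<open>s\<close>.\<close>
    let ?\<phi> = "\<lambda>z. y (inv' s \<circ> z) * u (inv' z \<circ> x)"
    have "right_invariant a ?\<phi>"
      unfolding right_invariant_def
    proof (intro allI impI)
      fix z h assume z: "z permutes entries a" and h: "h \<in> young_subgroup a"
      have hp: "h permutes entries a" using h by (simp add: young_subgroup_iff)
      have sz: "inv' s \<circ> z permutes {1..r}" using inv_comp_perms[OF s] z a by simp
      have "y (inv' s \<circ> (z \<circ> h)) = y (inv' s \<circ> z)"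
        using y sz h unfolding perm_module_iff[OF a] by (simp flip: comp_assoc)
      moreover have "u (inv' (z \<circ> h) \<circ> x) = u (inv' z \<circ> x)"
        unfolding inv_comp_eq[OF z hp] comp_assoc by (rule ul[OF young_subgroup_inv[OF h]])
      ultimately show "?\<phi> (z \<circ> h) = ?\<phi> z" by simp
    qed
    from coset_sum_shift[OF this] have "coset_sum a ?\<phi> = coset_sum a (\<lambda>z. ?\<phi> (s \<circ> z))" using s a by simp
    also have "\<dots> = coset_sum a (\<lambda>z. y z * u (inv' z \<circ> (inv' s \<circ> x)))"
    proof (rule coset_sum_cong)
      fix z assume z: "z permutes entries a"
      have "inv' s \<circ> (s \<circ> z) = z" using permutes_inv_o(2)[OF s] by (simp flip: comp_assoc)
      moreover have "inv' (s \<circ> z) \<circ> x = inv' z \<circ> (inv' s \<circ> x)"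
        using inv_comp_eq[OF s] z a by (simp add: comp_assoc)
      ultimately show "?\<phi> (s \<circ> z) = y z * u (inv' z \<circ> (inv' s \<circ> x))" by simp
    qed
    finally show "hom_of a u (translate (sym_group r) s y) x = translate (sym_group r) s (hom_of a u y) x"
      by (simp add: hom_of_def translate_eq[OF s])
  qed
qed

lemma hom_of_tabloid:
  assumes u: "u \<in> biinvariant a b"
  shows "hom_of a u (tabloid a id) = u"
proof
  fix x :: "nat \<Rightarrow> nat"
  have ul: "\<And>q x. q \<in> young_subgroup a \<Longrightarrow> u (q \<circ> x) = u x" using u by (auto simp: biinvariant_def)
  let ?\<phi> = "\<lambda>z :: nat \<Rightarrow> nat. u (inv' z \<circ> x)"
  have inv: "right_invariant a ?\<phi>"
    unfolding right_invariant_def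
  proof (intro allI impI)
    fix z h assume z: "z permutes entries a" and h: "h \<in> young_subgroup a"
    have hp: "h permutes entries a" using h by (simp add: young_subgroup_iff)
    show "?\<phi> (z \<circ> h) = ?\<phi> z"
      unfolding inv_comp_eq[OF z hp] comp_assoc by (rule ul[OF young_subgroup_inv[OF h]])
  qed
  have "hom_of a u (tabloid a id) x = (\<Sum>w\<in>words a. if w = word_of a id then ?\<phi> (coset_rep a w) else 0)"
    unfolding hom_of_def coset_sum_def
    by (rule sum.cong) (auto simp: tabloid_apply[OF permutes_id coset_rep(1)] coset_rep(2))
  also have "\<dots> = ?\<phi> (coset_rep a (word_of a id))"
    using finite_words permutes_id by (auto simp: words_def)
  also have "\<dots> = ?\<phi> id" by (rule right_invariant_coset_rep[OF inv permutes_id])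
  finally show "hom_of a u (tabloid a id) x = u x" by simp
qed

lemma homs_tabloid_biinvariant:
  assumes f: "f \<in> sym.homs r (perm_module a) (perm_module b)"
  shows "f (tabloid a id) \<in> biinvariant a b"
  unfolding biinvariant_def
proof (intro CollectI conjI ballI allI)
  have t: "tabloid a id \<in> perm_module a" by (rule tabloid_in_perm_module[OF permutes_id])
  show "f (tabloid a id) \<in> perm_module b" using sym.homs_mem[OF f t] .
  fix q x assume "q \<in> young_subgroup a"
  then have q: "inv' q \<in> young_subgroup a" by (rule young_subgroup_inv)
  then have p: "inv' q permutes {1..r}" using a by (simp add: young_subgroup_iff)
  have "bij q" using \<open>q \<in> young_subgroup a\<close> by (auto simp: young_subgroup_iff permutes_bij)
  then have qq: "inv' (inv' q) = q" by (rule inv_inv_eq)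
  have "f (tabloid a id) = f (translate (sym_group r) (inv' q) (tabloid a id))"
    using translate_tabloid_young[OF q] a by metis
  also have "\<dots> = translate (sym_group r) (inv' q) (f (tabloid a id))"
    using sym.homs_act[OF f t] p by (simp add: sym_group_carrier)
  finally show "f (tabloid a id) (q \<circ> x) = f (tabloid a id) x"
    unfolding translate_eq[OF p] qq by metis
qed

lemma homs_apply:
  assumes f: "f \<in> sym.homs r (perm_module a) (perm_module b)" and y: "y \<in> perm_module a"
  shows "f y = hom_of a (f (tabloid a id)) y"
proof
  fix x
  let ?z = "coset_rep a"
  have t: "tabloid a (?z w) \<in> perm_module a" if "w \<in> words a" for w
    by (rule tabloid_in_perm_module[OF coset_rep(1)[OF that]])
  note sm = perm_module_submodule[OF a]
  have "f y = f (\<Sum>w\<in>words a. fscale (y (?z w)) (tabloid a (?z w)))"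
    using perm_module_expand[OF y] by simp
  also have "\<dots> = (\<Sum>w\<in>words a. f (fscale (y (?z w)) (tabloid a (?z w))))"
    by (rule sym.homs_sum[OF f sm]) (rule sym.submoduleD(5)[OF sm t])
  also have "\<dots> = (\<Sum>w\<in>words a. fscale (y (?z w)) (f (tabloid a (?z w))))"
    by (rule sum.cong) (simp_all add: sym.homs_scale[OF f t])
  also have "\<dots> = (\<Sum>w\<in>words a. fscale (y (?z w)) (translate (sym_group r) (?z w) (f (tabloid a id))))"
  proof (rule sum.cong)
    fix w assume w: "w \<in> words a"
    have "?z w \<in> carrier (sym_group r)" using coset_rep(1)[OF w] a by (simp add: sym_group_carrier)
    from sym.homs_act[OF f tabloid_in_perm_module[OF permutes_id] this]
    show "fscale (y (?z w)) (f (tabloid a (?z w)))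
        = fscale (y (?z w)) (translate (sym_group r) (?z w) (f (tabloid a id)))"
      unfolding tabloid_translate[OF coset_rep(1)[OF w]] a by (simp only:)
  qed simp
  finally have "f y x = (\<Sum>w\<in>words a. y (?z w) * translate (sym_group r) (?z w) (f (tabloid a id)) x)"
    by (simp add: sum_fun_apply fscale_def)
  also have "\<dots> = (\<Sum>w\<in>words a. y (?z w) * f (tabloid a id) (inv' (?z w) \<circ> x))"
  proof (rule sum.cong)
    fix w assume w: "w \<in> words a"
    show "y (?z w) * translate (sym_group r) (?z w) (f (tabloid a id)) x
        = y (?z w) * f (tabloid a id) (inv' (?z w) \<circ> x)"
      by (simp add: translate_eq[OF coset_rep(1)[OF w, unfolded a]])
  qed simp
  finally show "f y x = hom_of a (f (tabloid a id)) y x"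
    by (simp add: hom_of_def coset_sum_def)
qed

end

section \<open>The signed column sum\<close>

text \<open>James's signed column element of the group algebra, acting on \<open>u\<close>; on the
  standard tabloid it gives the polytabloid.\<close>

definition column_sum :: "nat list \<Rightarrow> ((nat \<Rightarrow> nat) \<Rightarrow> 'k::field) \<Rightarrow> (nat \<Rightarrow> nat) \<Rightarrow> 'k" where
  "column_sum mu u x = (\<Sum>p\<in>column_stabilizer mu. of_int (sign p) * u (inv' p \<circ> x))"

lemma column_permutes: "p \<in> column_stabilizer mu \<Longrightarrow> p permutes entries mu"
  by (simp add: column_iff)

lemma column_sign:
  "\<lbrakk>p \<in> column_stabilizer mu; q \<in> column_stabilizer mu\<rbrakk> \<Longrightarrow> sign (p \<circ> q) = sign p * sign q"
  using sign_compose column_permutes permutation_permutes by (metis finite_atLeastAtMost)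

lemma finite_column_stabilizer: "finite (column_stabilizer mu)"
  by (rule finite_subset[OF _ finite_perms]) (use column_permutes in auto)

lemma column_comp:
  assumes p: "p \<in> column_stabilizer mu" and q: "q \<in> column_stabilizer mu"
  shows "p \<circ> q \<in> column_stabilizer mu"
  unfolding column_iff
proof (intro conjI ballI)
  show "p \<circ> q permutes entries mu" using column_permutes[OF p] column_permutes[OF q] by (rule permutes_compose[rotated])
  fix b assume b: "b \<in> entries mu"
  have "q b \<in> entries mu" using permutes_in_image[OF column_permutes[OF q]] b by blast
  then show "col_of mu ((p \<circ> q) b) = col_of mu b" using p q b by (simp only: column_iff comp_apply)
qed

lemma column_inv:
  assumes p: "p \<in> column_stabilizer mu"
  shows "inv' p \<in> column_stabilizer mu"
  unfolding column_iff
proof (intro conjI ballI)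
  note pp = column_permutes[OF p]
  show "inv' p permutes entries mu" using permutes_inv[OF pp] .
  fix b assume b: "b \<in> entries mu"
  have "inv' p b \<in> entries mu" using permutes_in_image[OF permutes_inv[OF pp]] b by blast
  then have "col_of mu (p (inv' p b)) = col_of mu (inv' p b)" using p by (simp only: column_iff)
  then show "col_of mu (inv' p b) = col_of mu b" by (simp only: permutes_inverses(1)[OF pp])
qed

lemma column_row_trivial:
  assumes p: "p \<in> column_stabilizer mu" and y: "p \<in> young_subgroup mu"
  shows "p = id"
proof
  fix b
  show "p b = id b"
  proof (cases "b \<in> entries mu")
    case True
    have "p b \<in> entries mu" using permutes_in_image[OF column_permutes[OF p]] True by blast
    then have "p b = sum_list (take (row_of mu (p b)) mu) + col_of mu (p b)" by (rule col_of(3))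
    also have "\<dots> = sum_list (take (row_of mu b) mu) + col_of mu b"
      using p y True by (simp only: column_iff young_subgroup_iff)
    also have "\<dots> = b" using col_of(3)[OF True] by simp
    finally show ?thesis by simp
  next
    case False
    then show ?thesis using permutes_not_in[OF column_permutes[OF p]] by simp
  qed
qed

lemma column_sum_column_shift:
  assumes q: "q \<in> column_stabilizer mu"
  shows "column_sum mu u (q \<circ> x) = of_int (sign q) * column_sum mu u x"
proof -
  note qp = column_permutes[OF q]
  have "column_sum mu u (q \<circ> x) = (\<Sum>p\<in>column_stabilizer mu. of_int (sign q * sign p) * u (inv' p \<circ> x))"
    unfolding column_sum_def
  proof (rule sum.reindex_bij_witness[of _ "\<lambda>p. q \<circ> p" "\<lambda>p. inv' q \<circ> p"])
    fix p assume p: "p \<in> column_stabilizer mu"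
    show "q \<circ> (inv' q \<circ> p) = p" "inv' q \<circ> (q \<circ> p) = p"
      using permutes_inv_o[OF qp] by (simp_all flip: comp_assoc)
    show "inv' q \<circ> p \<in> column_stabilizer mu" "q \<circ> p \<in> column_stabilizer mu"
      using column_comp column_inv p q by auto
    have "sign q * sign (inv' q \<circ> p) = sign (q \<circ> (inv' q \<circ> p))"
      using column_sign[OF q column_comp[OF column_inv[OF q] p]] by simp
    then have s: "sign q * sign (inv' q \<circ> p) = sign p" using permutes_inv_o[OF qp] by (simp flip: comp_assoc)
    have "inv' (inv' q \<circ> p) = inv' p \<circ> q"
      using inv_comp_eq[OF permutes_inv[OF qp] column_permutes[OF p]]
      by (simp add: inv_inv_eq permutes_bij[OF qp])
    then show "of_int (sign q * sign (inv' q \<circ> p)) * u (inv' (inv' q \<circ> p) \<circ> x)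
        = of_int (sign p) * u (inv' p \<circ> (q \<circ> x))"
      unfolding s by (simp add: comp_assoc)
  qed
  then show ?thesis by (simp add: column_sum_def sum_distrib_left mult.assoc)
qed

lemma column_sum_right_invariant:
  assumes u: "u \<in> perm_module lam" and sum: "sum_list lam = sum_list mu"
    and x: "x permutes entries lam" and h: "h \<in> young_subgroup lam"
  shows "column_sum mu u (x \<circ> h) = column_sum mu u x"
  unfolding column_sum_def
proof (rule sum.cong)
  fix p assume p: "p \<in> column_stabilizer mu"
  have "inv' p \<circ> x permutes entries lam"
    using inv_comp_perms[OF column_permutes[OF p]] x sum by simp
  then have "u ((inv' p \<circ> x) \<circ> h) = u (inv' p \<circ> x)"
    using u h unfolding perm_module_iff[OF refl] by blast
  then show "of_int (sign p) * u (inv' p \<circ> (x \<circ> h)) = of_int (sign p) * u (inv' p \<circ> x)"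
    by (simp add: comp_assoc)
qed simp

text \<open>The transposition of \<open>a\<close> and \<open>b\<close> lies in the column stabilizer
  and fixes the tabloid of \<open>x\<close>, so it pairs the terms with opposite signs. Cancelling
  even against odd permutations, rather than deriving that the sum equals its negative, covers
  characteristic 2.\<close>

lemma column_sum_eq_0:
  assumes u: "u \<in> perm_module lam" and sum: "sum_list lam = sum_list mu"
    and x: "x permutes entries lam"
    and ab: "a \<in> entries lam" "b \<in> entries lam" "a \<noteq> b" "col_of mu a = col_of mu b"
      "row_of lam (inv' x a) = row_of lam (inv' x b)"
  shows "column_sum mu u x = 0"
proof -
  let ?t = "transpose a b" and ?C = "column_stabilizer mu"
  let ?f = "\<lambda>p. of_int (sign p) * u (inv' p \<circ> x)"
  have tp: "?t permutes entries mu" using ab sum by (simp add: permutes_swap_id)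
  have t: "?t \<in> ?C" unfolding column_iff using tp ab by (auto simp: transpose_def)
  have tt: "?t \<circ> (?t \<circ> p) = p" for p by (simp add: fun_eq_iff)
  have s: "sign (?t \<circ> p) = - sign p" if "p \<in> ?C" for p
    using column_sign[OF t that] ab(3) by (simp add: sign_swap_id)
  have neg: "?f (?t \<circ> p) = - ?f p" if p: "p \<in> ?C" for p
  proof -
    note pp = column_permutes[OF p]
    \<comment> \<open>The transposition conjugated by \<open>x\<close>; it preserves rows because
      \<open>a\<close> and \<open>b\<close> lie in one row of the tableau of
      \<open>x\<close>.\<close>
    let ?h = "inv' x \<circ> (?t \<circ> x)"
    have hp: "?h permutes entries lam"
      using inv_comp_perms[OF x] permutes_compose[OF x] tp sum by simp
    have "row_of lam (?h c) = row_of lam c" for c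
    proof -
      have c: "inv' x (x c) = c" by (rule permutes_inverses(2)[OF x])
      consider "x c = a" | "x c = b" | "x c \<noteq> a" "x c \<noteq> b" by blast
      then show ?thesis by cases (use ab(5) c in \<open>simp_all add: transpose_def\<close>)
    qed
    then have h: "?h \<in> young_subgroup lam" using hp by (simp add: young_subgroup_iff)
    have px: "inv' p \<circ> x permutes entries lam" using inv_comp_perms[OF pp] x sum by simp
    have "inv' (?t \<circ> p) = inv' p \<circ> ?t"
      using inv_comp_eq[OF tp pp] by simp
    then have "inv' (?t \<circ> p) \<circ> x = (inv' p \<circ> x) \<circ> ?h"
      using permutes_inverses(1)[OF x] by (simp add: fun_eq_iff)
    then have "u (inv' (?t \<circ> p) \<circ> x) = u (inv' p \<circ> x)"
      using u h px unfolding perm_module_iff[OF refl] by simp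
    then show ?thesis using s[OF p] by simp
  qed
  have ev: "evenperm (?t \<circ> p) \<longleftrightarrow> \<not> evenperm p" if "p \<in> ?C" for p
    using s[OF that] by (auto simp: sign_def split: if_splits)
  have "column_sum mu u x = sum ?f {p \<in> ?C. evenperm p} + sum ?f {p \<in> ?C. \<not> evenperm p}"
    unfolding column_sum_def
    by (subst sum.union_disjoint[symmetric])
       (auto simp: finite_column_stabilizer intro!: sum.cong)
  also have "sum ?f {p \<in> ?C. \<not> evenperm p} = sum (\<lambda>p. - ?f p) {p \<in> ?C. evenperm p}"
    by (rule sum.reindex_bij_witness[of _ "\<lambda>p. ?t \<circ> p" "\<lambda>p. ?t \<circ> p"])
       (auto simp: tt ev column_comp[OF t] neg simp del: of_int_minus comp_apply)
  finally show ?thesis by (simp only: sum_negf right_minus)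
qed

text \<open>
  If the word of \<open>x\<close> has distinct letters in each column, then comparing, column by column, the
  number of letters at most \<open>i\<close> with the number of rows at most \<open>i\<close> shows that each column of height
  \<open>h\<close> contains precisely the letters \<open>0, \<dots>, h - 1\<close>.
\<close>

lemma column_injective_word_fits:
  assumes mu: "sorted_wrt (\<ge>) mu" and x: "x permutes entries mu"
    and inj: "\<And>a b. \<lbrakk>a \<in> entries mu; b \<in> entries mu; a \<noteq> b; col_of mu a = col_of mu b\<rbrakk>
        \<Longrightarrow> row_of mu (inv' x a) \<noteq> row_of mu (inv' x b)"
    and b: "b \<in> entries mu"
  shows "col_of mu b \<le> mu ! row_of mu (inv' x b)"
proof (rule ccontr)
  let ?S = "entries mu"
  define w where "w c = row_of mu (inv' x c)" for c
  assume "\<not> col_of mu b \<le> mu ! row_of mu (inv' x b)"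
  then have bad: "mu ! w b < col_of mu b" by (simp add: w_def)
  have xS: "inv' x c \<in> ?S \<longleftrightarrow> c \<in> ?S" for c using permutes_in_image[OF permutes_inv[OF x]] .
  have mono: "mu ! j \<le> mu ! i" if "i \<le> j" "j < length mu" for i j
    using mu that by (cases "i = j") (auto simp: sorted_wrt_iff_nth_less)
  have wl: "w b < length mu" using row_of(1)[of "inv' x b" mu] xS b by (simp add: w_def)
  have below: "row_of mu c < w b" if c: "c \<in> ?S" "col_of mu c = col_of mu b" for c
  proof (rule ccontr)
    assume "\<not> row_of mu c < w b"
    then have "mu ! row_of mu c \<le> mu ! w b" using mono row_of(1)[OF c(1)] by simp
    then show False using col_of(2)[OF c(1)] c(2) bad by simp
  qed
  then have "0 < w b" using b by fastforce
  \<comment> \<open>With this \<open>i\<close> the whole column of \<open>b\<close> lies in rows at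
    most \<open>i\<close>, while the letter of \<open>b\<close> exceeds \<open>i\<close>: the
    comparison is strict in this column.\<close>
  then obtain i where i: "w b = Suc i" using gr0_implies_Suc by blast
  let ?N = "{c \<in> ?S. w c \<le> i}" and ?R = "{c \<in> ?S. row_of mu c \<le> i}"
  let ?col = "\<lambda>A j. {c \<in> A. col_of mu c = j}"
  have sums: "card A = (\<Sum>j\<in>col_of mu ` ?S. card (?col A j))" if "A \<subseteq> ?S" for A
  proof -
    have fA: "finite A" using that finite_subset by blast
    have "(\<Sum>j\<in>col_of mu ` ?S. \<Sum>c\<in>?col A j. (1::nat)) = (\<Sum>c\<in>A. 1)"
      by (rule sum.group[OF fA]) (use that in auto)
    then show ?thesis by simp
  qed
  have le: "card (?col ?N j) \<le> card (?col ?R j)" for j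
  \<comment> \<open>A column with no box below row \<open>i\<close> contributes all its boxes to
    \<open>?R\<close>. Any other column meets each of the rows 0 to \<open>i\<close>, while its
    distinct letters at most \<open>i\<close> number at most \<open>i + 1\<close>.\<close>
  proof (cases "\<exists>c\<in>?S. col_of mu c = j \<and> i < row_of mu c")
    case False
    then have "?col ?N j \<subseteq> ?col ?R j" by force
    then show ?thesis by (intro card_mono) auto
  next
    case True
    then obtain c where c: "c \<in> ?S" "col_of mu c = j" "i < row_of mu c" by blast
    have "{..i} \<subseteq> row_of mu ` ?col ?R j"
    proof
      fix i' assume i': "i' \<in> {..i}"
      then have lt: "i' < row_of mu c" using c by simp
      have "mu ! row_of mu c \<le> mu ! i'" by (rule mono) (use lt row_of(1)[OF c(1)] in auto)
      then have "j \<le> mu ! i'" using col_of(2)[OF c(1)] c(2) by simp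
      moreover have "1 \<le> j" using col_of(1)[OF c(1)] c(2) by simp
      moreover have "i' < length mu" using lt row_of(1)[OF c(1)] by simp
      ultimately have "sum_list (take i' mu) + j \<in> ?col ?R j" "row_of mu (sum_list (take i' mu) + j) = i'"
        using box_exists[of i' mu j] i' by auto
      then show "i' \<in> row_of mu ` ?col ?R j" by (intro image_eqI[OF sym])
    qed
    then have "card {..i} \<le> card (row_of mu ` ?col ?R j)" by (intro card_mono) auto
    also have "\<dots> \<le> card (?col ?R j)" by (intro card_image_le) auto
    finally have "Suc i \<le> card (?col ?R j)" by simp
    moreover have "card (?col ?N j) = card (w ` ?col ?N j)"
    proof (rule card_image[symmetric], rule inj_onI, rule ccontr)
      fix a b assume "a \<in> ?col ?N j" "b \<in> ?col ?N j" "w a = w b" "a \<noteq> b"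
      then show False using inj[of a b] by (simp add: w_def)
    qed
    moreover have "card (w ` ?col ?N j) \<le> card {..i}" by (intro card_mono) auto
    ultimately show ?thesis by simp
  qed
  have lt: "card (?col ?N (col_of mu b)) < card (?col ?R (col_of mu b))"
  proof (rule psubset_card_mono)
    have "b \<in> ?col ?R (col_of mu b)" using b below[OF b refl] i by simp
    moreover have "b \<notin> ?col ?N (col_of mu b)" using i by simp
    moreover have "?col ?N (col_of mu b) \<subseteq> ?col ?R (col_of mu b)" using below i by force
    ultimately show "?col ?N (col_of mu b) \<subset> ?col ?R (col_of mu b)" by blast
  qed simp
  have "card ?N < card ?R"
    unfolding sums[of ?N, OF Collect_restrict] sums[of ?R, OF Collect_restrict]
    by (rule sum_strict_mono_ex1) (use le lt b in auto)
  moreover have "card ?N = card ?R"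
  proof (rule bij_betw_same_card[of "inv' x"], rule bij_betwI[of _ _ _ x])
    show "inv' x \<in> ?N \<rightarrow> ?R" using xS by (auto simp: w_def)
    show "x \<in> ?R \<rightarrow> ?N" using permutes_in_image[OF x] permutes_inverses(2)[OF x] by (auto simp: w_def)
  qed (use permutes_inverses[OF x] in auto)
  ultimately show False by simp
qed

text \<open>Moving each entry within its column to the row named by its letter is a column
  permutation \<open>s\<close>, and \<open>s \<circ> x\<close> then preserves rows.\<close>

lemma column_row_factor:
  assumes mu: "sorted_wrt (\<ge>) mu" and x: "x permutes entries mu"
    and inj: "\<And>a b. \<lbrakk>a \<in> entries mu; b \<in> entries mu; a \<noteq> b; col_of mu a = col_of mu b\<rbrakk>
        \<Longrightarrow> row_of mu (inv' x a) \<noteq> row_of mu (inv' x b)"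
  shows "\<exists>p\<in>column_stabilizer mu. \<exists>h\<in>young_subgroup mu. x = p \<circ> h"
proof -
  let ?S = "entries mu"
  define w where "w c = row_of mu (inv' x c)" for c
  define s where "s c = (if c \<in> ?S then sum_list (take (w c) mu) + col_of mu c else c)" for c
  have box: "s c \<in> ?S" "row_of mu (s c) = w c" "col_of mu (s c) = col_of mu c" if c: "c \<in> ?S" for c
  proof -
    have "inv' x c \<in> ?S" using permutes_in_image[OF permutes_inv[OF x]] c by blast
    then have "w c < length mu" using row_of(1) by (simp add: w_def)
    note b = box_exists[OF this col_of(1)[OF c] column_injective_word_fits[OF mu x inj c, folded w_def]]
    have s: "s c = sum_list (take (w c) mu) + col_of mu c" unfolding s_def using c by (rule if_P)
    show "s c \<in> ?S" unfolding s by (rule b(1))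
    show "row_of mu (s c) = w c" unfolding s by (rule b(2))
    show "col_of mu (s c) = col_of mu c" unfolding s by (rule b(3))
  qed
  have "inj_on s ?S"
  proof (rule inj_onI, rule ccontr)
    fix a b assume ab: "a \<in> ?S" "b \<in> ?S" "s a = s b" "a \<noteq> b"
    then have "col_of mu a = col_of mu b" "w a = w b" using box(2,3)[OF ab(1)] box(2,3)[OF ab(2)] by simp_all
    then show False using inj[OF ab(1,2,4)] by (simp add: w_def)
  qed
  moreover have "s ` ?S \<subseteq> ?S" using box(1) by blast
  ultimately have "bij_betw s ?S ?S" by (simp add: bij_betw_def endo_inj_surj)
  then have sp: "s permutes ?S" by (rule bij_imp_permutes) (simp only: s_def if_False)
  then have sC: "s \<in> column_stabilizer mu" unfolding column_iff using box(3) by blast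
  have "s \<circ> x \<in> young_subgroup mu"
    unfolding young_subgroup_iff
  proof (intro conjI ballI)
    show "s \<circ> x permutes ?S" by (rule permutes_compose[OF x sp])
    fix b assume "b \<in> ?S"
    then have "x b \<in> ?S" using permutes_in_image[OF x] by blast
    from box(2)[OF this] show "row_of mu ((s \<circ> x) b) = row_of mu b"
      by (simp add: w_def permutes_inverses(2)[OF x])
  qed
  moreover have "x = inv' s \<circ> (s \<circ> x)" using permutes_inv_o(2)[OF sp] by (simp flip: comp_assoc)
  ultimately show ?thesis using column_inv[OF sC] by blast
qed

lemma homs_polytabloid:
  assumes f: "f \<in> sym.homs r (perm_module mu) (perm_module lam)" and r: "sum_list mu = r"
  shows "f (polytabloid mu) = column_sum mu (f (tabloid mu id))"
proof
  fix x
  have t: "tabloid mu p \<in> perm_module mu" if "p \<in> column_stabilizer mu" for p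
    by (rule tabloid_in_perm_module[OF column_permutes[OF that]])
  note sm = perm_module_submodule[OF r]
  have "f (polytabloid mu) = (\<Sum>p\<in>column_stabilizer mu. f (fscale (of_int (sign p)) (tabloid mu p)))"
    unfolding polytabloid_def by (rule sym.homs_sum[OF f sm]) (rule sym.submoduleD(5)[OF sm t])
  also have "\<dots> = (\<Sum>p\<in>column_stabilizer mu. fscale (of_int (sign p)) (f (tabloid mu p)))"
    by (rule sum.cong) (simp_all add: sym.homs_scale[OF f t])
  finally have "f (polytabloid mu) x = (\<Sum>p\<in>column_stabilizer mu. of_int (sign p) * f (tabloid mu p) x)"
    by (simp add: sum_fun_apply fscale_def)
  also have "\<dots> = column_sum mu (f (tabloid mu id)) x"
    unfolding column_sum_def
  proof (rule sum.cong)
    fix p assume p: "p \<in> column_stabilizer mu"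
    note pp = column_permutes[OF p]
    have "p \<in> carrier (sym_group r)" using pp r by (simp add: sym_group_carrier)
    from sym.homs_act[OF f tabloid_in_perm_module[OF permutes_id] this]
    have "f (tabloid mu p) = translate (sym_group r) p (f (tabloid mu id))"
      unfolding tabloid_translate[OF pp] r .
    then show "of_int (sign p) * f (tabloid mu p) x = of_int (sign p) * f (tabloid mu id) (inv' p \<circ> x)"
      by (simp add: translate_eq[OF pp[unfolded r]])
  qed simp
  finally show "f (polytabloid mu) x = column_sum mu (f (tabloid mu id)) x" .
qed

lemma polytabloid_eq_column_sum: "polytabloid mu = column_sum mu (tabloid mu id)"
proof -
  have "(\<lambda>f. f) \<in> sym.homs (sum_list mu) (perm_module mu) (perm_module mu)" by (simp add: sym.homs_def)
  from homs_polytabloid[OF this refl] show ?thesis .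
qed

text \<open>Only the identity contributes, as row and column stabilizers meet trivially. Hence the
  polytabloid is nonzero in every characteristic, and the scalar by which an endomorphism acts on it
  can be read off at \<open>id\<close>.\<close>

lemma polytabloid_id: "polytabloid mu id = (1 :: 'k::field)"
proof -
  have "polytabloid mu id = (\<Sum>p\<in>column_stabilizer mu. of_int (sign p) * (tabloid mu p id :: 'k))"
    by (simp add: polytabloid_def sum_fun_apply fscale_def)
  also have "\<dots> = (\<Sum>p\<in>column_stabilizer mu. if p = id then 1 else 0)"
  proof (rule sum.cong)
    fix p assume p: "p \<in> column_stabilizer mu"
    note pp = column_permutes[OF p]
    have "word_of mu p = word_of mu id \<longleftrightarrow> p = id"
      using word_of_eq_iff[OF permutes_id pp] column_row_trivial[OF p] id_in_young_subgroup[of mu]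
      by (auto simp del: id_apply)
    then show "of_int (sign p) * (tabloid mu p id :: 'k) = (if p = id then 1 else 0)"
      by (simp add: tabloid_apply[OF pp permutes_id])
  qed simp
  also have "\<dots> = 1"
    using finite_column_stabilizer by (simp add: column_iff permutes_id)
  finally show ?thesis .
qed

text \<open>A tabloid either has two entries of one column in one row, where both sides vanish, or
  is a column translate of the standard one, where both sides are their values at \<open>id\<close>
  up to the same sign. Applied to the image of the standard tabloid, this makes every endomorphism
  act on the polytabloid by a scalar.\<close>

lemma column_sum_eq_polytabloid:
  assumes mu: "sorted_wrt (\<ge>) mu" and y: "y \<in> perm_module mu"
  shows "column_sum mu y = fscale (column_sum mu y id) (polytabloid mu :: _ \<Rightarrow> 'k::field)"
proof
  fix x
  let ?t = "tabloid mu id :: _ \<Rightarrow> 'k"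
  have t: "?t \<in> perm_module mu" by (rule tabloid_in_perm_module[OF permutes_id])
  consider (out) "\<not> x permutes entries mu"
    | (factor) p h where "p \<in> column_stabilizer mu" "h \<in> young_subgroup mu" "x = p \<circ> h"
    | (repeat) a b where "x permutes entries mu" "a \<in> entries mu" "b \<in> entries mu"
        "a \<noteq> b" "col_of mu a = col_of mu b" "row_of mu (inv' x a) = row_of mu (inv' x b)"
    using column_row_factor[OF mu, of x] by blast
  then have "column_sum mu y x = column_sum mu y id * column_sum mu ?t x"
  proof cases
    case out
    have z: "column_sum mu v x = 0" if "v \<in> perm_module mu" for v :: "_ \<Rightarrow> 'k"
      unfolding column_sum_def
    proof (rule sum.neutral, rule ballI)
      fix p assume p: "p \<in> column_stabilizer mu"
      have "\<not> inv' p \<circ> x permutes entries mu"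
        using inv_comp_perms[OF column_permutes[OF p]] out by blast
      then show "of_int (sign p) * v (inv' p \<circ> x) = 0" using that by (simp add: perm_module_iff[OF refl])
    qed
    show ?thesis using z[OF y] z[OF t] by simp
  next
    case factor
    have v: "column_sum mu v x = of_int (sign p) * column_sum mu v id" if "v \<in> perm_module mu" for v :: "_ \<Rightarrow> 'k"
      unfolding factor(3)
      using column_sum_right_invariant[OF that refl column_permutes[OF factor(1)] factor(2)]
        column_sum_column_shift[OF factor(1), of v id] by simp
    have "column_sum mu ?t id = 1" using polytabloid_id[of mu] unfolding polytabloid_eq_column_sum .
    then show ?thesis using v[OF y] v[OF t] by simp
  next
    case repeat
    show ?thesis
      using column_sum_eq_0[OF y refl repeat] column_sum_eq_0[OF t refl repeat] by simp
  qed
  then show "column_sum mu y x = fscale (column_sum mu y id) (polytabloid mu) x"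
    by (simp add: fscale_def polytabloid_eq_column_sum)
qed

section \<open>Kostka numbers as ranks\<close>

lemma polytabloid_in_specht: "(polytabloid mu :: _ \<Rightarrow> 'k::field) \<in> specht_module mu"
proof -
  have "translate (sym_group (sum_list mu)) id (polytabloid mu) = (polytabloid mu :: _ \<Rightarrow> 'k)"
    by (simp add: translate_eq[OF permutes_id])
  moreover have "id \<in> carrier (sym_group (sum_list mu))" by (simp add: sym_group_carrier permutes_id)
  ultimately show ?thesis
    unfolding specht_module_def by (intro sym.span_base image_eqI[OF sym])
qed

lemma specht_subset_iff:
  assumes "sym.submodule (sum_list mu) Y"
  shows "specht_module mu \<subseteq> Y \<longleftrightarrow> polytabloid mu \<in> Y"
proof
  assume "polytabloid mu \<in> Y"
  then show "specht_module mu \<subseteq> Y"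
    unfolding specht_module_def
    using sym.submoduleD(1,6)[OF assms] by (intro sym.span_minimal) auto
qed (use polytabloid_in_specht in blast)

text \<open>For \<open>u\<close> and \<open>v\<close> the images of the standard tabloids under
  homomorphisms \<open>f\<close> and \<open>g\<close>, this is the value at \<open>id\<close> of
  \<open>g \<circ> f\<close> applied to the polytabloid, that is, \<chi> of
  \<open>g \<circ> f\<close>.\<close>

definition kostka_form :: "nat list \<Rightarrow> nat list \<Rightarrow> ((nat \<Rightarrow> nat) \<Rightarrow> 'k::field) \<Rightarrow> ((nat \<Rightarrow> nat) \<Rightarrow> 'k) \<Rightarrow> 'k" where
  "kostka_form lam mu u v = coset_sum lam (\<lambda>z. column_sum mu u z * v (inv' z))"

lemma kostka_eq_kernel_rank:
  assumes lam: "sum_list lam = r" and mu: "sum_list mu = r" "sorted_wrt (\<ge>) mu"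
  shows "kostka TYPE('k::field) lam mu
    = kernel_rank (kostka_form lam mu) (biinvariant mu lam :: (_ \<Rightarrow> 'k) set) (biinvariant lam mu)"
proof -
  let ?N = "perm_module mu :: (_ \<Rightarrow> 'k) set" and ?M = "perm_module lam :: (_ \<Rightarrow> 'k) set"
  let ?e = "polytabloid mu :: _ \<Rightarrow> 'k" and ?Y = "young_module mu :: (_ \<Rightarrow> 'k) set"
  define \<chi> where "\<chi> \<theta> = \<theta> ?e id" for \<theta> :: "((nat \<Rightarrow> nat) \<Rightarrow> 'k) \<Rightarrow> (nat \<Rightarrow> nat) \<Rightarrow> 'k"
  note N = perm_module_submodule[OF mu(1), where 'a = 'k] findim_perm_module[of mu, where 'k = 'k]
  note M = perm_module_submodule[OF lam, where 'a = 'k] findim_perm_module[of lam, where 'k = 'k]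
  have eN: "?e \<in> ?N" using specht_module_subset polytabloid_in_specht by blast
  have e0: "?e \<noteq> 0" using polytabloid_id[of mu, where 'k = 'k] by auto
  have \<chi>: "\<theta> ?e = fscale (\<chi> \<theta>) ?e" if \<theta>: "\<theta> \<in> sym.homs r ?N ?N" for \<theta>
    unfolding \<chi>_def homs_polytabloid[OF \<theta> mu(1)]
    by (rule column_sum_eq_polytabloid[OF mu(2)])
      (rule sym.homs_mem[OF \<theta> tabloid_in_perm_module[OF permutes_id]])
  have "\<exists>Y. sym.indecomposable r Y \<and> sym.direct_summand r Y ?N \<and> specht_module mu \<subseteq> Y"
    using sym.exists_indecomposable_summand[where \<chi> = \<chi>, OF N eN e0 \<chi>] specht_subset_iff mu(1)
    by (metis sym.indecomposable_def)
  from someI_ex[OF this] have Y: "sym.indecomposable r ?Y" "sym.direct_summand r ?Y ?N" "?e \<in> ?Y"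
    unfolding young_module_def mu(1) using polytabloid_in_specht by auto
  have "kostka TYPE('k) lam mu
      = kernel_rank (\<lambda>f g. \<chi> (g \<circ> f)) (sym.homs r ?N ?M) (sym.homs r ?M ?N)"
    unfolding kostka_def lam
    by (rule sym.multiplicity_eq_kernel_rank[where \<chi> = \<chi>, OF M N eN e0 \<chi> Y])
  also have "\<dots> = kernel_rank (\<lambda>f g. kostka_form lam mu (f (tabloid mu id)) (g (tabloid lam id)))
      (sym.homs r ?N ?M) (sym.homs r ?M ?N)"
  proof (rule kernel_rank_cong)
    fix f g assume f: "f \<in> sym.homs r ?N ?M" and g: "g \<in> sym.homs r ?M ?N"
    have "\<chi> (g \<circ> f) = hom_of lam (g (tabloid lam id)) (column_sum mu (f (tabloid mu id))) id"
      unfolding \<chi>_def comp_apply homs_apply[OF lam mu(1) g sym.homs_mem[OF f eN]]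
      by (simp only: homs_polytabloid[OF f mu(1)])
    then show "\<chi> (g \<circ> f) = kostka_form lam mu (f (tabloid mu id)) (g (tabloid lam id))"
      by (simp add: hom_of_def kostka_form_def)
  qed
  also have "\<dots> = kernel_rank (kostka_form lam mu) (biinvariant mu lam :: (_ \<Rightarrow> 'k) set) (biinvariant lam mu)"
  proof (rule kernel_rank_surj[where P = "\<lambda>f :: (_ \<Rightarrow> 'k) \<Rightarrow> _ \<Rightarrow> 'k. f (tabloid mu id)"
        and Q = "\<lambda>g :: (_ \<Rightarrow> 'k) \<Rightarrow> _ \<Rightarrow> 'k. g (tabloid lam id)"])
    have surj: "(\<lambda>f. f (tabloid a id)) ` sym.homs r (perm_module a) (perm_module b) = (biinvariant a b :: (_ \<Rightarrow> 'k) set)"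
      if "sum_list a = r" "sum_list b = r" for a b
    proof
      show "(\<lambda>f. f (tabloid a id)) ` sym.homs r (perm_module a) (perm_module b) \<subseteq> (biinvariant a b :: (_ \<Rightarrow> 'k) set)"
        using homs_tabloid_biinvariant[OF that] by blast
      show "(biinvariant a b :: (_ \<Rightarrow> 'k) set) \<subseteq> (\<lambda>f. f (tabloid a id)) ` sym.homs r (perm_module a) (perm_module b)"
      proof
        fix u :: "_ \<Rightarrow> 'k" assume u: "u \<in> biinvariant a b"
        show "u \<in> (\<lambda>f. f (tabloid a id)) ` sym.homs r (perm_module a) (perm_module b)"
          using hom_of_tabloid[OF that u] hom_of_in_homs[OF that u] by (intro image_eqI[of _ _ "hom_of a u"]) simp_all
      qed
    qed
    show "(\<lambda>f. f (tabloid mu id)) ` sym.homs r ?N ?M = biinvariant mu lam"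
      "(\<lambda>g. g (tabloid lam id)) ` sym.homs r ?M ?N = biinvariant lam mu"
      using surj lam mu(1) by auto
  qed
  finally show ?thesis .
qed

section \<open>Monomials span the bi-invariant functions\<close>

lemma digits_unique:
  fixes d d' :: "nat \<Rightarrow> nat"
  assumes "(\<Sum>i<L. d i * N ^ i) = (\<Sum>i<L. d' i * N ^ i)"
    and "\<And>i. i < L \<Longrightarrow> d i < N" "\<And>i. i < L \<Longrightarrow> d' i < N" and "i < L"
  shows "d i = d' i"
  using assms
proof (induction L arbitrary: d d' i)
  case (Suc L)
  have e: "(\<Sum>i<Suc L. d i * N ^ i) = d 0 + N * (\<Sum>i<L. d (Suc i) * N ^ i)" for d :: "nat \<Rightarrow> nat"
    by (simp only: sum.lessThan_Suc_shift) (simp add: sum_distrib_left mult_ac)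
  have eq: "d 0 + N * (\<Sum>i<L. d (Suc i) * N ^ i) = d' 0 + N * (\<Sum>i<L. d' (Suc i) * N ^ i)"
    using Suc.prems(1) unfolding e .
  have lt: "d 0 < N" "d' 0 < N" using Suc.prems by auto
  from eq have "(d 0 + N * (\<Sum>i<L. d (Suc i) * N ^ i)) mod N = (d' 0 + N * (\<Sum>i<L. d' (Suc i) * N ^ i)) mod N"
    by simp
  then have z: "d 0 = d' 0" using lt by simp
  then have "(\<Sum>i<L. d (Suc i) * N ^ i) = (\<Sum>i<L. d' (Suc i) * N ^ i)" using eq lt by simp
  from Suc.IH[OF this] have "d (Suc j) = d' (Suc j)" if "j < L" for j
    using Suc.prems(2,3) that by simp
  then show ?case using z Suc.prems(4) by (cases i) auto
qed simp

lemma sum_powers_eq_digits: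
  assumes "finite S" "f ` S \<subseteq> {..<L}"
  shows "(\<Sum>s\<in>S. N ^ f s) = (\<Sum>i<L. card {s \<in> S. f s = i} * (N::nat) ^ i)"
proof -
  have "(\<Sum>s\<in>S. N ^ f s) = (\<Sum>i<L. \<Sum>s\<in>{s \<in> S. f s = i}. N ^ f s)"
    by (rule sum.group[symmetric]) (use assms in auto)
  also have "\<dots> = (\<Sum>i<L. card {s \<in> S. f s = i} * N ^ i)"
    by (rule sum.cong) auto
  finally show ?thesis .
qed

text \<open>Fibres have fewer than \<open>N\<close> elements, so the sum is a base \<open>N\<close>
  numeral whose digits are the fibre sizes. One natural number thus encodes the multiset of values,
  and several variables can later be replaced by powers of a single \<open>t\<close>.\<close>

lemma sum_powers_eq_imp_fibres:
  assumes S: "finite S" "card S < N" and f: "f ` S \<subseteq> {..<L}" "f' ` S \<subseteq> {..<L}"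
    and e: "(\<Sum>s\<in>S. (N::nat) ^ f s) = (\<Sum>s\<in>S. N ^ f' s)"
  shows "card {s \<in> S. f s = i} = card {s \<in> S. f' s = i}"
proof (cases "i < L")
  case True
  have lt: "card {s \<in> S. g s = i} < N" for g :: "_ \<Rightarrow> nat" and i
    using card_mono[OF S(1), of "{s \<in> S. g s = i}"] S(2) by simp
  from digits_unique[OF e[unfolded sum_powers_eq_digits[OF S(1) f(1)] sum_powers_eq_digits[OF S(1) f(2)]] lt lt True]
  show ?thesis .
next
  case False
  then have "{s \<in> S. f s = i} = {}" "{s \<in> S. f' s = i} = {}" using f by auto
  then show ?thesis by (simp only:)
qed

lemma image_mset_eqI_card:
  fixes f f' :: "'a \<Rightarrow> 'b"
  assumes "finite S" "\<And>i. card {s \<in> S. f s = i} = card {s \<in> S. f' s = i}"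
  shows "image_mset f (mset_set S) = image_mset f' (mset_set S)"
proof (rule multiset_eqI)
  fix i
  have "count (image_mset g (mset_set S)) i = card {s \<in> S. g s = i}" for g :: "'a \<Rightarrow> 'b"
  proof -
    have "g -` {i} \<inter> S = {s \<in> S. g s = i}" by auto
    then show ?thesis using assms(1) by (simp add: count_image_mset)
  qed
  then show "count (image_mset f (mset_set S)) i = count (image_mset f' (mset_set S)) i"
    using assms(2) by simp
qed

text \<open>Lagrange interpolation separates the exponents.\<close>

lemma coefficients_in_subspace:
  fixes v :: "nat \<Rightarrow> 'a \<Rightarrow> 'k::field"
  assumes T: "fn.subspace T" and E: "finite E" and Z: "infinite Z"
    and mem: "\<And>t. t \<in> Z \<Longrightarrow> (\<Sum>e\<in>E. fscale (t ^ e) (v e)) \<in> T"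
    and e0: "e0 \<in> E"
  shows "v e0 \<in> T"
proof -
  define D where "D = Max E"
  have D: "e \<le> D" if "e \<in> E" for e using E that by (simp add: D_def)
  obtain S where S: "S \<subseteq> Z" "finite S" "card S = Suc D"
    using infinite_arbitrarily_large[OF Z, of "Suc D"] by blast
  define l where "l j = (\<Prod>i\<in>S - {j}. smult (inverse (j - i)) [:- i, 1:])" for j
  have pl: "poly (l j) i = (if i = j then 1 else 0)" if "i \<in> S" "j \<in> S" for i j
  proof (cases "i = j")
    case True
    have "poly (l j) j = (\<Prod>i\<in>S - {j}. 1)"
      unfolding l_def poly_prod
    proof (rule prod.cong)
      fix i assume "i \<in> S - {j}"
      then have "inverse (j - i) * (j - i) = 1" by (intro left_inverse) auto
      then show "poly (smult (inverse (j - i)) [:- i, 1:]) j = 1" by (simp add: algebra_simps)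
    qed simp
    then show ?thesis using True by simp
  next
    case False
    then have "i \<in> S - {j}" using that by simp
    then show ?thesis unfolding l_def poly_prod using False S(2) by (auto intro!: prod_zero)
  qed
  have dl: "degree (l j) \<le> D" if "j \<in> S" for j
  proof -
    have "degree (l j) \<le> (\<Sum>i\<in>S - {j}. degree (smult (inverse (j - i)) [:- i, 1:]))"
      unfolding l_def by (rule degree_prod_sum_le[unfolded comp_def]) (use S in simp)
    also have "\<dots> \<le> (\<Sum>i\<in>S - {j}. 1)" by (rule sum_mono) auto
    also have "\<dots> = D" using S that by simp
    finally show ?thesis .
  qed
  have interp: "monom 1 e = (\<Sum>j\<in>S. smult (j ^ e) (l j))" if "e \<in> E" for e
  proof (rule poly_eqI_degree[where A = S])
    fix x assume x: "x \<in> S"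
    have "poly (\<Sum>j\<in>S. smult (j ^ e) (l j)) x = (\<Sum>j\<in>S. if j = x then j ^ e else 0)"
      unfolding poly_sum by (rule sum.cong) (use x pl in auto)
    then show "poly (monom 1 e) x = poly (\<Sum>j\<in>S. smult (j ^ e) (l j)) x"
      using x S by (simp add: poly_monom)
  next
    show "degree (monom 1 e :: 'k poly) < card S" using D[OF that] S(3) by (simp add: degree_monom_eq)
    have "degree (\<Sum>j\<in>S. smult (j ^ e) (l j)) \<le> D"
      by (rule degree_sum_le[OF S(2)]) (use dl degree_smult_le order_trans in blast)
    then show "degree (\<Sum>j\<in>S. smult (j ^ e) (l j)) < card S" using S(3) by simp
  qed
  \<comment> \<open>The coefficients at \<open>e0\<close> of the Lagrange polynomials form a row of
    the inverse Vandermonde matrix, which isolates the term \<open>e0\<close>.\<close>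
  have co: "(\<Sum>j\<in>S. j ^ e * coeff (l j) e0) = (if e = e0 then 1 else 0)" if "e \<in> E" for e
    using arg_cong[OF interp[OF that], of "\<lambda>p. coeff p e0"] by (simp add: coeff_sum)
  have "v e0 = (\<Sum>j\<in>S. fscale (coeff (l j) e0) (\<Sum>e\<in>E. fscale (j ^ e) (v e)))"
  proof
    fix x
    have "(\<Sum>j\<in>S. fscale (coeff (l j) e0) (\<Sum>e\<in>E. fscale (j ^ e) (v e))) x
        = (\<Sum>j\<in>S. \<Sum>e\<in>E. (j ^ e * coeff (l j) e0) * v e x)"
      by (simp add: sum_fun_apply fscale_def sum_distrib_left mult_ac)
    also have "\<dots> = (\<Sum>e\<in>E. \<Sum>j\<in>S. (j ^ e * coeff (l j) e0) * v e x)" by (rule sum.swap)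
    also have "\<dots> = (\<Sum>e\<in>E. if e = e0 then v e x else 0)"
      by (rule sum.cong) (auto simp: co simp flip: sum_distrib_right)
    also have "\<dots> = v e0 x" using E e0 by simp
    finally show "v e0 x = (\<Sum>j\<in>S. fscale (coeff (l j) e0) (\<Sum>e\<in>E. fscale (j ^ e) (v e))) x" by simp
  qed
  also have "\<dots> \<in> T"
    by (rule fn.subspace_sum[OF T], rule fn.subspace_scale[OF T], rule mem[OF subsetD[OF S(1)]])
  finally show ?thesis .
qed

section \<open>Monomials at invertible matrices\<close>

definition GL :: "nat \<Rightarrow> 'k::field mat set" where
  "GL n = {A \<in> carrier_mat n n. det A \<noteq> 0}"

text \<open>For a fixed permutation \<open>x\<close> this is a monomial in the entries of
  \<open>g\<close>. As a function of \<open>x\<close> it depends only on the double coset, since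
  reordering the factors or permuting within rows leaves the product unchanged.\<close>

definition monomial :: "nat list \<Rightarrow> nat list \<Rightarrow> 'k::field mat \<Rightarrow> (nat \<Rightarrow> nat) \<Rightarrow> 'k" where
  "monomial a b g x = (if x permutes entries b then
     \<Prod>c\<in>entries b. g $$ (row_of b c, row_of a (x c)) else 0)"

text \<open>Each position gets its own digit in base \<open>N\<close>, so distinct monomials of
  degree below \<open>N\<close> in the entries become distinct powers of \<open>t\<close>.\<close>

definition power_mat :: "nat \<Rightarrow> nat \<Rightarrow> 'k::field \<Rightarrow> 'k mat" where
  "power_mat n N t = mat n n (\<lambda>(i, j). t ^ (N ^ (i * n + j)))"

lemma index_lt: "\<lbrakk>i < n; j < n\<rbrakk> \<Longrightarrow> i * n + j < n * (n::nat)"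
proof -
  assume "i < n" "j < n"
  have "i * n + j < Suc i * n" using \<open>j < n\<close> by simp
  also have "\<dots> \<le> n * n" by (rule mult_le_mono1) (use \<open>i < n\<close> in simp)
  finally show ?thesis .
qed

lemma index_inj: "\<lbrakk>j < n; j' < n; i * n + j = i' * n + j'\<rbrakk> \<Longrightarrow> i = i' \<and> j = (j'::nat)"
proof -
  assume j: "j < n" "j' < n" and e: "i * n + j = i' * n + j'"
  from e have "(i * n + j) mod n = (i' * n + j') mod n" by (rule arg_cong)
  then have "j = j'" using j by simp
  then show ?thesis using e j by simp
qed

text \<open>In the Leibniz expansion the exponents are base \<open>N\<close> numerals recording the
  positions used, so the identity permutation is alone in its exponent. The determinant is thus a
  nonzero polynomial in \<open>t\<close>, with finitely many roots.\<close>

lemma infinite_power_mat_GL: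
  assumes inf: "infinite (UNIV :: 'k::field set)" and N: "n < N"
  shows "infinite {t :: 'k. power_mat n N t \<in> GL n}"
proof -
  let ?P = "{p. p permutes {0..<n}}"
  define ex where "ex p = (\<Sum>i\<in>{0..<n}. N ^ (i * n + p i))" for p
  define Q :: "'k poly" where "Q = (\<Sum>p\<in>?P. monom (signof p) (ex p))"
  have fP: "finite ?P" by (simp add: finite_permutations)
  have ev: "det (power_mat n N t) = poly Q t" for t :: 'k
  proof -
    have "det (power_mat n N t) = (\<Sum>p\<in>?P. signof p * (\<Prod>i = 0..<n. power_mat n N t $$ (i, p i)))"
      by (rule det_def'[of _ n]) (simp add: power_mat_def)
    also have "\<dots> = (\<Sum>p\<in>?P. signof p * t ^ ex p)"
    proof (rule sum.cong)
      fix p assume "p \<in> ?P"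
      then have "p i < n" if "i < n" for i using permutes_in_image[of p "{0..<n}" i] that by auto
      then show "signof p * (\<Prod>i = 0..<n. power_mat n N t $$ (i, p i)) = signof p * t ^ ex p"
        by (simp add: power_mat_def ex_def power_sum)
    qed simp
    finally show ?thesis by (simp add: Q_def poly_sum poly_monom)
  qed
  have uniq: "p = id" if p: "p permutes {0..<n}" and e: "ex p = ex id" for p
  proof
    fix i
    show "p i = id i"
    proof (cases "i < n")
      case True
      have pl: "p i < n" if "i < n" for i using permutes_in_image[OF p, of i] that by auto
      let ?f = "\<lambda>i. i * n + p i" and ?g = "\<lambda>i. i * n + id i"
      have "card {s \<in> {0..<n}. ?f s = ?g i} = card {s \<in> {0..<n}. ?g s = ?g i}"
        by (rule sum_powers_eq_imp_fibres[where L = "n * n" and N = N])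
          (use N e pl in \<open>auto simp: ex_def intro!: index_lt\<close>)
      moreover have "0 < card {s \<in> {0..<n}. ?g s = ?g i}" using True by (auto simp: card_gt_0_iff)
      ultimately have "{s \<in> {0..<n}. ?f s = ?g i} \<noteq> {}" by (metis card_gt_0_iff)
      then obtain s where "s < n" "s * n + p s = i * n + i" by auto
      then show ?thesis using index_inj[OF pl True] by auto
    next
      case False
      then show ?thesis using permutes_not_in[OF p] by simp
    qed
  qed
  have "coeff Q (ex id) = (\<Sum>p\<in>?P. if p = id then 1 else 0)"
    unfolding Q_def coeff_sum
    by (rule sum.cong) (use uniq in auto)
  also have "\<dots> = 1" using fP by (simp add: permutes_id)
  finally have "Q \<noteq> 0" by auto
  then have "finite {t. poly Q t = 0}" by (rule poly_roots_finite)
  moreover have "{t. power_mat n N t \<in> GL n} = UNIV - {t. poly Q t = 0}"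
    by (auto simp: GL_def ev) (simp_all add: power_mat_def)
  ultimately show ?thesis using inf by simp
qed

lemma row_of_pair_less:
  assumes "sum_list a = r" "sum_list b = r" "length a = n" "length b = n" "x permutes {1..r}" "c \<in> {1..r}"
  shows "row_of b c < n" "row_of a (x c) < n"
  using row_of(1)[of c b] row_of(1)[of "x c" a] permutes_in_image[OF assms(5)] assms by auto

text \<open>The exponent determines the multiset of pairs formed by the row of \<open>c\<close> in
  \<open>b\<close> and the row of \<open>x c\<close> in \<open>a\<close>. Equal multisets give a
  permutation \<open>h\<close> matching the pairs; it lies in the Young subgroup of
  \<open>b\<close>, and then \<open>x\<close> and \<open>y \<circ> h\<close> differ by the Young
  subgroup of \<open>a\<close>. So \<open>x\<close> and \<open>y\<close> lie in one double
  coset.\<close>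

lemma biinvariant_eq:
  assumes u: "u \<in> biinvariant a b" and r: "sum_list a = r" "sum_list b = r" and n: "length a = n" "length b = n"
    and N: "r < N" and x: "x permutes {1..r}" and y: "y permutes {1..r}"
    and e: "(\<Sum>c\<in>{1..r}. N ^ (row_of b c * n + row_of a (x c))) = (\<Sum>c\<in>{1..r}. N ^ (row_of b c * n + row_of a (y c)))"
  shows "u x = u y"
proof -
  let ?S = "{1..r}"
  let ?f = "\<lambda>x c. row_of b c * n + row_of a (x c)"
  note lt = row_of_pair_less[OF r n]
  have sub: "?f x ` ?S \<subseteq> {..<n * n}" if "x permutes ?S" for x
    using lt[OF that] index_lt by blast
  have "image_mset (?f x) (mset_set ?S) = image_mset (?f y) (mset_set ?S)"
    by (rule image_mset_eqI_card[OF _ sum_powers_eq_imp_fibres[OF _ _ sub[OF x] sub[OF y] e]]) (use N in auto)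
  from image_mset_eq_implies_permutes[OF _ this] obtain h where h: "h permutes ?S" "\<forall>c\<in>?S. ?f x c = ?f y (h c)"
    by auto
  have yh: "y \<circ> h permutes ?S" by (rule permutes_compose[OF h(1) y])
  have rows: "row_of b (h c) = row_of b c" "row_of a (x c) = row_of a ((y \<circ> h) c)" if c: "c \<in> ?S" for c
  proof -
    have hc: "h c \<in> ?S" using permutes_in_image[OF h(1)] c by blast
    show "row_of b (h c) = row_of b c" "row_of a (x c) = row_of a ((y \<circ> h) c)"
      using index_inj[OF lt(2)[OF x c] lt(2)[OF y hc] h(2)[rule_format, OF c]] by auto
  qed
  have hb: "h \<in> young_subgroup b" unfolding young_subgroup_iff r(2) using h(1) rows(1) by blast
  let ?q = "x \<circ> inv' (y \<circ> h)"
  have q: "?q \<in> young_subgroup a"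
    unfolding young_subgroup_iff r(1)
  proof (intro conjI ballI)
    show "?q permutes ?S" by (rule permutes_compose[OF permutes_inv[OF yh] x])
    fix d assume "d \<in> ?S"
    then have c: "inv' (y \<circ> h) d \<in> ?S" using permutes_in_image[OF permutes_inv[OF yh]] by blast
    have "row_of a (?q d) = row_of a ((y \<circ> h) (inv' (y \<circ> h) d))" using rows(2)[OF c] by simp
    then show "row_of a (?q d) = row_of a d" using permutes_inverses(1)[OF yh] by simp
  qed
  have "x = ?q \<circ> (y \<circ> h)" using permutes_inv_o(2)[OF yh] by (simp add: comp_assoc del: o_apply)
  then have "u x = u (?q \<circ> (y \<circ> h))" by simp
  also have "\<dots> = u (y \<circ> h)" using u q by (simp add: biinvariant_def)
  also have "\<dots> = u y" using u hb y r(2) by (simp add: biinvariant_def perm_module_iff[OF refl])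
  finally show ?thesis .
qed

lemma biinvariant_subset_span_monomials:
  assumes inf: "infinite (UNIV :: 'k::field set)"
    and r: "sum_list a = r" "sum_list b = r" and n: "length a = n" "length b = n"
  shows "(biinvariant a b :: (_ \<Rightarrow> 'k) set) \<subseteq> fn.span (monomial a b ` GL n)"
proof
  fix u :: "_ \<Rightarrow> 'k" assume u: "u \<in> biinvariant a b"
  let ?S = "{1..r}" and ?T = "fn.span (monomial a b ` (GL n :: 'k mat set))"
  define N where "N = Suc (max n r)"
  define ex where "ex x = (\<Sum>c\<in>?S. N ^ (row_of b c * n + row_of a (x c)))" for x
  define E where "E = ex ` perms r"
  \<comment> \<open>The indicator function of one double coset. The monomial at
    \<open>power_mat n N t\<close> combines these with coefficients \<open>t ^ e\<close>, from which
    interpolation recovers each of them.\<close>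
  define v :: "nat \<Rightarrow> _ \<Rightarrow> 'k" where "v e x = (if x \<in> perms r \<and> ex x = e then 1 else 0)" for e x
  have E: "finite E" using finite_perms by (simp add: E_def)
  note lt = row_of_pair_less[OF r n]
  have vT: "v e \<in> ?T" if "e \<in> E" for e
  proof (rule coefficients_in_subspace[OF fn.subspace_span E infinite_power_mat_GL[OF inf] _ that])
    show "n < N" by (simp add: N_def)
    fix t :: 'k assume t: "t \<in> {t. power_mat n N t \<in> GL n}"
    have "(\<Sum>e\<in>E. fscale (t ^ e) (v e)) = monomial a b (power_mat n N t)"
    proof
      fix x
      show "(\<Sum>e\<in>E. fscale (t ^ e) (v e)) x = monomial a b (power_mat n N t) x"
      proof (cases "x permutes ?S")
        case True
        have "(\<Sum>e\<in>E. fscale (t ^ e) (v e)) x = (\<Sum>e\<in>E. if e = ex x then t ^ e else 0)"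
          using True by (auto simp: sum_fun_apply fscale_def v_def intro!: sum.cong)
        also have "\<dots> = t ^ ex x" using True E by (simp add: E_def)
        also have "\<dots> = (\<Prod>c\<in>?S. power_mat n N t $$ (row_of b c, row_of a (x c)))"
          unfolding ex_def power_sum by (rule prod.cong) (simp_all add: power_mat_def lt[OF True])
        finally show ?thesis using True r by (simp add: monomial_def)
      next
        case False
        then show ?thesis using r by (simp add: sum_fun_apply fscale_def v_def monomial_def)
      qed
    qed
    then show "(\<Sum>e\<in>E. fscale (t ^ e) (v e)) \<in> ?T" using t by (auto intro: fn.span_base)
  qed
  define rep where "rep = inv_into (perms r) ex"
  have rep: "rep e \<in> perms r" "ex (rep e) = e" if "e \<in> E" for e
    using inv_into_into[of e ex "perms r"] f_inv_into_f[of e ex "perms r"] that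
    unfolding rep_def E_def by auto
  have "u = (\<Sum>e\<in>E. fscale (u (rep e)) (v e))"
  proof
    fix x
    show "u x = (\<Sum>e\<in>E. fscale (u (rep e)) (v e)) x"
    proof (cases "x permutes ?S")
      case True
      then have xE: "ex x \<in> E" by (simp add: E_def)
      have "(\<Sum>e\<in>E. fscale (u (rep e)) (v e)) x = (\<Sum>e\<in>E. if e = ex x then u (rep e) else 0)"
        using True by (auto simp: sum_fun_apply fscale_def v_def intro!: sum.cong)
      also have "\<dots> = u (rep (ex x))" using xE E by simp
      also have "\<dots> = u x"
        by (rule biinvariant_eq[OF u r n, of N]) (use rep[OF xE] True in \<open>auto simp: N_def ex_def\<close>)
      finally show ?thesis by simp
    next
      case False
      then show ?thesis using u r by (simp add: sum_fun_apply fscale_def v_def biinvariant_def perm_module_iff[OF refl])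
    qed
  qed
  also have "\<dots> \<in> ?T" by (intro fn.span_sum fn.span_scale vT)
  finally show "u \<in> ?T" .
qed

lemma monomial_biinvariant:
  assumes r: "sum_list a = r" "sum_list b = r"
  shows "monomial a b g \<in> biinvariant a b"
  unfolding biinvariant_def perm_module_iff[OF r(2)]
proof (intro CollectI conjI ballI allI impI)
  fix x h assume x: "x permutes {1..r}" and h: "h \<in> young_subgroup b"
  have hp: "h permutes {1..r}" using h r by (simp add: young_subgroup_iff)
  have "(\<Prod>c\<in>{1..r}. g $$ (row_of b c, row_of a (x (h c)))) = (\<Prod>c\<in>{1..r}. g $$ (row_of b (h c), row_of a (x (h c))))"
    by (rule prod.cong) (use h r in \<open>simp_all add: young_subgroup_iff\<close>)
  also have "\<dots> = (\<Prod>c\<in>{1..r}. g $$ (row_of b c, row_of a (x c)))"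
    using prod.permute[OF hp, of "\<lambda>c. g $$ (row_of b c, row_of a (x c))"] by (simp add: comp_def)
  finally show "monomial a b g (x \<circ> h) = monomial a b g x"
    using x permutes_compose[OF hp x] r by (simp add: monomial_def)
next
  fix q x assume q: "q \<in> young_subgroup a"
  have qp: "q permutes {1..r}" using q r by (simp add: young_subgroup_iff)
  show "monomial a b g (q \<circ> x) = monomial a b g x"
  proof (cases "x permutes {1..r}")
    case True
    have "row_of a (q (x c)) = row_of a (x c)" if "c \<in> {1..r}" for c
      using q r permutes_in_image[OF True, of c] that by (simp only: young_subgroup_iff)
    then show ?thesis using True permutes_compose[OF True qp] r by (simp add: monomial_def)
  next
    case False
    have "\<not> q \<circ> x permutes {1..r}"
    proof
      assume "q \<circ> x permutes {1..r}"
      then have "inv' q \<circ> (q \<circ> x) permutes {1..r}" using inv_comp_perms[OF qp] by blast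
      then show False using False permutes_inv_o(2)[OF qp] by (simp flip: comp_assoc)
    qed
    then show ?thesis using False r by (simp add: monomial_def)
  qed
qed (use r in \<open>simp add: monomial_def\<close>)

section \<open>Block determinants\<close>

text \<open>A Leibniz determinant over an arbitrary index set, so that the boxes of one column can
  serve as indices directly.\<close>

definition perm_det :: "'a set \<Rightarrow> ('a \<Rightarrow> 'a \<Rightarrow> 'k::comm_ring_1) \<Rightarrow> 'k" where
  "perm_det S \<phi> = (\<Sum>p | p permutes S. of_int (sign p) * (\<Prod>b\<in>S. \<phi> b (p b)))"

lemma det_eq_perm_det: "det (mat n n (\<lambda>(i, j). X i j)) = perm_det {0..<n} X"
proof -
  have "det (mat n n (\<lambda>(i, j). X i j))
      = (\<Sum>p | p permutes {0..<n}. of_int (sign p) * (\<Prod>i = 0..<n. mat n n (\<lambda>(i, j). X i j) $$ (i, p i)))"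
    by (rule det_def') simp
  also have "\<dots> = perm_det {0..<n} X"
    unfolding perm_det_def
  proof (rule sum.cong)
    fix p assume "p \<in> {p. p permutes {0..<n}}"
    then have "p i < n" if "i < n" for i using permutes_in_image[of p "{0..<n}" i] that by auto
    then show "of_int (sign p) * (\<Prod>i = 0..<n. mat n n (\<lambda>(i, j). X i j) $$ (i, p i))
        = of_int (sign p) * (\<Prod>b = 0..<n. X b (p b))" by simp
  qed simp
  finally show ?thesis .
qed

lemma perm_det_reindex:
  assumes f: "bij_betw f A B" and A: "finite A"
  shows "perm_det A (\<lambda>a a'. \<psi> (f a) (f a')) = perm_det B \<psi>"
proof -
  have inj: "inj_on f A" and img: "f ` A = B" using f by (auto simp: bij_betw_def)
  let ?g = "inv_into A f"
  have g: "bij_betw ?g B A" using bij_betw_inv_into[OF f] .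
  show ?thesis
    unfolding perm_det_def
  proof (rule sum.reindex_bij_witness[of _ "map_permutation B ?g" "map_permutation A f"])
    fix p assume "p \<in> {p. p permutes A}"
    then have p: "p permutes A" by simp
    show "map_permutation B ?g (map_permutation A f p) = p"
      by (rule map_permutation_compose_inv[OF f p]) (use inj in simp)
    show "map_permutation A f p \<in> {p. p permutes B}" using map_permutation_permutes[OF f p] by simp
    have "(\<Prod>b\<in>B. \<psi> b (map_permutation A f p b)) = (\<Prod>a\<in>A. \<psi> (f a) (map_permutation A f p (f a)))"
      unfolding img[symmetric] using inj by (simp add: prod.reindex)
    also have "\<dots> = (\<Prod>a\<in>A. \<psi> (f a) (f (p a)))"
      by (rule prod.cong) (simp_all add: map_permutation_apply[OF inj])
    finally show "of_int (sign (map_permutation A f p)) * (\<Prod>b\<in>B. \<psi> b (map_permutation A f p b))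
        = of_int (sign p) * (\<Prod>a\<in>A. \<psi> (f a) (f (p a)))"
      using sign_map_permutation[OF inj p A] by simp
  next
    fix p assume "p \<in> {p. p permutes B}"
    then have p: "p permutes B" by simp
    show "map_permutation A f (map_permutation B ?g p) = p"
      by (rule map_permutation_compose_inv[OF g p]) (use img f_inv_into_f in metis)
    show "map_permutation B ?g p \<in> {p. p permutes A}" using map_permutation_permutes[OF g p] by simp
  qed
qed

text \<open>Permutations preserving the fibres of \<open>f\<close> are products of permutations of
  single fibres, and signs multiply. This is the determinant of a block diagonal matrix with one
  block per fibre; values not taken by \<open>f\<close> contribute the empty determinant 1.\<close>

lemma sum_fibre_permutations:
  fixes \<phi> :: "'a \<Rightarrow> 'a \<Rightarrow> 'k::comm_ring_1"
  assumes "finite J" "finite S" "f ` S \<subseteq> J"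
  shows "(\<Sum>p | p permutes S \<and> (\<forall>b\<in>S. f (p b) = f b). of_int (sign p) * (\<Prod>b\<in>S. \<phi> b (p b)))
    = (\<Prod>j\<in>J. perm_det {b \<in> S. f b = j} \<phi>)"
  using assms
proof (induction J arbitrary: S rule: finite_induct)
  case empty
  then show ?case by simp
next
  case (insert j J)
  let ?T = "{b \<in> S. f b = j}" and ?U = "{b \<in> S. f b \<noteq> j}"
  let ?P = "\<lambda>S. {p. p permutes S \<and> (\<forall>b\<in>S. f (p b) = f b)}"
  let ?t = "\<lambda>S p. of_int (sign p) * (\<Prod>b\<in>S. \<phi> b (p b))"
  have fin: "finite ?T" "finite ?U" using insert.prems by auto
  have ST: "S = ?T \<union> ?U" "?T \<inter> ?U = {}" by auto
  have "(\<Sum>p\<in>?P S. ?t S p) = (\<Sum>(p, q)\<in>{p. p permutes ?T} \<times> ?P ?U. ?t ?T p * ?t ?U q)"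
  proof (rule sum.reindex_bij_witness[of _ "\<lambda>(p, q). p \<circ> q"
        "\<lambda>p. (\<lambda>b. if b \<in> ?T then p b else b, \<lambda>b. if b \<in> ?U then p b else b)"])
    fix p assume "p \<in> ?P S"
    then have p: "p permutes S" and fp: "\<And>b. b \<in> S \<Longrightarrow> f (p b) = f b" by auto
    have S: "p b \<in> S \<longleftrightarrow> b \<in> S" for b using permutes_in_image[OF p] .
    have out: "p b = b" if "b \<notin> S" for b using permutes_not_in[OF p that] .
    let ?p = "\<lambda>b. if b \<in> ?T then p b else b" and ?q = "\<lambda>b. if b \<in> ?U then p b else b"
    have perm: "(\<lambda>b. if b \<in> V then p b else b) permutes V"
      if "V \<subseteq> S" "\<And>b. b \<in> V \<Longrightarrow> p b \<in> V" for V
    proof (rule bij_imp_permutes)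
      have "inj_on p V" using permutes_inj_on[OF p] by blast
      moreover have "finite V" using insert.prems(1) that(1) finite_subset by blast
      ultimately have "bij_betw p V V" using that(2) by (auto simp: bij_betw_def endo_inj_surj image_subset_iff)
      then show "bij_betw (\<lambda>b. if b \<in> V then p b else b) V V"
        by (rule bij_betw_cong[THEN iffD1, rotated]) simp
    qed simp
    have pT: "?p permutes ?T" by (rule perm) (use fp S in auto)
    have pU: "?q permutes ?U" by (rule perm) (use fp S in auto)
    show "(case (?p, ?q) of (p, q) \<Rightarrow> p \<circ> q) = p"
      using fp S out by (auto simp: fun_eq_iff)
    show "(?p, ?q) \<in> {p. p permutes ?T} \<times> ?P ?U" using pT pU fp S by auto
    have "?p \<circ> ?q = p" using fp S out by (auto simp: fun_eq_iff)
    moreover have "sign (?p \<circ> ?q) = sign ?p * sign ?q"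
      using sign_compose pT pU fin permutation_permutes by blast
    ultimately have s: "sign p = sign ?p * sign ?q" by simp
    have "(\<Prod>b\<in>S. \<phi> b (p b)) = (\<Prod>b\<in>?T. \<phi> b (p b)) * (\<Prod>b\<in>?U. \<phi> b (p b))"
      using prod.union_disjoint[OF fin ST(2), of "\<lambda>b. \<phi> b (p b)"] ST(1) by simp
    also have "\<dots> = (\<Prod>b\<in>?T. \<phi> b (?p b)) * (\<Prod>b\<in>?U. \<phi> b (?q b))" by simp
    finally show "(case (?p, ?q) of (p, q) \<Rightarrow> ?t ?T p * ?t ?U q) = ?t S p"
      unfolding s by (simp add: mult_ac)
  next
    fix pq assume "pq \<in> {p. p permutes ?T} \<times> ?P ?U"
    then obtain p q where pq: "pq = (p, q)" "p permutes ?T" "q permutes ?U" "\<And>b. b \<in> ?U \<Longrightarrow> f (q b) = f b"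
      by auto
    have T: "p b \<in> ?T \<longleftrightarrow> b \<in> ?T" and U: "q b \<in> ?U \<longleftrightarrow> b \<in> ?U" for b
      by (rule permutes_in_image[OF pq(2)], rule permutes_in_image[OF pq(3)])
    have o: "b \<notin> ?T \<Longrightarrow> p b = b" "b \<notin> ?U \<Longrightarrow> q b = b" for b
      by (rule permutes_not_in[OF pq(2)], assumption, rule permutes_not_in[OF pq(3)])
    have pT: "p (q b) = p b" "f (p b) = j" "p b \<in> S" if "b \<in> ?T" for b using that o(2)[of b] T[of b] by auto
    have qU: "p (q b) = q b" "q b \<in> S" if "b \<in> ?U" for b using that o(1)[of "q b"] U[of b] by auto
    have oo: "p (q b) = b" if "b \<notin> S" for b using that o(1)[of b] o(2)[of b] by auto
    show "((\<lambda>b. if b \<in> ?T then (case pq of (p, q) \<Rightarrow> p \<circ> q) b else b),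
        (\<lambda>b. if b \<in> ?U then (case pq of (p, q) \<Rightarrow> p \<circ> q) b else b)) = pq"
      using pT(1) qU(1) o by (auto simp: pq(1) fun_eq_iff)
    have "p permutes S" "q permutes S" using permutes_subset pq(2,3) by blast+
    then have "p \<circ> q permutes S" using permutes_compose by blast
    moreover have "f (p (q b)) = f b" if "b \<in> S" for b
      using that pT[of b] qU[of b] pq(4)[of b] by (cases "f b = j") auto
    ultimately show "(case pq of (p, q) \<Rightarrow> p \<circ> q) \<in> ?P S" by (simp add: pq(1))
  qed
  also have "\<dots> = perm_det ?T \<phi> * (\<Sum>q\<in>?P ?U. ?t ?U q)"
    by (simp add: perm_det_def sum_product sum.cartesian_product)
  also have "(\<Sum>q\<in>?P ?U. ?t ?U q) = (\<Prod>i\<in>J. perm_det {b \<in> ?U. f b = i} \<phi>)"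
    by (rule insert.IH) (use insert.prems in auto)
  also have "\<dots> = (\<Prod>i\<in>J. perm_det {b \<in> S. f b = i} \<phi>)"
  proof (rule prod.cong)
    fix i assume "i \<in> J"
    then have "{b \<in> ?U. f b = i} = {b \<in> S. f b = i}" using insert.hyps by auto
    then show "perm_det {b \<in> ?U. f b = i} \<phi> = perm_det {b \<in> S. f b = i} \<phi>" by simp
  qed simp
  finally show ?case using insert.hyps by simp
qed

section \<open>Leading minors and the complementary minor identity\<close>

definition leading_minor :: "nat \<Rightarrow> 'k::comm_ring_1 mat \<Rightarrow> 'k" where
  "leading_minor h X = det (mat h h (\<lambda>(i, j). X $$ (i, j)))"

text \<open>Conjugation by the order reversing permutation matrix; it turns trailing principal
  minors into leading ones.\<close>

definition reverse_mat :: "nat \<Rightarrow> 'k mat \<Rightarrow> 'k mat" where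
  "reverse_mat n X = mat n n (\<lambda>(i, j). X $$ (n - Suc i, n - Suc j))"

lemma leading_minor_transpose:
  assumes X: "X \<in> carrier_mat n n" and h: "h \<le> n"
  shows "leading_minor h (transpose_mat X) = leading_minor h X"
proof -
  have "mat h h (\<lambda>(i, j). transpose_mat X $$ (i, j)) = transpose_mat (mat h h (\<lambda>(i, j). X $$ (i, j)))"
    using X h by (intro eq_matI) auto
  then show ?thesis by (simp add: leading_minor_def det_transpose[of _ h])
qed

lemma reverse_mat_carrier [simp]: "reverse_mat n X \<in> carrier_mat n n"
  by (simp add: reverse_mat_def)

lemma bij_betw_reverse: "bij_betw (\<lambda>i. n - Suc i) {0..<n} {0..<n}"
  by (rule bij_betwI[of _ _ _ "\<lambda>i. n - Suc i"]) auto

lemma reverse_mat_mult: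
  assumes A: "A \<in> carrier_mat n n" and B: "B \<in> carrier_mat n n"
  shows "reverse_mat n (A * B) = reverse_mat n A * reverse_mat n (B :: 'k::comm_ring_1 mat)"
proof (rule eq_matI)
  fix i j assume ij: "i < dim_row (reverse_mat n A * reverse_mat n B)" "j < dim_col (reverse_mat n A * reverse_mat n B)"
  then have i: "i < n" and j: "j < n" by (auto simp: reverse_mat_def)
  have "(reverse_mat n A * reverse_mat n B) $$ (i, j) = (\<Sum>k\<in>{0..<n}. A $$ (n - Suc i, n - Suc k) * B $$ (n - Suc k, n - Suc j))"
    using i j by (simp add: scalar_prod_def reverse_mat_def)
  also have "\<dots> = (\<Sum>k\<in>{0..<n}. A $$ (n - Suc i, k) * B $$ (k, n - Suc j))"
    by (rule sum.reindex_bij_betw[OF bij_betw_reverse])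
  also have "\<dots> = reverse_mat n (A * B) $$ (i, j)"
    using A B i j by (simp add: scalar_prod_def reverse_mat_def)
  finally show "reverse_mat n (A * B) $$ (i, j) = (reverse_mat n A * reverse_mat n B) $$ (i, j)" by simp
qed (auto simp: reverse_mat_def)

lemma det_reverse_mat:
  assumes X: "X \<in> carrier_mat n n"
  shows "det (reverse_mat n X) = det X"
proof -
  have "det (reverse_mat n X) = perm_det {0..<n} (\<lambda>i j. X $$ (n - Suc i, n - Suc j))"
    unfolding reverse_mat_def by (rule det_eq_perm_det)
  also have "\<dots> = perm_det {0..<n} (\<lambda>i j. X $$ (i, j))"
    by (rule perm_det_reindex[OF bij_betw_reverse]) simp
  also have "\<dots> = det (mat n n (\<lambda>(i, j). X $$ (i, j)))" by (rule det_eq_perm_det[symmetric])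
  also have "mat n n (\<lambda>(i, j). X $$ (i, j)) = X" using X by (intro eq_matI) auto
  finally show ?thesis .
qed

lemma leading_minor_reverse:
  assumes h: "h \<le> n"
  shows "leading_minor (n - h) (reverse_mat n Y) = det (mat (n - h) (n - h) (\<lambda>(i, j). Y $$ (i + h, j + h)))"
proof -
  let ?m = "n - h"
  have "leading_minor ?m (reverse_mat n Y) = det (mat ?m ?m (\<lambda>(i, j). Y $$ (?m - Suc i + h, ?m - Suc j + h)))"
    unfolding leading_minor_def
    by (rule arg_cong[of _ _ det], rule eq_matI) (use h in \<open>auto simp: reverse_mat_def\<close>)
  also have "\<dots> = perm_det {0..<?m} (\<lambda>i j. Y $$ (?m - Suc i + h, ?m - Suc j + h))"
    by (rule det_eq_perm_det)
  also have "\<dots> = perm_det {0..<?m} (\<lambda>i j. Y $$ (i + h, j + h))"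
    by (rule perm_det_reindex[OF bij_betw_reverse]) simp
  also have "\<dots> = det (mat ?m ?m (\<lambda>(i, j). Y $$ (i + h, j + h)))" by (rule det_eq_perm_det[symmetric])
  finally show ?thesis .
qed

text \<open>Multiply \<open>X\<close> by the matrix whose first \<open>h\<close> columns are those
  of the identity and whose remaining columns are those of \<open>Y\<close>. The product is block
  triangular, with the leading block of \<open>X\<close> and an identity on the diagonal, and
  determinants are compared.\<close>

lemma jacobi_leading_minor:
  fixes X Y :: "'k::field mat"
  assumes X: "X \<in> carrier_mat n n" and Y: "Y \<in> carrier_mat n n" and XY: "X * Y = 1\<^sub>m n" and h: "h \<le> n"
  shows "leading_minor h X = det X * leading_minor (n - h) (reverse_mat n Y)"
proof -
  let ?m = "n - h"
  obtain A B C D where s: "split_block X h h = (A, B, C, D)" by (metis prod_cases4)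
  obtain A' B' C' D' where s': "split_block Y h h = (A', B', C', D')" by (metis prod_cases4)
  have "dim_row X = h + ?m" "dim_col X = h + ?m" "dim_row Y = h + ?m" "dim_col Y = h + ?m" using X Y h by auto
  note b = split_block[OF s this(1,2)] and b' = split_block[OF s' this(3,4)]
  let ?Z = "four_block_mat (1\<^sub>m h) B' (0\<^sub>m ?m h) D'"
  have one: "1\<^sub>m n = four_block_mat (1\<^sub>m h) (0\<^sub>m h ?m) (0\<^sub>m ?m h) (1\<^sub>m ?m :: 'k mat)"
    using h by (intro eq_matI) auto
  have "X * Y = four_block_mat (A * A' + B * C') (A * B' + B * D') (C * A' + D * C') (C * B' + D * D')"
    using mult_four_block_mat[OF b(1-4) b'(1-4)] b(5) b'(5) by simp
  then have e: "four_block_mat (A * A' + B * C') (A * B' + B * D') (C * A' + D * C') (C * B' + D * D')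
      = four_block_mat (1\<^sub>m h) (0\<^sub>m h ?m) (0\<^sub>m ?m h) (1\<^sub>m ?m)" using XY one by simp
  have z: "A * B' + B * D' = 0\<^sub>m h ?m"
  proof (rule eq_matI)
    fix i j assume "i < dim_row (0\<^sub>m h ?m :: 'k mat)" "j < dim_col (0\<^sub>m h ?m :: 'k mat)"
    then show "(A * B' + B * D') $$ (i, j) = 0\<^sub>m h ?m $$ (i, j)"
      using arg_cong[OF e, of "\<lambda>M. M $$ (i, j + h)"] b b' by simp
  qed (use b b' in auto)
  have i: "C * B' + D * D' = 1\<^sub>m ?m"
  proof (rule eq_matI)
    fix i j assume "i < dim_row (1\<^sub>m ?m :: 'k mat)" "j < dim_col (1\<^sub>m ?m :: 'k mat)"
    then show "(C * B' + D * D') $$ (i, j) = 1\<^sub>m ?m $$ (i, j)"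
      using arg_cong[OF e, of "\<lambda>M. M $$ (i + h, j + h)"] b b' by simp
  qed (use b b' in auto)
  have "X * ?Z = four_block_mat (A * 1\<^sub>m h + B * 0\<^sub>m ?m h) (A * B' + B * D') (C * 1\<^sub>m h + D * 0\<^sub>m ?m h) (C * B' + D * D')"
    using mult_four_block_mat[OF b(1-4) one_carrier_mat b'(2) zero_carrier_mat b'(4)] b(5) by simp
  also have "\<dots> = four_block_mat A (0\<^sub>m h ?m) C (1\<^sub>m ?m)" unfolding z i using b by simp
  finally have XZ: "X * ?Z = four_block_mat A (0\<^sub>m h ?m) C (1\<^sub>m ?m)" .
  have Zc: "?Z \<in> carrier_mat n n" using b' h by (intro carrier_matI) auto
  have "det X * det ?Z = det (X * ?Z)" using det_mult[OF X Zc] by simp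
  also have "\<dots> = det A * det (1\<^sub>m ?m :: 'k mat)"
    unfolding XZ by (rule det_four_block_mat_upper_right_zero[OF b(1) refl b(3)]) simp
  also have "det ?Z = det (1\<^sub>m h :: 'k mat) * det D'"
    by (rule det_four_block_mat_lower_left_zero[OF _ b'(2) refl b'(4)]) simp
  finally have "det A = det X * det D'" by simp
  moreover have "A = mat h h (\<lambda>(i, j). X $$ (i, j))"
    using s unfolding split_block_def Let_def by (auto intro!: eq_matI)
  moreover have "D' = mat ?m ?m (\<lambda>(i, j). Y $$ (i + h, j + h))"
    using s' Y unfolding split_block_def Let_def by auto
  ultimately show ?thesis unfolding leading_minor_reverse[OF h] by (simp add: leading_minor_def)
qed

section \<open>The generating function of the forms\<close>

text \<open>The function \<Delta> in Leibniz form. The permutation enters through its inverse to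
  match \<open>column_sum\<close>.\<close>

definition column_minors :: "nat list \<Rightarrow> 'k::field mat \<Rightarrow> 'k" where
  "column_minors mu X = (\<Sum>p\<in>column_stabilizer mu.
     of_int (sign p) * (\<Prod>b\<in>entries mu. X $$ (row_of mu b, row_of mu (inv' p b))))"

definition column_height :: "nat list \<Rightarrow> nat \<Rightarrow> nat" where
  "column_height mu j = card {i. i < length mu \<and> j \<le> mu ! i}"

lemma downward_closed_eq_atLeastLessThan:
  fixes D :: "nat set"
  assumes D: "finite D" "\<And>i j. \<lbrakk>i \<in> D; j \<le> i\<rbrakk> \<Longrightarrow> j \<in> D"
  shows "D = {0..<card D}"
proof (rule card_subset_eq)
  show "D \<subseteq> {0..<card D}"
  proof
    fix i assume i: "i \<in> D"
    have "card {..i} \<le> card D" by (rule card_mono[OF D(1)]) (use D(2)[OF i] in auto)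
    then show "i \<in> {0..<card D}" by simp
  qed
qed simp_all

lemma partition_nth_mono: "\<lbrakk>sorted_wrt (\<ge>) mu; i \<le> j; j < length mu\<rbrakk> \<Longrightarrow> mu ! j \<le> (mu ! i :: nat)"
  by (cases "i = j") (auto simp: sorted_wrt_iff_nth_less)

text \<open>The column stabilizer consists of the permutations preserving the fibres of
  \<open>col_of\<close>, so the sum is a block determinant. Columns of height 0 give the empty minor
  1, so any bound \<open>m\<close> on the parts may be used.\<close>

lemma column_minors_eq:
  assumes mu: "sorted_wrt (\<ge>) mu" and m: "\<forall>a\<in>set mu. a \<le> m"
  shows "column_minors mu X = (\<Prod>j\<in>{1..m}. leading_minor (column_height mu j) X)"
proof -
  let ?S = "entries mu" and ?C = "column_stabilizer mu"
  let ?\<phi> = "\<lambda>b b'. X $$ (row_of mu b, row_of mu b')"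
  have inv_inv: "inv' (inv' p) = p" if "p \<in> ?C" for p
    using column_permutes[OF that] by (simp add: inv_inv_eq permutes_bij)
  have "column_minors mu X = (\<Sum>p\<in>?C. of_int (sign p) * (\<Prod>b\<in>?S. ?\<phi> b (p b)))"
    unfolding column_minors_def
  proof (rule sum.reindex_bij_witness[of _ inv' inv'])
    fix p assume p: "p \<in> ?C"
    have "permutation p" using column_permutes[OF p] permutation_permutes by blast
    then show "of_int (sign (inv' p)) * (\<Prod>b\<in>?S. ?\<phi> b (inv' p b)) = of_int (sign p) * (\<Prod>b\<in>?S. ?\<phi> b (inv' p b))"
      by (simp add: sign_inverse)
  qed (use inv_inv column_inv in auto)
  also have "?C = {p. p permutes ?S \<and> (\<forall>b\<in>?S. col_of mu (p b) = col_of mu b)}"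
    using column_iff[of _ mu] by blast
  also have "(\<Sum>p\<in>{p. p permutes ?S \<and> (\<forall>b\<in>?S. col_of mu (p b) = col_of mu b)}. of_int (sign p) * (\<Prod>b\<in>?S. ?\<phi> b (p b)))
      = (\<Prod>j\<in>{1..m}. perm_det {b \<in> ?S. col_of mu b = j} ?\<phi>)"
  proof (rule sum_fibre_permutations)
    show "col_of mu ` ?S \<subseteq> {1..m}"
    proof
      fix j assume "j \<in> col_of mu ` ?S"
      then obtain b where b: "b \<in> ?S" "j = col_of mu b" by blast
      have "mu ! row_of mu b \<le> m" using m row_of(1)[OF b(1)] by simp
      then show "j \<in> {1..m}" using col_of(1,2)[OF b(1)] b(2) by simp
    qed
  qed simp_all
  also have "\<dots> = (\<Prod>j\<in>{1..m}. leading_minor (column_height mu j) X)"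
  proof (rule prod.cong)
    fix j assume j: "j \<in> {1..m}"
    have D: "{i. i < length mu \<and> j \<le> mu ! i} = {0..<column_height mu j}"
      unfolding column_height_def
    proof (rule downward_closed_eq_atLeastLessThan)
      fix i i' assume "i \<in> {i. i < length mu \<and> j \<le> mu ! i}" "i' \<le> i"
      then show "i' \<in> {i. i < length mu \<and> j \<le> mu ! i}" using partition_nth_mono[OF mu, of i' i] by simp
    qed simp
    have "bij_betw (row_of mu) {b \<in> ?S. col_of mu b = j} {i. i < length mu \<and> j \<le> mu ! i}"
    proof (rule bij_betwI[of _ _ _ "\<lambda>i. sum_list (take i mu) + j"])
      show "row_of mu \<in> {b \<in> ?S. col_of mu b = j} \<rightarrow> {i. i < length mu \<and> j \<le> mu ! i}"
        using row_of(1)[of _ mu] col_of(2)[of _ mu] by blast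
      show "(\<lambda>i. sum_list (take i mu) + j) \<in> {i. i < length mu \<and> j \<le> mu ! i} \<rightarrow> {b \<in> ?S. col_of mu b = j}"
        using box_exists[of _ mu j] j by simp
      show "sum_list (take (row_of mu b) mu) + j = b" if "b \<in> {b \<in> ?S. col_of mu b = j}" for b
        using col_of(3)[of b mu] that by simp
      show "row_of mu (sum_list (take i mu) + j) = i" if "i \<in> {i. i < length mu \<and> j \<le> mu ! i}" for i
        using box_exists(2)[of i mu j] that j by simp
    qed
    then have "perm_det {b \<in> ?S. col_of mu b = j} ?\<phi> = perm_det {0..<column_height mu j} (\<lambda>i i'. X $$ (i, i'))"
      unfolding D by (rule perm_det_reindex) simp
    then show "perm_det {b \<in> ?S. col_of mu b = j} ?\<phi> = leading_minor (column_height mu j) X"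
      unfolding leading_minor_def det_eq_perm_det .
  qed simp
  finally show ?thesis .
qed

text \<open>The contribution of one choice \<open>w\<close> of inner summation indices when the
  entries of \<open>h * (mat_diag n \<zeta> * g)\<close> are multiplied out, with the diagonal
  factors removed.\<close>

definition word_term :: "nat list \<Rightarrow> 'k::field mat \<Rightarrow> 'k mat \<Rightarrow> (nat \<Rightarrow> nat) \<Rightarrow> 'k" where
  "word_term mu g h w = (\<Sum>p\<in>column_stabilizer mu. of_int (sign p) *
     (\<Prod>b\<in>entries mu. h $$ (row_of mu b, w b) * g $$ (w b, row_of mu (inv' p b))))"

text \<open>A representative \<open>z\<close> enters only through its word, and the words of
  \<open>lam\<close> list the cosets once each. After reindexing along \<open>z\<close>, the
  products for \<open>g\<close> and \<open>h\<close> run over the same entries.\<close>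

lemma kostka_form_monomial:
  assumes r: "sum_list lam = r" "sum_list mu = r"
  shows "kostka_form lam mu (monomial mu lam g) (monomial lam mu h) = (\<Sum>w\<in>words lam. word_term mu g h w)"
  unfolding kostka_form_def coset_sum_def
proof (rule sum.cong)
  fix w assume w: "w \<in> words lam"
  let ?S = "{1..r}"
  define z where "z = coset_rep lam w"
  have z: "z permutes ?S" and wz: "word_of lam z = w" using coset_rep[OF w] r by (simp_all add: z_def)
  have wb: "w b = row_of lam (inv' z b)" if "b \<in> ?S" for b
    using that r unfolding wz[symmetric] word_of_def by simp
  have h: "monomial lam mu h (inv' z) = (\<Prod>b\<in>?S. h $$ (row_of mu b, w b))"
  proof -
    have "monomial lam mu h (inv' z) = (\<Prod>b\<in>?S. h $$ (row_of mu b, row_of lam (inv' z b)))"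
      using permutes_inv[OF z] r by (simp add: monomial_def)
    also have "\<dots> = (\<Prod>b\<in>?S. h $$ (row_of mu b, w b))" by (rule prod.cong) (simp_all add: wb)
    finally show ?thesis .
  qed
  have g: "monomial mu lam g (inv' p \<circ> z) = (\<Prod>b\<in>?S. g $$ (w b, row_of mu (inv' p b)))"
    if p: "p \<in> column_stabilizer mu" for p
  proof -
    have pz: "inv' p \<circ> z permutes ?S"
      using inv_comp_perms[OF column_permutes[OF p]] z r by simp
    have "monomial mu lam g (inv' p \<circ> z) = (\<Prod>c\<in>?S. g $$ (row_of lam c, row_of mu (inv' p (z c))))"
      using pz r by (simp add: monomial_def)
    also have "\<dots> = (\<Prod>c\<in>?S. (\<lambda>b. g $$ (row_of lam (inv' z b), row_of mu (inv' p b))) (z c))"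
      using permutes_inverses(2)[OF z] by simp
    also have "\<dots> = (\<Prod>b\<in>?S. g $$ (row_of lam (inv' z b), row_of mu (inv' p b)))"
      using prod.permute[OF z, of "\<lambda>b. g $$ (row_of lam (inv' z b), row_of mu (inv' p b))"] by (simp add: comp_def)
    also have "\<dots> = (\<Prod>b\<in>?S. g $$ (w b, row_of mu (inv' p b)))" by (rule prod.cong) (simp_all add: wb)
    finally show ?thesis .
  qed
  have "column_sum mu (monomial mu lam g) z * monomial lam mu h (inv' z)
      = (\<Sum>p\<in>column_stabilizer mu. of_int (sign p) * (\<Prod>b\<in>?S. g $$ (w b, row_of mu (inv' p b)))
          * (\<Prod>b\<in>?S. h $$ (row_of mu b, w b)))"
    by (simp add: column_sum_def g h sum_distrib_right)
  also have "\<dots> = word_term mu g h w"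
    unfolding word_term_def r by (rule sum.cong) (simp_all add: prod.distrib mult_ac)
  finally show "column_sum mu (monomial mu lam g) (coset_rep lam w) * monomial lam mu h (inv' (coset_rep lam w))
      = word_term mu g h w" unfolding z_def .
qed simp

text \<open>Distributing the product over the sums produces every word with letters below
  \<open>n\<close>, of all contents. The factor in \<open>\<zeta>\<close> records the content, so
  the words of \<open>lam\<close> can be extracted as a coefficient.\<close>

lemma column_minors_generating_function:
  assumes n: "length mu = n" and g: "g \<in> carrier_mat n n" and h: "h \<in> carrier_mat n n"
  shows "column_minors mu (h * (mat_diag n \<zeta> * g))
    = (\<Sum>w\<in>entries mu \<rightarrow>\<^sub>E {0..<n}. (\<Prod>b\<in>entries mu. \<zeta> (w b)) * word_term mu g h w)"
proof -
  let ?S = "entries mu" and ?C = "column_stabilizer mu" and ?X = "h * (mat_diag n \<zeta> * g)"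
  let ?t = "\<lambda>p b l. \<zeta> l * (h $$ (row_of mu b, l) * g $$ (l, row_of mu (inv' p b)))"
  have "column_minors mu ?X = (\<Sum>p\<in>?C. of_int (sign p) * (\<Prod>b\<in>?S. \<Sum>l\<in>{0..<n}. ?t p b l))"
    unfolding column_minors_def
  proof (rule sum.cong)
    fix p assume p: "p \<in> ?C"
    have "?X $$ (row_of mu b, row_of mu (inv' p b)) = (\<Sum>l\<in>{0..<n}. ?t p b l)" if b: "b \<in> ?S" for b
    proof -
      have "inv' p b \<in> ?S" using permutes_in_image[OF permutes_inv[OF column_permutes[OF p]]] b by blast
      then have "row_of mu b < n" "row_of mu (inv' p b) < n" using row_of(1) b n by blast+
      then show ?thesis
        using g h by (simp add: mat_diag_mult_left[OF g] scalar_prod_def mult_ac)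
    qed
    then show "of_int (sign p) * (\<Prod>b\<in>?S. ?X $$ (row_of mu b, row_of mu (inv' p b)))
        = of_int (sign p) * (\<Prod>b\<in>?S. \<Sum>l\<in>{0..<n}. ?t p b l)"
      by (intro arg_cong2[where f = "(*)"] prod.cong refl)
  qed simp
  also have "\<dots> = (\<Sum>p\<in>?C. of_int (sign p) * (\<Sum>w\<in>?S \<rightarrow>\<^sub>E {0..<n}. \<Prod>b\<in>?S. ?t p b (w b)))"
    by (subst prod_sum_PiE) simp_all
  also have "\<dots> = (\<Sum>p\<in>?C. \<Sum>w\<in>?S \<rightarrow>\<^sub>E {0..<n}. (\<Prod>b\<in>?S. \<zeta> (w b)) * (of_int (sign p) *
      (\<Prod>b\<in>?S. h $$ (row_of mu b, w b) * g $$ (w b, row_of mu (inv' p b)))))"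
    by (simp add: sum_distrib_left prod.distrib mult_ac)
  also have "\<dots> = (\<Sum>w\<in>?S \<rightarrow>\<^sub>E {0..<n}. \<Sum>p\<in>?C. (\<Prod>b\<in>?S. \<zeta> (w b)) * (of_int (sign p) *
      (\<Prod>b\<in>?S. h $$ (row_of mu b, w b) * g $$ (w b, row_of mu (inv' p b)))))"
    by (rule sum.swap)
  finally show ?thesis by (simp add: word_term_def sum_distrib_left)
qed

section \<open>Words of prescribed content\<close>

lemma sum_over_rows:
  assumes "length lam = n"
  shows "(\<Sum>b\<in>entries lam. F (row_of lam b)) = (\<Sum>i\<in>{0..<n}. lam ! i * (F i :: nat))"
proof -
  let ?S = "entries lam"
  have "(\<Sum>b\<in>?S. F (row_of lam b)) = (\<Sum>i\<in>{0..<n}. \<Sum>b\<in>{b \<in> ?S. row_of lam b = i}. F (row_of lam b))"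
    by (rule sum.group[symmetric]) (use row_of(1)[of _ lam] assms in auto)
  also have "\<dots> = (\<Sum>i\<in>{0..<n}. lam ! i * F i)"
  proof (rule sum.cong)
    fix i assume "i \<in> {0..<n}"
    then have i: "i < length lam" using assms by simp
    have "{b \<in> ?S. row_of lam b = i} = {sum_list (take i lam)<..sum_list (take (Suc i) lam)}"
      using tableau_row_iff[OF i] tableau_row_eq[OF i] by blast
    then have c: "card {b \<in> ?S. row_of lam b = i} = lam ! i" by (simp add: sum_list_take_Suc[OF i])
    have "(\<Sum>b\<in>{b \<in> ?S. row_of lam b = i}. F (row_of lam b)) = (\<Sum>b\<in>{b \<in> ?S. row_of lam b = i}. F i)"
      by (rule sum.cong) auto
    also have "\<dots> = lam ! i * F i" unfolding sum_constant c by simp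
    finally show "(\<Sum>b\<in>{b \<in> ?S. row_of lam b = i}. F (row_of lam b)) = lam ! i * F i" .
  qed simp
  finally show ?thesis .
qed

text \<open>A word belongs to \<open>lam\<close> exactly when each letter \<open>i\<close> occurs
  \<open>lam ! i\<close> times, and the base \<open>N\<close> weight determines these numbers. The
  renumbering \<open>\<rho>\<close> is present because the complementary side is read with reversed
  letters.\<close>

lemma words_iff_weight:
  assumes n: "length lam = n" and N: "sum_list lam < N"
    and \<rho>: "inj_on \<rho> {0..<n}" "\<And>i. i < n \<Longrightarrow> \<rho> i < n"
  shows "w \<in> words lam \<longleftrightarrow> w \<in> entries lam \<rightarrow>\<^sub>E {0..<n} \<and>
    (\<Sum>b\<in>entries lam. N ^ \<rho> (w b)) = (\<Sum>i\<in>{0..<n}. lam ! i * N ^ \<rho> i)"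
proof -
  let ?S = "entries lam"
  have rows: "row_of lam b \<in> {0..<n}" if "b \<in> ?S" for b using row_of(1)[OF that] n by simp
  have base: "(\<Sum>b\<in>?S. N ^ \<rho> (row_of lam b)) = (\<Sum>i\<in>{0..<n}. lam ! i * N ^ \<rho> i)"
    by (rule sum_over_rows[OF n])
  show ?thesis
  proof
    assume "w \<in> words lam"
    then obtain x where x: "x permutes ?S" and w: "w = word_of lam x" by (auto simp: words_def)
    have inv: "inv' x b \<in> ?S \<longleftrightarrow> b \<in> ?S" for b by (rule permutes_in_image[OF permutes_inv[OF x]])
    have "w \<in> ?S \<rightarrow>\<^sub>E {0..<n}" using rows inv unfolding w word_of_def by auto
    moreover have "(\<Sum>b\<in>?S. N ^ \<rho> (w b)) = (\<Sum>b\<in>?S. N ^ \<rho> (row_of lam (inv' x b)))"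
      by (rule sum.cong) (auto simp: w word_of_def)
    moreover have "\<dots> = (\<Sum>b\<in>?S. N ^ \<rho> (row_of lam b))"
      using sum.permute[OF permutes_inv[OF x], of "\<lambda>b. N ^ \<rho> (row_of lam b)"] by (simp add: comp_def)
    ultimately show "w \<in> ?S \<rightarrow>\<^sub>E {0..<n} \<and> (\<Sum>b\<in>?S. N ^ \<rho> (w b)) = (\<Sum>i\<in>{0..<n}. lam ! i * N ^ \<rho> i)"
      using base by simp
  next
    assume a: "w \<in> ?S \<rightarrow>\<^sub>E {0..<n} \<and> (\<Sum>b\<in>?S. N ^ \<rho> (w b)) = (\<Sum>i\<in>{0..<n}. lam ! i * N ^ \<rho> i)"
    then have w: "w b \<in> {0..<n}" if "b \<in> ?S" for b using that by blast
    have fib: "card {b \<in> ?S. \<rho> (w b) = i} = card {b \<in> ?S. \<rho> (row_of lam b) = i}" for i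
      by (rule sum_powers_eq_imp_fibres[where L = n and N = N]) (use a base N w rows \<rho>(2) in auto)
    have "image_mset w (mset_set ?S) = image_mset (row_of lam) (mset_set ?S)"
    proof (rule image_mset_eqI_card)
      fix i
      have inj: "\<rho> k = \<rho> i \<longleftrightarrow> k = i" if "k \<in> {0..<n}" "i \<in> {0..<n}" for k
        using \<rho>(1) that by (auto simp: inj_on_def)
      show "card {b \<in> ?S. w b = i} = card {b \<in> ?S. row_of lam b = i}"
      proof (cases "i \<in> {0..<n}")
        case True
        have "{b \<in> ?S. w b = i} = {b \<in> ?S. \<rho> (w b) = \<rho> i}" "{b \<in> ?S. row_of lam b = i} = {b \<in> ?S. \<rho> (row_of lam b) = \<rho> i}"
          using inj[OF w True] inj[OF rows True] by blast+
        then show ?thesis using fib by simp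
      next
        case False
        then have "{b \<in> ?S. w b = i} = {}" "{b \<in> ?S. row_of lam b = i} = {}" using w rows by blast+
        then show ?thesis by (simp only:)
      qed
    qed simp
    from image_mset_eq_implies_permutes[OF _ this]
    obtain p where p: "p permutes ?S" "\<forall>b\<in>?S. w b = row_of lam (p b)" by auto
    have "inv' (inv' p) = p" using p(1) by (simp add: inv_inv_eq permutes_bij)
    then have "w = word_of lam (inv' p)"
      using p(2) a by (auto simp: word_of_def fun_eq_iff PiE_def extensional_def)
    then show "w \<in> words lam" using permutes_inv[OF p(1)] by (auto simp: words_def)
  qed
qed

section \<open>Duality\<close>

definition mat_inv :: "nat \<Rightarrow> 'k::field mat \<Rightarrow> 'k mat" where
  "mat_inv n g = (SOME g'. g' \<in> GL n \<and> g * g' = 1\<^sub>m n \<and> g' * g = 1\<^sub>m n)"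

lemma mat_inv:
  assumes "g \<in> GL n"
  shows "mat_inv n g \<in> GL n" "g * mat_inv n g = 1\<^sub>m n" "mat_inv n g * g = 1\<^sub>m n"
proof -
  have g: "g \<in> carrier_mat n n" "det g \<noteq> 0" using assms by (auto simp: GL_def)
  from det_non_zero_imp_unit[OF g, where b = "()"]
  obtain g' where g': "g' \<in> carrier_mat n n" "g' * g = 1\<^sub>m n" "g * g' = 1\<^sub>m n"
    by (auto simp: Units_def ring_mat_simps)
  have "det g * det g' = 1" using det_mult[OF g(1) g'(1)] g'(3) by simp
  then have "g' \<in> GL n" using g'(1) by (auto simp: GL_def)
  then have "\<exists>g'. g' \<in> GL n \<and> g * g' = 1\<^sub>m n \<and> g' * g = 1\<^sub>m n" using g' by blast
  from someI_ex[OF this] show "mat_inv n g \<in> GL n" "g * mat_inv n g = 1\<^sub>m n" "mat_inv n g * g = 1\<^sub>m n"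
    unfolding mat_inv_def by auto
qed

lemma mat_inv_unique:
  assumes g: "g \<in> GL n" and a: "a \<in> carrier_mat n n" "g * a = 1\<^sub>m n"
  shows "mat_inv n g = a"
proof -
  have c: "g \<in> carrier_mat n n" "mat_inv n g \<in> carrier_mat n n" using g mat_inv(1)[OF g] by (auto simp: GL_def)
  have "mat_inv n g = mat_inv n g * (g * a)" using a c by simp
  also have "\<dots> = (mat_inv n g * g) * a" using assoc_mult_mat[OF c(2,1) a(1)] by simp
  also have "\<dots> = a" using mat_inv(3)[OF g] a by simp
  finally show ?thesis .
qed

text \<open>Inversion and transposition both reverse products, so their composite does not:
  \<open>g\<close> and \<open>h\<close> keep their places around the diagonal matrix. The reversal
  turns the trailing minors of Jacobi's identity into leading ones.\<close>

definition contragredient :: "nat \<Rightarrow> 'k::field mat \<Rightarrow> 'k mat" where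
  "contragredient n g = transpose_mat (reverse_mat n (mat_inv n g))"

lemma GL_transpose: "g \<in> GL n \<Longrightarrow> transpose_mat g \<in> GL n"
  by (auto simp: GL_def det_transpose)

lemma GL_reverse: "g \<in> GL n \<Longrightarrow> reverse_mat n g \<in> GL n"
  by (auto simp: GL_def det_reverse_mat)

lemma reverse_mat_reverse: "g \<in> carrier_mat n n \<Longrightarrow> reverse_mat n (reverse_mat n g) = g"
  by (intro eq_matI) (auto simp: reverse_mat_def)

lemma contragredient_image: "contragredient n ` GL n = (GL n :: 'k::field mat set)"
proof
  show "contragredient n ` GL n \<subseteq> (GL n :: 'k mat set)"
    by (auto simp: contragredient_def intro!: GL_transpose GL_reverse mat_inv(1))
  show "GL n \<subseteq> contragredient n ` (GL n :: 'k mat set)"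
  proof
    fix k :: "'k mat" assume k: "k \<in> GL n"
    let ?a = "reverse_mat n (transpose_mat k)"
    have a: "?a \<in> GL n" by (rule GL_reverse[OF GL_transpose[OF k]])
    note i = mat_inv[OF a]
    have "mat_inv n (mat_inv n ?a) = ?a"
      by (rule mat_inv_unique[OF i(1) _ i(3)]) simp
    then have "contragredient n (mat_inv n ?a) = k"
      using k by (auto simp: contragredient_def reverse_mat_reverse GL_def)
    then show "k \<in> contragredient n ` GL n" using i(1) by (metis imageI)
  qed
qed

section \<open>Complementary partitions and their minors\<close>

lemma complement_props:
  assumes "lam \<in> partitions n r" "\<forall>a\<in>set lam. a \<le> m"
  shows "length (complement m lam) = n" "sorted_wrt (\<ge>) (complement m lam)"
    "\<forall>a\<in>set (complement m lam). a \<le> m"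
    "\<And>i. i < n \<Longrightarrow> complement m lam ! i = m - lam ! (n - Suc i)"
    "sum_list (complement m lam) = n * m - r"
  using complement_in_partitions[OF assms] assms(1)
  by (auto simp: partitions_def complement_def rev_nth)

text \<open>Rotated by half a turn, the complementary diagram fills the rest of the \<open>n\<close>
  by \<open>m\<close> rectangle. Column \<open>j\<close> and column \<open>m + 1 - j\<close> of the
  complement make up a full column, columns being counted from 1.\<close>

lemma column_height_complement:
  assumes mu: "mu \<in> partitions n r" "\<forall>a\<in>set mu. a \<le> m" and j: "j \<in> {1..m}"
  shows "column_height (complement m mu) (m + 1 - j) = n - column_height mu j"
proof -
  have l: "length mu = n" using mu by (simp add: partitions_def)
  have "{i. i < n \<and> m + 1 - j \<le> complement m mu ! i} = (\<lambda>i. n - Suc i) ` {i. i < n \<and> \<not> j \<le> mu ! i}"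
    (is "?A = _ ` ?B")
  proof
    show "(\<lambda>i. n - Suc i) ` ?B \<subseteq> ?A"
      using j by (auto simp: complement_props(4)[OF mu])
    show "?A \<subseteq> (\<lambda>i. n - Suc i) ` ?B"
    proof
      fix i assume i: "i \<in> ?A"
      have le: "mu ! (n - Suc i) \<le> m" using mu(2) l i by simp
      have "m + 1 - j \<le> m - mu ! (n - Suc i)" using i complement_props(4)[OF mu, of i] by simp
      then have "n - Suc i \<in> ?B" using i j le by auto
      moreover have "i = n - Suc (n - Suc i)" using i by simp
      ultimately show "i \<in> (\<lambda>i. n - Suc i) ` ?B" by blast
    qed
  qed
  moreover have "inj_on (\<lambda>i. n - Suc i) ?B" by (rule inj_onI) auto
  ultimately have "column_height (complement m mu) (m + 1 - j) = card ?B"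
    by (simp add: column_height_def complement_props(1)[OF mu] card_image)
  also have "?B = {0..<n} - {i. i < n \<and> j \<le> mu ! i}" by auto
  also have "card \<dots> = n - card {i. i < n \<and> j \<le> mu ! i}" by (subst card_Diff_subset) auto
  finally show ?thesis by (simp add: column_height_def l)
qed

lemma column_height_le: "column_height mu j \<le> length mu"
proof -
  have "column_height mu j \<le> card {0..<length mu}" unfolding column_height_def by (rule card_mono) auto
  then show ?thesis by simp
qed

text \<open>Jacobi's identity is applied to each of the \<open>m\<close> columns, empty ones
  included, and each contributes one factor \<open>det X\<close>; this is the origin of the exponent
  \<open>m\<close>.\<close>

lemma column_minors_complement:
  fixes X :: "'k::field mat"
  assumes mu: "mu \<in> partitions n r" "\<forall>a\<in>set mu. a \<le> m"
    and X: "X \<in> carrier_mat n n" and Y: "Y \<in> carrier_mat n n" and XY: "X * Y = 1\<^sub>m n"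
  shows "column_minors mu X = det X ^ m * column_minors (complement m mu) (transpose_mat (reverse_mat n Y))"
proof -
  have l: "length mu = n" and s: "sorted_wrt (\<ge>) mu" using mu by (auto simp: partitions_def)
  have h: "column_height mu j \<le> n" for j using column_height_le[of mu j] l by simp
  have "column_minors mu X = (\<Prod>j\<in>{1..m}. leading_minor (column_height mu j) X)"
    by (rule column_minors_eq[OF s mu(2)])
  also have "\<dots> = (\<Prod>j\<in>{1..m}. det X * leading_minor (n - column_height mu j) (reverse_mat n Y))"
    by (rule prod.cong[OF refl]) (rule jacobi_leading_minor[OF X Y XY h])
  also have "\<dots> = det X ^ m * (\<Prod>j\<in>{1..m}. leading_minor (n - column_height mu j) (reverse_mat n Y))"
    by (simp add: prod.distrib)
  also have "(\<Prod>j\<in>{1..m}. leading_minor (n - column_height mu j) (reverse_mat n Y))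
      = (\<Prod>j\<in>{1..m}. leading_minor (column_height (complement m mu) (m + 1 - j)) (reverse_mat n Y))"
    by (rule prod.cong[OF refl]) (simp only: column_height_complement[OF mu])
  also have "\<dots> = (\<Prod>j\<in>{1..m}. leading_minor (column_height (complement m mu) j) (reverse_mat n Y))"
    by (rule prod.reindex_bij_witness[of _ "\<lambda>j. m + 1 - j" "\<lambda>j. m + 1 - j"]) auto
  also have "\<dots> = (\<Prod>j\<in>{1..m}. leading_minor (column_height (complement m mu) j) (transpose_mat (reverse_mat n Y)))"
    by (rule prod.cong[OF refl], rule leading_minor_transpose[symmetric, of _ n])
      (use column_height_le[of "complement m mu"] complement_props(1)[OF mu] in simp_all)
  also have "\<dots> = column_minors (complement m mu) (transpose_mat (reverse_mat n Y))"
    by (rule column_minors_eq[OF complement_props(2,3)[OF mu], symmetric])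
  finally show ?thesis .
qed

lemma polys_eq_if_eq_off_zero:
  fixes p q :: "'k::field poly"
  assumes inf: "infinite (UNIV :: 'k set)" and e: "\<And>t. t \<noteq> 0 \<Longrightarrow> poly p t = poly q t"
  shows "p = q"
proof (rule ccontr)
  assume "p \<noteq> q"
  then have "finite {t. poly (p - q) t = 0}" by (intro poly_roots_finite) simp
  moreover have "UNIV - {0} \<subseteq> {t. poly (p - q) t = 0}" using e by auto
  ultimately have "finite (UNIV - {0 :: 'k})" using finite_subset by blast
  then show False using inf by simp
qed

text \<open>
  Both sides are coefficients of the generating function at \<open>\<zeta>\<^sub>i = t\<^bsup>N^i\<^esup>\<close>, where \<open>N\<close> is so large
  that the exponent determines the content of a word.
\<close>

lemma word_sum_complement:
  fixes g h :: "'k::field mat"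
  assumes inf: "infinite (UNIV :: 'k set)"
    and lam: "lam \<in> partitions n r" "\<forall>a\<in>set lam. a \<le> m"
    and mu: "mu \<in> partitions n r" "\<forall>a\<in>set mu. a \<le> m"
    and g: "g \<in> GL n" and h: "h \<in> GL n"
  shows "(\<Sum>w\<in>words lam. word_term mu g h w) = det g ^ m * det h ^ m *
    (\<Sum>w\<in>words (complement m lam). word_term (complement m mu) (contragredient n g) (contragredient n h) w)"
proof -
  let ?r' = "n * m - r" and ?lam' = "complement m lam" and ?mu' = "complement m mu"
  let ?g' = "contragredient n g" and ?h' = "contragredient n h"
  let ?S = "{1..r}" and ?S' = "{1..?r'}"
  let ?W = "?S \<rightarrow>\<^sub>E {0..<n}" and ?W' = "?S' \<rightarrow>\<^sub>E {0..<n}"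
  define N where "N = Suc (max r ?r')"
  define e where "e w = (\<Sum>b\<in>?S. N ^ w b)" for w
  \<comment> \<open>The inverted diagonal matrix is also reversed, so letter \<open>i\<close> on the
    complementary side carries the inverse of the variable with index
    \<open>n - Suc i\<close>.\<close>
  define e' where "e' w = (\<Sum>b\<in>?S'. N ^ (n - Suc (w b)))" for w
  \<comment> \<open>A bound for all exponents \<open>e' w\<close>; multiplying by
    \<open>t ^ L\<close> clears the negative powers of \<open>t\<close> on the complementary
    side.\<close>
  define L where "L = ?r' * N ^ n"
  define A where "A = (\<Sum>i\<in>{0..<n}. N ^ i)"
  define c where "c = det g ^ m * det h ^ m"
  have ll: "length lam = n" "sum_list lam = r" "length mu = n" "sum_list mu = r"
    using lam mu by (auto simp: partitions_def)
  note lc = complement_props[OF lam] and mc = complement_props[OF mu]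
  have gc: "g \<in> carrier_mat n n" "h \<in> carrier_mat n n" using g h by (auto simp: GL_def)
  have ic: "mat_inv n g \<in> carrier_mat n n" "mat_inv n h \<in> carrier_mat n n"
    using mat_inv(1)[OF g] mat_inv(1)[OF h] by (auto simp: GL_def)
  have eL: "e' w \<le> L" if "w \<in> ?W'" for w
  proof -
    have "e' w \<le> (\<Sum>b\<in>?S'. N ^ n)"
      unfolding e'_def by (rule sum_mono, rule power_increasing) (auto simp: N_def)
    then show ?thesis by (simp add: L_def)
  qed
  have fW: "finite ?W" "finite ?W'" by (auto intro!: finite_PiE)
  have gen: "(\<Sum>w\<in>?W. t ^ e w * word_term mu g h w)
      = c * t ^ (m * A) * (\<Sum>w\<in>?W'. inverse (t ^ e' w) * word_term ?mu' ?g' ?h' w)" if t: "t \<noteq> 0" for t :: 'k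
  proof -
    define \<zeta> where "\<zeta> i = t ^ (N ^ i)" for i
    define \<zeta>' where "\<zeta>' i = inverse (t ^ (N ^ (n - Suc i)))" for i
    let ?D = "mat_diag n \<zeta>" and ?D' = "mat_diag n (\<lambda>i. inverse (\<zeta> i))"
    let ?X = "h * (?D * g)" and ?Y = "mat_inv n g * (?D' * mat_inv n h)"
    have z0: "\<zeta> i \<noteq> 0" for i using t by (simp add: \<zeta>_def)
    have Xc: "?X \<in> carrier_mat n n" and Yc: "?Y \<in> carrier_mat n n"
      using gc ic by (auto intro!: mult_carrier_mat)
    have dd: "?D * ?D' = 1\<^sub>m n" using z0 by simp
    have Zc: "?D' * mat_inv n h \<in> carrier_mat n n" by (rule mult_carrier_mat[OF mat_diag_dim ic(2)])
    have "g * ?Y = (g * mat_inv n g) * (?D' * mat_inv n h)"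
      by (rule assoc_mult_mat[OF gc(1) ic(1) Zc, symmetric])
    then have gY: "g * ?Y = ?D' * mat_inv n h"
      by (simp only: mat_inv(2)[OF g] left_mult_one_mat[OF Zc])
    have "?X * ?Y = h * (?D * g * ?Y)"
      by (rule assoc_mult_mat[OF gc(2) mult_carrier_mat[OF mat_diag_dim gc(1)] Yc])
    also have "?D * g * ?Y = ?D * (?D' * mat_inv n h)"
      using assoc_mult_mat[OF mat_diag_dim gc(1) Yc] gY by simp
    also have "\<dots> = ?D * ?D' * mat_inv n h"
      by (rule assoc_mult_mat[OF mat_diag_dim mat_diag_dim ic(2), symmetric])
    also have "\<dots> = mat_inv n h" unfolding dd using ic(2) by simp
    finally have XY: "?X * ?Y = 1\<^sub>m n" using mat_inv(2)[OF h] by simp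
    have rD: "transpose_mat (reverse_mat n ?D') = mat_diag n \<zeta>'"
      by (intro eq_matI) (auto simp: reverse_mat_def mat_diag_def \<zeta>_def \<zeta>'_def)
    have rY: "reverse_mat n ?Y = reverse_mat n (mat_inv n g) * (reverse_mat n ?D' * reverse_mat n (mat_inv n h))"
      unfolding reverse_mat_mult[OF ic(1) Zc] reverse_mat_mult[OF mat_diag_dim ic(2)] ..
    have "transpose_mat (reverse_mat n ?Y)
        = transpose_mat (reverse_mat n ?D' * reverse_mat n (mat_inv n h)) * transpose_mat (reverse_mat n (mat_inv n g))"
      unfolding rY by (rule transpose_mult[OF reverse_mat_carrier mult_carrier_mat[OF reverse_mat_carrier reverse_mat_carrier]])
    also have "transpose_mat (reverse_mat n ?D' * reverse_mat n (mat_inv n h)) = ?h' * mat_diag n \<zeta>'"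
      unfolding contragredient_def rD[symmetric] by (rule transpose_mult[of _ n n _ n]) simp_all
    also have "(?h' * mat_diag n \<zeta>') * transpose_mat (reverse_mat n (mat_inv n g)) = ?h' * (mat_diag n \<zeta>' * ?g')"
      unfolding contragredient_def by (rule assoc_mult_mat[of _ n n _ n _ n]) simp_all
    finally have tY: "transpose_mat (reverse_mat n ?Y) = ?h' * (mat_diag n \<zeta>' * ?g')" .
    have cc: "?g' \<in> carrier_mat n n" "?h' \<in> carrier_mat n n" by (simp_all add: contragredient_def)
    have "det ?D = (\<Prod>i\<in>{0..<n}. \<zeta> i)"
      by (subst det_upper_triangular[of _ n]) (auto simp: mat_diag_def diag_mat_def prod.list_conv_set_nth)
    also have "\<dots> = t ^ A" by (simp add: \<zeta>_def A_def power_sum)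
    finally have detD: "det ?D = t ^ A" .
    have detX: "det ?X ^ m = c * t ^ (m * A)"
      using det_mult[OF gc(2) mult_carrier_mat[OF mat_diag_dim gc(1)]] det_mult[OF mat_diag_dim gc(1)]
      by (simp add: detD c_def power_mult_distrib power_mult mult_ac flip: power_mult)
    have "(\<Sum>w\<in>?W. t ^ e w * word_term mu g h w) = column_minors mu ?X"
      unfolding column_minors_generating_function[OF ll(3) gc] ll(4)
      by (simp add: \<zeta>_def e_def power_sum)
    also have "\<dots> = c * t ^ (m * A) * column_minors ?mu' (?h' * (mat_diag n \<zeta>' * ?g'))"
      unfolding column_minors_complement[OF mu Xc Yc XY] detX tY ..
    also have "column_minors ?mu' (?h' * (mat_diag n \<zeta>' * ?g'))
        = (\<Sum>w\<in>?W'. inverse (t ^ e' w) * word_term ?mu' ?g' ?h' w)"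
      unfolding column_minors_generating_function[OF mc(1) cc] mc(5)
      by (simp add: \<zeta>'_def e'_def power_sum prod_inversef[unfolded comp_def, symmetric])
    finally show ?thesis .
  qed
  define P where "P = (\<Sum>w\<in>?W. monom (word_term mu g h w) (e w + L))"
  define Q where "Q = (\<Sum>w\<in>?W'. monom (c * word_term ?mu' ?g' ?h' w) (m * A + (L - e' w)))"
  have "P = Q"
  proof (rule polys_eq_if_eq_off_zero[OF inf])
    fix t :: 'k assume t: "t \<noteq> 0"
    have "poly P t = t ^ L * (\<Sum>w\<in>?W. t ^ e w * word_term mu g h w)"
      by (simp add: P_def poly_sum poly_monom sum_distrib_left power_add mult_ac)
    also have "\<dots> = (\<Sum>w\<in>?W'. c * word_term ?mu' ?g' ?h' w * (t ^ (m * A) * (t ^ L * inverse (t ^ e' w))))"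
      unfolding gen[OF t] by (simp add: sum_distrib_left mult_ac)
    also have "\<dots> = poly Q t"
      unfolding Q_def poly_sum
    proof (rule sum.cong)
      fix w assume "w \<in> ?W'"
      then have "t ^ L * inverse (t ^ e' w) = t ^ (L - e' w)"
        using power_diff[OF t eL] by (simp add: divide_inverse)
      then show "c * word_term ?mu' ?g' ?h' w * (t ^ (m * A) * (t ^ L * inverse (t ^ e' w)))
          = poly (monom (c * word_term ?mu' ?g' ?h' w) (m * A + (L - e' w))) t"
        by (simp only: poly_monom power_add)
    qed simp
    finally show "poly P t = poly Q t" .
  qed
  define E where "E = (\<Sum>i\<in>{0..<n}. lam ! i * N ^ i)"
  define E' where "E' = (\<Sum>i\<in>{0..<n}. (m - lam ! i) * N ^ i)"
  \<comment> \<open>The exponent \<open>m * A\<close> comes from the determinant of the diagonal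
    matrix. Parts of \<open>lam\<close> and of its complement add up to \<open>m\<close>, so the
    coefficient of content \<open>lam\<close> on the left meets that of content
    \<open>complement m lam\<close> on the right.\<close>
  have EE: "E + E' = m * A"
  proof -
    have "lam ! i * N ^ i + (m - lam ! i) * N ^ i = m * N ^ i" if "i < n" for i
      using lam(2) ll(1) that by (simp flip: add_mult_distrib)
    then show ?thesis by (simp add: E_def E'_def A_def sum_distrib_left flip: sum.distrib)
  qed
  have w: "words lam = {w \<in> ?W. e w = E}"
  proof -
    have "w \<in> words lam \<longleftrightarrow> w \<in> ?W \<and> e w = E" for w
      using words_iff_weight[OF ll(1), of N "\<lambda>i. i" w] unfolding ll(2) e_def E_def by (simp add: N_def)
    then show ?thesis by blast
  qed
  have w': "words ?lam' = {w \<in> ?W'. e' w = E'}"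
  proof -
    have "(\<Sum>i\<in>{0..<n}. ?lam' ! i * N ^ (n - Suc i)) = (\<Sum>i\<in>{0..<n}. (m - lam ! (n - Suc i)) * N ^ (n - Suc i))"
      by (rule sum.cong) (simp_all add: lc(4))
    also have "\<dots> = E'"
      unfolding E'_def by (rule sum.reindex_bij_betw[OF bij_betw_reverse])
    finally have "(\<Sum>i\<in>{0..<n}. ?lam' ! i * N ^ (n - Suc i)) = E'" .
    moreover have "inj_on (\<lambda>i. n - Suc i) {0..<n}" using bij_betw_reverse by (rule bij_betw_imp_inj_on)
    ultimately have "w \<in> words ?lam' \<longleftrightarrow> w \<in> ?W' \<and> e' w = E'" for w
      using words_iff_weight[OF lc(1), of N "\<lambda>i. n - Suc i" w] unfolding lc(5) e'_def by (simp add: N_def)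
    then show ?thesis by blast
  qed
  have "coeff P (E + L) = (\<Sum>w\<in>?W. if e w = E then word_term mu g h w else 0)"
    unfolding P_def coeff_sum by (rule sum.cong) auto
  also have "\<dots> = (\<Sum>w\<in>words lam. word_term mu g h w)"
    unfolding w using fW by (simp add: sum.inter_filter)
  finally have 1: "coeff P (E + L) = (\<Sum>w\<in>words lam. word_term mu g h w)" .
  have "coeff Q (E + L) = (\<Sum>w\<in>?W'. if e' w = E' then c * word_term ?mu' ?g' ?h' w else 0)"
    unfolding Q_def coeff_sum
  proof (rule sum.cong)
    fix w assume "w \<in> ?W'"
    from eL[OF this] have "m * A + (L - e' w) = E + L \<longleftrightarrow> e' w = E'" unfolding EE[symmetric] by auto
    then show "coeff (monom (c * word_term ?mu' ?g' ?h' w) (m * A + (L - e' w))) (E + L)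
        = (if e' w = E' then c * word_term ?mu' ?g' ?h' w else 0)" by simp
  qed simp
  also have "\<dots> = (\<Sum>w\<in>words ?lam'. c * word_term ?mu' ?g' ?h' w)"
    unfolding w' using fW by (simp add: sum.inter_filter)
  finally have "coeff Q (E + L) = c * (\<Sum>w\<in>words ?lam'. word_term ?mu' ?g' ?h' w)"
    by (simp add: sum_distrib_left)
  then show ?thesis using 1 \<open>P = Q\<close> by (simp add: c_def)
qed

lemma kernel_row_linear_span:
  assumes u: "u \<in> fn.span B"
    and lin: "\<And>c x y. \<Lambda> (fscale c x + y) = fscale c (\<Lambda> x) + \<Lambda> y" and zero: "\<Lambda> 0 = 0"
  shows "\<Lambda> u \<in> fn.span (\<Lambda> ` B)"
  using u
proof (induction u rule: fn.span_induct_alt)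
  case base
  show ?case unfolding zero by (rule fn.span_zero)
next
  case (step c x y)
  then show ?case
    unfolding lin by (intro fn.span_add[OF fn.span_scale[OF fn.span_base[OF imageI]]])
qed

text \<open>The form is bilinear and the monomials span both spaces of bi-invariant functions, so
  its rank is that of its restriction to monomials. The index set now depends on the partitions only
  through \<open>n\<close>.\<close>

lemma kostka_eq_word_rank:
  assumes inf: "infinite (UNIV :: 'k::field set)" and lam: "lam \<in> partitions n r" and mu: "mu \<in> partitions n r"
  shows "kostka TYPE('k) lam mu
    = kernel_rank (\<lambda>g h. \<Sum>w\<in>words lam. word_term mu g h w) (GL n :: 'k mat set) (GL n)"
proof -
  have l: "length lam = n" "sum_list lam = r" "length mu = n" "sum_list mu = r" "sorted_wrt (\<ge>) mu"
    using lam mu by (auto simp: partitions_def)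
  let ?A = "biinvariant mu lam :: (_ \<Rightarrow> 'k) set" and ?B = "biinvariant lam mu :: (_ \<Rightarrow> 'k) set"
  let ?F = "kostka_form lam mu :: (_ \<Rightarrow> 'k) \<Rightarrow> _"
  have "kernel_rank (\<lambda>g h. ?F (monomial mu lam g) (monomial lam mu h)) (GL n) (GL n) = kernel_rank ?F ?A ?B"
  proof (rule kernel_rank_transport)
    show "monomial mu lam ` GL n \<subseteq> ?A" "monomial lam mu ` GL n \<subseteq> ?B"
      using monomial_biinvariant l by blast+
  next
    fix u assume "u \<in> ?A"
    then have "u \<in> fn.span (monomial mu lam ` GL n)"
      using biinvariant_subset_span_monomials[OF inf l(4,2,3,1)] by blast
    from kernel_row_linear_span[OF this, of "kernel_row ?F ?B"]
    show "kernel_row ?F ?B u \<in> fn.span ((\<lambda>g. kernel_row ?F ?B (monomial mu lam g)) ` GL n)"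
      by (simp add: image_image fun_eq_iff kernel_row_def kostka_form_def coset_sum_def column_sum_def fscale_def
          algebra_simps sum.distrib sum_distrib_left)
  next
    fix v assume "v \<in> ?B"
    then have "v \<in> fn.span (monomial lam mu ` GL n)"
      using biinvariant_subset_span_monomials[OF inf l(2,4,1,3)] by blast
    from kernel_row_linear_span[OF this, of "kernel_row (\<lambda>y x. ?F x y) ?A"]
    show "kernel_row (\<lambda>y x. ?F x y) ?A v \<in> fn.span ((\<lambda>h. kernel_row (\<lambda>y x. ?F x y) ?A (monomial lam mu h)) ` GL n)"
      by (simp add: image_image fun_eq_iff kernel_row_def kostka_form_def coset_sum_def fscale_def
          algebra_simps sum.distrib sum_distrib_left)
  qed
  then show ?thesis
    unfolding kostka_eq_kernel_rank[OF l(2,4,5)] kostka_form_monomial[OF l(2,4)] by simp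
qed

lemma kostka_complement:
  assumes inf: "infinite (UNIV :: 'k::field set)"
    and lam: "lam \<in> partitions n r" "\<forall>a\<in>set lam. a \<le> m"
    and mu: "mu \<in> partitions n r" "\<forall>a\<in>set mu. a \<le> m"
  shows "kostka TYPE('k) lam mu = kostka TYPE('k) (complement m lam) (complement m mu)"
proof -
  let ?K = "\<lambda>g h :: 'k mat. \<Sum>w\<in>words (complement m lam). word_term (complement m mu) g h w"
  let ?G = "GL n :: 'k mat set"
  have "kostka TYPE('k) lam mu = kernel_rank (\<lambda>g h. \<Sum>w\<in>words lam. word_term mu g h w) ?G ?G"
    by (rule kostka_eq_word_rank[OF inf lam(1) mu(1)])
  also have "\<dots> = kernel_rank (\<lambda>g h. det g ^ m * det h ^ m * ?K (contragredient n g) (contragredient n h)) ?G ?G"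
    by (rule kernel_rank_cong) (rule word_sum_complement[OF inf lam mu])
  also have "\<dots> = kernel_rank (\<lambda>g h. ?K (contragredient n g) (contragredient n h)) ?G ?G"
    by (rule kernel_rank_scale) (auto simp: GL_def)
  also have "\<dots> = kernel_rank ?K ?G ?G"
    by (rule kernel_rank_surj[OF contragredient_image contragredient_image])
  also have "\<dots> = kostka TYPE('k) (complement m lam) (complement m mu)"
    by (rule kostka_eq_word_rank[OF inf complement_in_partitions[OF lam] complement_in_partitions[OF mu], symmetric])
  finally show ?thesis .
qed

section \<open>Row and column removal\<close>

lemma partition_le_hd: "\<lbrakk>lam \<in> partitions n r; a \<in> set lam\<rbrakk> \<Longrightarrow> a \<le> hd lam"
  by (cases lam) (auto simp: partitions_def)

lemma partition_ge_last: "\<lbrakk>lam \<in> partitions n r; a \<in> set lam\<rbrakk> \<Longrightarrow> last lam \<le> a"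
  by (cases lam rule: rev_cases) (auto simp: partitions_def sorted_wrt_append)

text \<open>A trailing zero is an empty row: Young subgroup and column stabilizer are unchanged, so
  the modules agree as sets, including the chosen Young module.\<close>

lemma kostka_append_zero: "kostka TYPE('k::field) (lam @ [0]) (mu @ [0]) = kostka TYPE('k) lam mu"
proof -
  have tr: "tableau_row (lam @ [0]) i = (if i < length lam then tableau_row lam i else {})"
    if "i < length (lam @ [0])" for i and lam :: "nat list"
    using that by (auto simp: tableau_row_def nth_append)
  have tc: "tableau_column (lam @ [0]) j = tableau_column lam j" if "1 \<le> j" for j and lam :: "nat list"
    using that by (auto simp: tableau_column_def nth_append less_Suc_eq)
  have y: "young_subgroup (lam @ [0]) = young_subgroup lam" for lam :: "nat list"
    unfolding young_subgroup_def by (auto simp: tr)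
  have cs: "column_stabilizer (lam @ [0]) = column_stabilizer lam" for lam :: "nat list"
    unfolding column_stabilizer_def by (auto simp: tc)
  have M: "perm_module (lam @ [0]) = (perm_module lam :: (_ \<Rightarrow> 'k) set)" for lam
    by (simp add: perm_module_def y)
  have "specht_module (lam @ [0]) = (specht_module lam :: (_ \<Rightarrow> 'k) set)" for lam
    by (simp add: specht_module_def polytabloid_def tabloid_def y cs)
  then have "young_module (mu @ [0]) = (young_module mu :: (_ \<Rightarrow> 'k) set)"
    by (simp add: young_module_def M)
  then show ?thesis by (simp add: kostka_def M)
qed

lemma kostka_remove_column:
  assumes inf: "infinite (UNIV :: 'k::field set)"
    and lam: "lam \<in> partitions n r" "last lam \<noteq> 0" and mu: "mu \<in> partitions n r" "last mu \<noteq> 0"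
  shows "kostka TYPE('k) lam mu = kostka TYPE('k) (remove_column lam) (remove_column mu)"
proof -
  \<comment> \<open>A common bound on the parts; positivity of the parts bounds the complements by
    \<open>m - 1\<close>. For empty lists \<open>hd\<close> and \<open>last\<close> are unspecified,
    but then there is no part to bound.\<close>
  define m where "m = max (hd lam) (hd mu)"
  have m: "\<forall>a\<in>set lam. a \<le> m" "\<forall>a\<in>set mu. a \<le> m"
    using partition_le_hd lam mu by (auto simp: m_def le_max_iff_disj)
  have pos: "\<forall>a\<in>set lam. 1 \<le> a" "\<forall>a\<in>set mu. 1 \<le> a"
    using partition_ge_last lam mu by (metis One_nat_def Suc_leI gr0I le_trans)+
  have c: "complement (m - 1) (complement m k) = remove_column k" "\<forall>a\<in>set (complement m k). a \<le> m - 1"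
    if "\<forall>a\<in>set k. a \<le> m" "\<forall>a\<in>set k. 1 \<le> a" for k
    using that by (auto simp: complement_def remove_column_def rev_map)
  have "kostka TYPE('k) lam mu = kostka TYPE('k) (complement m lam) (complement m mu)"
    by (rule kostka_complement[OF inf lam(1) m(1) mu(1) m(2)])
  also have "\<dots> = kostka TYPE('k) (complement (m - 1) (complement m lam)) (complement (m - 1) (complement m mu))"
    by (rule kostka_complement[OF inf complement_in_partitions[OF lam(1) m(1)] c(2)[OF m(1) pos(1)]
          complement_in_partitions[OF mu(1) m(2)] c(2)[OF m(2) pos(2)]])
  finally show ?thesis unfolding c(1)[OF m(1) pos(1)] c(1)[OF m(2) pos(2)] .
qed

lemma kostka_remove_row:
  assumes inf: "infinite (UNIV :: 'k::field set)"
    and lam: "lam \<in> partitions n r" and mu: "mu \<in> partitions n r" and hd: "hd lam = hd mu"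
  shows "kostka TYPE('k) lam mu = kostka TYPE('k) (remove_row lam) (remove_row mu)"
proof (cases n)
  case 0
  then show ?thesis using lam mu by (simp add: partitions_def remove_row_def)
next
  case (Suc n')
  define m where "m = hd mu"
  have tl: "k = m # tl k \<and> tl k \<in> partitions n' (r - m) \<and> (\<forall>a\<in>set k. a \<le> m) \<and> (\<forall>a\<in>set (tl k). a \<le> m)"
    if "k \<in> partitions n r" "hd k = m" for k
    using that Suc partition_le_hd[OF that(1)] by (cases k) (auto simp: partitions_def)
  note l = tl[OF lam hd[folded m_def]] and k = tl[OF mu m_def[symmetric]]
  have c: "complement m (m # xs) = complement m xs @ [0]" for xs by (simp add: complement_def)
  have "kostka TYPE('k) lam mu = kostka TYPE('k) (complement m lam) (complement m mu)"
    using l k by (intro kostka_complement[OF inf lam _ mu]) auto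
  also have "\<dots> = kostka TYPE('k) (complement m (tl lam)) (complement m (tl mu))"
    using l k c kostka_append_zero by metis
  also have "\<dots> = kostka TYPE('k) (tl lam) (tl mu)"
    using l k by (intro kostka_complement[OF inf, symmetric]) auto
  finally show ?thesis by (simp add: remove_row_def)
qed

theorem corollary9p1:
  assumes "infinite (UNIV :: 'k::field set)"
  shows "(\<forall>n r m. \<forall>lam\<in>partitions n r. \<forall>mu\<in>partitions n r.
            hd lam \<le> m \<and> hd mu \<le> m \<longrightarrow>
            kostka TYPE('k) lam mu = kostka TYPE('k) (complement m lam) (complement m mu)) \<and>
         (\<forall>n r. \<forall>lam\<in>partitions n r. \<forall>mu\<in>partitions n r.
            last lam \<noteq> 0 \<and> last mu \<noteq> 0 \<longrightarrow>
            kostka TYPE('k) lam mu = kostka TYPE('k) (remove_column lam) (remove_column mu)) \<and>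
         (\<forall>n r. \<forall>lam\<in>partitions n r. \<forall>mu\<in>partitions n r.
            hd lam = hd mu \<longrightarrow>
            kostka TYPE('k) lam mu = kostka TYPE('k) (remove_row lam) (remove_row mu))"
proof (intro conjI allI ballI impI)
  fix n r m lam mu
  assume lam: "lam \<in> partitions n r" and mu: "mu \<in> partitions n r" and hd: "hd lam \<le> m \<and> hd mu \<le> m"
  show "kostka TYPE('k) lam mu = kostka TYPE('k) (complement m lam) (complement m mu)"
  proof (rule kostka_complement[OF assms lam _ mu])
    show "\<forall>a\<in>set lam. a \<le> m" "\<forall>a\<in>set mu. a \<le> m"
      using hd partition_le_hd[OF lam] partition_le_hd[OF mu] by (meson le_trans)+
  qed
qed (use kostka_remove_column[OF assms] kostka_remove_row[OF assms] in blast)+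

end
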